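(* (a) There are $2^{\aleph_0}$ many pairwise non-homeomorphic $\omega$-cc graph-like continua. (b) There are $2^{\aleph_0}$ many pairwise non-homeomorphic graph-like continua which are $\omega$-ac but not $2$-cc.
   Context: A graph-like continuum is a continuum (compact connected metric space) $X$ with a closed zero-dimensional subset $V$ such that $X\setminus V\cong E\times(0,1)$ for some discrete set $E$. A space is $n$-ac (resp. $n$-cc) if any at most $n$ of its points lie on a common arc (resp. simple closed curve); it is $\omega$-ac (resp. $\omega$-cc) if it is $n$-ac (resp. $n$-cc) for all $n\in\mathbb{N}$. *)

theory Defs
  imports "HOL-Analysis.Analysis" "HOL-Library.Equipollence"
begin

definition continuum :: "'a topology \<Rightarrow> bool" where
  "continuum X \<longleftrightarrow>
     topspace X \<noteq> {} \<and> metrizable_space X \<and> compact_space X \<and> connected_space X"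

(* Taking the discrete set E inside the point type loses no generality: a homeomorphism from
   E \<times> (0,1) onto X - V embeds any index set E into X - V by e \<mapsto> image of (e, 1/2).
   Since X is compact and nonempty, V cannot be empty, so small inductive dimension
   at most 0 means exactly 0 here. *)
definition graph_like_continuum :: "'a topology \<Rightarrow> bool" where
  "graph_like_continuum X \<longleftrightarrow>
     continuum X \<and>
     (\<exists>V. closedin X V \<and> subtopology X V dim_le 0 \<and>
        (\<exists>E :: 'a set.
           subtopology X (topspace X - V) homeomorphic_space
             prod_topology (discrete_topology E) (top_of_set {0<..<1::real})))"

definition arc_in :: "'a topology \<Rightarrow> 'a set \<Rightarrow> bool" where
  "arc_in X A \<longleftrightarrow>
     A \<subseteq> topspace X \<and> subtopology X A homeomorphic_space top_of_set {0..1::real}"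

definition simple_closed_curve_in :: "'a topology \<Rightarrow> 'a set \<Rightarrow> bool" where
  "simple_closed_curve_in X C \<longleftrightarrow>
     C \<subseteq> topspace X \<and> subtopology X C homeomorphic_space top_of_set (sphere (0::complex) 1)"

definition n_ac :: "nat \<Rightarrow> 'a topology \<Rightarrow> bool" where
  "n_ac n X \<longleftrightarrow>
     (\<forall>F. F \<subseteq> topspace X \<and> finite F \<and> card F \<le> n \<longrightarrow> (\<exists>A. arc_in X A \<and> F \<subseteq> A))"

definition n_cc :: "nat \<Rightarrow> 'a topology \<Rightarrow> bool" where
  "n_cc n X \<longleftrightarrow>
     (\<forall>F. F \<subseteq> topspace X \<and> finite F \<and> card F \<le> n \<longrightarrow>
        (\<exists>C. simple_closed_curve_in X C \<and> F \<subseteq> C))"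

definition omega_ac :: "'a topology \<Rightarrow> bool" where
  "omega_ac X \<longleftrightarrow> (\<forall>n. n_ac n X)"

definition omega_cc :: "'a topology \<Rightarrow> bool" where
  "omega_cc X \<longleftrightarrow> (\<forall>n. n_cc n X)"

(* A set of 2^aleph_0 pairwise non-homeomorphic spaces satisfying P. Every compact metrizable
   space embeds in the Hilbert cube, so the point type nat \<Rightarrow> real carries a copy of each of
   them; the topologies on it are arbitrary. The type nat set has 2^aleph_0 elements. *)
definition continuum_many_nonhomeomorphic :: "((nat \<Rightarrow> real) topology \<Rightarrow> bool) \<Rightarrow> bool" where
  "continuum_many_nonhomeomorphic P \<longleftrightarrow>
     (\<exists>\<X> :: (nat \<Rightarrow> real) topology set.
        \<X> \<approx> (UNIV :: nat set set) \<and>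
        (\<forall>X\<in>\<X>. P X) \<and>
        pairwise (\<lambda>X Y. \<not> X homeomorphic_space Y) \<X>)"

end

theory Submission
  imports Defs "HOL-Library.Sublist"
begin

text \<open>
  A blob is the Cantor set together with its gaps and, for every node of the Cantor
  construction, one more edge between the two halves of that node. Each node is then attached
  to the rest by four edges. For each of the three ways to pair the four terminals there are two
  disjoint arcs in the node that realise the pairing and contain a prescribed finite set: such arcs
  are glued from arcs in the two halves, and in deep nodes the finite set has at most one point.
  Joining two terminals of a blob by an edge gives a bead, which can be traversed from the first to
  the last point through any finite set. Hence a sequence of beads that converges to a point
  is \<open>\<omega>\<close>-ac, and it is \<open>\<omega>\<close>-cc after closing it up by an edge;
  without this edge some links between beads are bridges. Every bead has a vertex, its
  hub, which the traversing arcs can avoid. Therefore the hubs of \<open>m\<close> beads may be identified.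
  This creates a point of order between \<open>2m\<close> and \<open>4m\<close>, while the order of all points other than the hubs is at
  most \<open>4\<close>, so a set of natural numbers can be coded by the sizes \<open>m\<close>.
\<close>

section \<open>Arcs\<close>

text \<open>An arc passes each point at most once, so identifying the hubs of several beads is
  harmless only if every bead can be traversed without its hub; the set to be avoided is therefore
  carried through the construction of all arcs. The terminals 1/4 and 3/4 come from the
  self-similarity: 3/4 of the left half is 1/4 of the node, and 1/4 of the right half is 3/4 of the
  node. Hence four of the eight terminals of the halves are those of the node, and the other four
  are the ends of its gap and its chord. With \<open>a\<close>, \<open>b\<close>, \<open>c\<close>
  for the pairings 0-1/4, 0-1, 0-3/4, a node gets \<open>a\<close> from \<open>a\<close> and
  \<open>c\<close> in its halves, \<open>b\<close> from \<open>a\<close> and \<open>a\<close>,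
  \<open>c\<close> from \<open>a\<close> and \<open>b\<close>, so the three are proved together. The
  spaces lie in a countable product of lines, where vertices have integer coordinates and each
  coordinate varies along finitely many edges only; compactness and zero-dimensionality are then
  checked coordinate by coordinate. A hub is the end of no edge, so it has no degree to be counted;
  its order is bounded by cuts from above and by arcs that meet only in the hub from below.\<close>

definition arc_from :: "'a::topological_space set \<Rightarrow> 'a \<Rightarrow> 'a \<Rightarrow> bool" where
  "arc_from A u v \<longleftrightarrow> (\<exists>g. arc g \<and> path_image g = A \<and> pathstart g = u \<and> pathfinish g = v)"

lemma arc_from_sym: "arc_from A u v \<Longrightarrow> arc_from A v u"
  unfolding arc_from_def by (metis arc_reversepath path_image_reversepath pathfinish_reversepath pathstart_reversepath)

lemma arc_from_join:
  assumes "arc_from A u v" "arc_from B v w" "A \<inter> B \<subseteq> {v}"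
  shows "arc_from (A \<union> B) u w"
  using assms unfolding arc_from_def
  by (metis arc_join path_image_join pathfinish_join pathstart_join)

lemma arc_from_ends: "arc_from A u v \<Longrightarrow> u \<in> A \<and> v \<in> A \<and> u \<noteq> v"
  unfolding arc_from_def
  by (metis arc_distinct_ends pathfinish_in_path_image pathstart_in_path_image)

lemma arc_from_mem: "arc_from A u v \<Longrightarrow> u \<in> A" "arc_from A u v \<Longrightarrow> v \<in> A"
  using arc_from_ends by blast+

lemma arc_from_connected: "arc_from A u v \<Longrightarrow> connected A"
  unfolding arc_from_def using connected_arc_image by blast

lemma arc_from_image:
  fixes g :: "real \<Rightarrow> 'a::topological_space"
  assumes "continuous_on {a..b} g" "inj_on g {a..b}" "a < b"
  shows "arc_from (g ` {a..b}) (g a) (g b)"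
proof -
  define h where "h = (\<lambda>s::real. a + (b - a) * s)"
  have h: "h ` {0..1} = {a..b}"
  proof
    show "h ` {0..1} \<subseteq> {a..b}"
    proof clarsimp
      fix x :: real assume x: "0 \<le> x" "x \<le> 1"
      have "(b - a) * x \<le> b - a" using mult_left_mono[of x 1 "b - a"] x assms(3) by simp
      moreover have "0 \<le> (b - a) * x" using x assms(3) by simp
      ultimately show "a \<le> h x \<and> h x \<le> b" unfolding h_def by linarith
    qed
    show "{a..b} \<subseteq> h ` {0..1}"
    proof
      fix x assume "x \<in> {a..b}"
      then have "x = h ((x - a) / (b - a))" "(x - a) / (b - a) \<in> {0..1}"
        using assms(3) by (auto simp: h_def)
      then show "x \<in> h ` {0..1}" by blast
    qed
  qed
  have "inj_on h {0..1}" using assms(3) by (auto simp: h_def inj_on_def)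
  then have "inj_on (g \<circ> h) {0..1}" using assms(2) h by (simp add: comp_inj_on)
  moreover have "continuous_on {0..1} (g \<circ> h)"
  proof (rule continuous_on_compose)
    show "continuous_on {0..1} h" unfolding h_def by (intro continuous_intros)
    show "continuous_on (h ` {0..1}) g" using assms(1) h by simp
  qed
  ultimately have "arc (g \<circ> h)" by (simp add: arc_def path_def)
  moreover have "path_image (g \<circ> h) = g ` {a..b}" by (simp only: path_image_def image_comp [symmetric] h)
  moreover have "pathstart (g \<circ> h) = g a" "pathfinish (g \<circ> h) = g b"
    by (auto simp: pathstart_def pathfinish_def h_def)
  ultimately show ?thesis unfolding arc_from_def by metis
qed

lemma homeomorphic_imp_homeomorphic_space:
  assumes "S homeomorphic T"
  shows "top_of_set S homeomorphic_space top_of_set T"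
proof -
  obtain f g where fg: "homeomorphism S T f g" using assms homeomorphic_def by blast
  then have "homeomorphic_maps (top_of_set S) (top_of_set T) f g"
    unfolding homeomorphic_maps_def homeomorphism_def
    by (auto simp: continuous_map_in_subtopology)
  then show ?thesis using homeomorphic_space_def by blast
qed

lemma arc_in_arc_from:
  fixes X :: "'a::t2_space set"
  assumes "arc_from A u v" "A \<subseteq> X"
  shows "arc_in (top_of_set X) A"
proof -
  have "A homeomorphic {0..1::real}"
    using assms(1) unfolding arc_from_def by (metis homeomorphic_arc_image_interval zero_less_one)
  then show ?thesis
    using assms(2) by (auto simp: arc_in_def subtopology_subtopology Int_absorb1 homeomorphic_imp_homeomorphic_space)
qed

lemma simple_closed_curve_in_arcs:
  fixes X :: "'a::t2_space set"
  assumes "arc_from A u v" "arc_from B u v" "A \<inter> B \<subseteq> {u, v}" "A \<union> B \<subseteq> X"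
  shows "simple_closed_curve_in (top_of_set X) (A \<union> B)"
proof -
  obtain g where g: "arc g" "path_image g = A" "pathstart g = u" "pathfinish g = v"
    using assms(1) unfolding arc_from_def by blast
  obtain h where h: "arc h" "path_image h = B" "pathstart h = v" "pathfinish h = u"
    using arc_from_sym [OF assms(2)] unfolding arc_from_def by blast
  have "simple_path (g +++ h)"
    by (rule simple_path_join_loop) (use g h assms in auto)
  moreover have "path_image (g +++ h) = A \<union> B" using g h by (simp add: path_image_join)
  moreover have "pathfinish (g +++ h) = pathstart (g +++ h)" using g h by simp
  ultimately have "(A \<union> B) homeomorphic sphere (0::complex) 1"
    by (metis homeomorphic_simple_path_image_circle zero_less_one)
  then show ?thesis
    using assms(4) by (auto simp: simple_closed_curve_in_def subtopology_subtopology Int_absorb1 homeomorphic_imp_homeomorphic_space)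
qed

section \<open>Concatenating infinitely many arcs\<close>

lemma continuous_on_join_unit_intervals:
  fixes g :: "nat \<Rightarrow> real \<Rightarrow> 'a::topological_space"
  assumes "\<And>k. continuous_on {0..1} (g k)" "\<And>k. g k 1 = g (Suc k) 0"
  shows "continuous_on {0..real n} (\<lambda>t. g (nat \<lfloor>t\<rfloor>) (t - real (nat \<lfloor>t\<rfloor>)))" (is "continuous_on _ ?G")
proof (induction n)
  case 0
  then show ?case by simp
next
  case (Suc n)
  have "continuous_on {real n..real (Suc n)} ?G"
  proof (rule continuous_on_eq)
    show "continuous_on {real n..real (Suc n)} (\<lambda>t. g n (t - real n))"
      by (rule continuous_on_compose2 [OF assms(1)]) (auto intro!: continuous_intros)
    fix t assume t: "t \<in> {real n..real (Suc n)}"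
    show "g n (t - real n) = ?G t"
    proof (cases "t = real (Suc n)")
      case True
      have "nat \<lfloor>t\<rfloor> = Suc n" using True by simp
      then show ?thesis using True assms(2)[of n] by simp
    next
      case False
      then have "\<lfloor>t\<rfloor> = int n" using t by (intro floor_unique) auto
      then show ?thesis by simp
    qed
  qed
  moreover have "{0..real (Suc n)} = {0..real n} \<union> {real n..real (Suc n)}" by auto
  ultimately show ?case using Suc by (metis closed_real_atLeastAtMost continuous_on_closed_Un)
qed

text \<open>The arcs are run through one per unit of time on a half-line, and s / (1 - s) compresses
  this half-line to [0, 1). Since the sets \<open>C k\<close> shrink to \<open>q\<close>, the value
  \<open>q\<close> at 1 keeps the map continuous.\<close>

lemma arc_from_infinite_join:
  fixes C :: "nat \<Rightarrow> 'a::t2_space set"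
  assumes arcs: "\<And>k. arc_from (C k) (p k) (p (Suc k))"
    and adj: "\<And>k. C k \<inter> C (Suc k) \<subseteq> {p (Suc k)}"
    and dis: "\<And>j k. Suc j < k \<Longrightarrow> C j \<inter> C k = {}"
    and q: "\<And>k. q \<notin> C k"
    and conv: "\<And>U. open U \<Longrightarrow> q \<in> U \<Longrightarrow> \<exists>N. \<forall>k\<ge>N. C k \<subseteq> U"
  shows "arc_from (insert q (\<Union>k. C k)) (p 0) q"
proof -
  obtain g where g: "\<And>k. arc (g k)" "\<And>k. path_image (g k) = C k" "\<And>k. pathstart (g k) = p k"
      "\<And>k. pathfinish (g k) = p (Suc k)"
    using arcs unfolding arc_from_def by metis
  have g0: "g k 0 = p k" and g1: "g k 1 = p (Suc k)" for k
    using g(3,4)[of k] by (auto simp: pathstart_def pathfinish_def)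
  have gC: "g k ` {0..1} = C k" for k using g(2)[of k] by (simp add: path_image_def)
  define H where "H = (\<lambda>t. g (nat \<lfloor>t\<rfloor>) (t - real (nat \<lfloor>t\<rfloor>)))"
  define G where "G = (\<lambda>s. if s < 1 then H (s / (1 - s)) else q)"
  have Hin: "H t \<in> C (nat \<lfloor>t\<rfloor>)" if "0 \<le> t" for t
    unfolding H_def gC[symmetric] using that by (intro imageI) (simp, linarith)
  have fr: "real (nat \<lfloor>t\<rfloor>) \<le> t \<and> t < real (nat \<lfloor>t\<rfloor>) + 1" if "0 \<le> t" for t :: real
    using that by linarith
  have Hinj: "s = t" if st: "0 \<le> s" "s \<le> t" and eq: "H s = H t" for s t
  proof -
    define i where "i = nat \<lfloor>s\<rfloor>"
    define j where "j = nat \<lfloor>t\<rfloor>"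
    have ij: "i \<le> j" using st unfolding i_def j_def by (intro nat_mono floor_mono)
    have mem: "H s \<in> C i" "H s \<in> C j" using Hin[of s] Hin[of t] st eq by (auto simp: i_def j_def)
    have fs: "s - real i \<in> {0..1}" "s - real i < 1" "t - real j \<in> {0..1}"
      using fr[of s] fr[of t] st unfolding i_def[symmetric] j_def[symmetric] atLeastAtMost_iff by linarith+
    have inj: "inj_on (g k) {0..1}" for k using g(1)[of k] by (simp add: arc_def)
    consider "i = j" | "j = Suc i" | "Suc i < j" using ij by linarith
    then show ?thesis
    proof cases
      case 1
      then have "g i (s - real i) = g i (t - real i)" using eq unfolding H_def i_def[symmetric] j_def[symmetric] by simp
      then show ?thesis using inj_onD [OF inj] fs 1 by fastforce
    next
      case 2
      then have "H s = p (Suc i)" using adj[of i] mem by auto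
      then have "g i (s - real i) = g i 1" unfolding H_def i_def[symmetric] g1 .
      then have "s - real i = 1" using inj_onD [OF inj] fs by fastforce
      then show ?thesis using fs by simp
    next
      case 3
      then show ?thesis using dis[of i j] mem by auto
    qed
  qed
  have Gimg: "G ` {0..1} = insert q (\<Union>k. C k)"
  proof
    show "G ` {0..1} \<subseteq> insert q (\<Union>k. C k)"
    proof clarsimp
      fix s :: real assume s: "0 \<le> s" "s \<le> 1" "\<forall>k. G s \<notin> C k"
      then show "G s = q" using Hin[of "s / (1 - s)"] by (auto simp: G_def split: if_splits)
    qed
    have "x \<in> G ` {0..1}" if "x \<in> C k" for x k
    proof -
      have "x \<in> g k ` {0..1}" using gC[of k] that by simp
      then obtain r where r: "r \<in> {0..1}" "g k r = x" by blast
      obtain t where t: "0 \<le> t" "H t = x"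
      proof (cases "r = 1")
        case True
        show ?thesis by (rule that[of "real (Suc k)"]) (use r True g0 g1 in \<open>auto simp: H_def simp del: of_nat_Suc\<close>)
      next
        case False
        then have "\<lfloor>real k + r\<rfloor> = int k" using r by (intro floor_unique) auto
        then show ?thesis by (intro that[of "real k + r"]) (use r in \<open>auto simp: H_def\<close>)
      qed
      have "G (t / (1 + t)) = H t" using t(1) by (simp add: G_def divide_simps)
      moreover have "t / (1 + t) \<in> {0..1}" using t(1) by simp
      ultimately show ?thesis using t(2) by (metis image_eqI)
    qed
    moreover have "q \<in> G ` {0..1}" by (rule image_eqI[of _ _ 1]) (auto simp: G_def)
    ultimately show "insert q (\<Union>k. C k) \<subseteq> G ` {0..1}" by auto
  qed
  have mono: "s / (1 - s) \<le> t / (1 - t)" if "0 \<le> s" "s \<le> t" "t < 1" for s t :: real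
    using that by (intro frac_le) auto
  have "inj_on G {0..1}"
  proof (rule linorder_inj_onI)
    fix s t :: real assume st: "s < t" "s \<in> {0..1}" "t \<in> {0..1}"
    show "G s \<noteq> G t"
    proof (cases "t < 1")
      case True
      have "s / (1 - s) \<noteq> t / (1 - t)" using st True by (auto simp: field_simps)
      then show ?thesis using Hinj[OF _ mono[of s t]] st True by (auto simp: G_def)
    next
      case False
      then show ?thesis using Hin[of "s / (1 - s)"] q st by (auto simp: G_def)
    qed
  qed auto
  moreover have "continuous_on {0..1} G"
  proof (rule continuous_on_eq_continuous_within[THEN iffD2], rule ballI)
    fix s :: real assume s: "s \<in> {0..1}"
    show "continuous (at s within {0..1}) G"
    proof (cases "s < 1")
      case True
      \<comment> \<open>Continuity at \<open>s\<close> is checked on \<open>{0..c}\<close> with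
        \<open>c\<close> halfway between \<open>s\<close> and 1. There the rescaled parameter is at
        most (1 + s) / (1 - s), hence at most \<open>n\<close>, so only finitely many arcs
        occur.\<close>
      define n where "n = nat \<lceil>2 / (1 - s)\<rceil>"
      define c where "c = (1 + s) / 2"
      have c: "s < c" "c < 1" using True by (auto simp: c_def)
      have cn: "c / (1 - c) \<le> real n"
      proof -
        have "c / (1 - c) = (1 + s) / (1 - s)" using True by (simp add: c_def divide_simps) (auto simp: algebra_simps)
        also have "\<dots> \<le> 2 / (1 - s)" using True by (intro divide_right_mono) auto
        also have "\<dots> \<le> real n" unfolding n_def by linarith
        finally show ?thesis .
      qed
      have "continuous_on {0..c} (\<lambda>s. H (s / (1 - s)))"
      proof (rule continuous_on_compose2[of "{0..real n}" H])
        show "continuous_on {0..real n} H" unfolding H_def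
          by (rule continuous_on_join_unit_intervals) (use g g0 g1 in \<open>auto simp: arc_def path_def\<close>)
        show "continuous_on {0..c} (\<lambda>s. s / (1 - s))" using c by (auto intro!: continuous_intros)
        show "(\<lambda>s. s / (1 - s)) ` {0..c} \<subseteq> {0..real n}"
        proof (rule image_subsetI)
          fix x assume x: "x \<in> {0..c}"
          then have "x / (1 - x) \<le> real n" using mono[of x c] cn c by (metis atLeastAtMost_iff order_trans)
          moreover have "0 \<le> x / (1 - x)" using x c by auto
          ultimately show "x / (1 - x) \<in> {0..real n}" by simp
        qed
      qed
      then have "continuous_on {0..c} G"
        by (rule continuous_on_eq) (use c in \<open>auto simp: G_def\<close>)
      then have "continuous (at s within {0..c}) G" using s c by (auto simp: continuous_on_eq_continuous_within)
      moreover have "at s within {0..c} = at s within {0..1}"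
        by (rule at_within_nhd[of _ "{..<c}"]) (use c in auto)
      ultimately show ?thesis by simp
    next
      case False
      then have s1: "s = 1" using s by simp
      show ?thesis unfolding continuous_within s1
      proof (rule topological_tendstoI)
        fix U assume U: "open U" "G 1 \<in> U"
        then obtain N where N: "\<forall>k\<ge>N. C k \<subseteq> U" using conv[of U] by (auto simp: G_def)
        \<comment> \<open>N / (1 + N) is the parameter that s / (1 - s) sends to \<open>N\<close>;
          beyond it only arcs with index at least \<open>N\<close> occur.\<close>
        have *: "G x \<in> U" if "x \<in> {0..1}" "real N / (1 + real N) < x" for x
        proof (cases "x < 1")
          case True
          have "real N \<le> x / (1 - x)" using that True by (simp add: field_simps)
          then have "N \<le> nat \<lfloor>x / (1 - x)\<rfloor>" by (simp add: le_nat_floor)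
          then show ?thesis using Hin[of "x / (1 - x)"] N True that by (auto simp: G_def)
        next
          case False
          then show ?thesis using U by (auto simp: G_def)
        qed
        have "open {real N / (1 + real N)<..}" "(1::real) \<in> {real N / (1 + real N)<..}" by auto
        then show "\<forall>\<^sub>F x in at 1 within {0..1}. G x \<in> U"
          unfolding eventually_at_topological using * by (metis greaterThan_iff)
      qed
    qed
  qed
  ultimately have "arc_from (G ` {0..1}) (G 0) (G 1)" by (intro arc_from_image) auto
  moreover have "G 0 = p 0" by (simp add: G_def H_def g0)
  ultimately show ?thesis unfolding Gimg by (simp add: G_def)
qed

text \<open>A finite subcover of \<open>S\<close> already covers all but finitely many of the
  \<open>T i\<close>, and the remaining ones have a compact union.\<close>

lemma compact_UN_converging:
  assumes "compact S" "\<And>i. i \<in> I \<Longrightarrow> compact (T i)"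
    and "\<And>U. open U \<Longrightarrow> S \<subseteq> U \<Longrightarrow> finite {i \<in> I. \<not> T i \<subseteq> U}"
  shows "compact (S \<union> (\<Union>i\<in>I. T i))"
proof (rule compactI)
  fix C assume C: "\<forall>t\<in>C. open t" "S \<union> (\<Union>i\<in>I. T i) \<subseteq> \<Union>C"
  obtain D where D: "D \<subseteq> C" "finite D" "S \<subseteq> \<Union>D"
    using compactE[OF assms(1), of C] C by (metis Un_subset_iff)
  define J where "J = {i \<in> I. \<not> T i \<subseteq> \<Union>D}"
  have "finite J" unfolding J_def by (rule assms(3)) (use C D in auto)
  then have "compact (\<Union>i\<in>J. T i)" using assms(2) by (intro compact_UN) (auto simp: J_def)
  then obtain D' where D': "D' \<subseteq> C" "finite D'" "(\<Union>i\<in>J. T i) \<subseteq> \<Union>D'"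
  proof (rule compactE)
    show "(\<Union>i\<in>J. T i) \<subseteq> \<Union>C" using C by (auto simp: J_def)
  qed (use C in auto)
  have "S \<union> (\<Union>i\<in>I. T i) \<subseteq> \<Union>(D \<union> D')"
  proof
    fix x assume "x \<in> S \<union> (\<Union>i\<in>I. T i)"
    then consider "x \<in> S" | i where "i \<in> I" "x \<in> T i" by auto
    then show "x \<in> \<Union>(D \<union> D')"
    proof cases
      case (2 i)
      show ?thesis
      proof (cases "T i \<subseteq> \<Union>D")
        case False
        then have "i \<in> J" using 2 by (simp add: J_def)
        then show ?thesis using D'(3) 2 by blast
      qed (use 2 in blast)
    qed (use D in auto)
  qed
  then show "\<exists>C'\<subseteq>C. finite C' \<and> S \<union> (\<Union>i\<in>I. T i) \<subseteq> \<Union>C'"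
    using D D' by (intro exI[of _ "D \<union> D'"]) auto
qed


section \<open>The Cantor set and its nodes\<close>

text \<open>
  A list of Booleans addresses an interval of the ternary Cantor construction (\<open>True\<close> stands for the
  right third). The map \<open>pos w\<close> parametrises this interval, \<open>ramp w\<close> climbs from 0 to 1 across its
  middle third, and on the Cantor set \<open>node w\<close> is the indicator function of the interval.
\<close>

primrec pos :: "bool list \<Rightarrow> real \<Rightarrow> real" where
  "pos [] t = t"
| "pos (b # w) t = (pos w t + 2 * of_bool b) / 3"

definition clamp :: "real \<Rightarrow> real" where "clamp t = max 0 (min 1 t)"

primrec ramp :: "bool list \<Rightarrow> real \<Rightarrow> real" where
  "ramp [] t = clamp (3 * t - 1)"
| "ramp (b # w) t = ramp w (3 * t - 2 * of_bool b)"

primrec node :: "bool list \<Rightarrow> real \<Rightarrow> real" where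
  "node [] t = 1"
| "node (b # w) t = (if b then clamp (3 * t - 1) else 1 - clamp (3 * t - 1)) * node w (3 * t - 2 * of_bool b)"

text \<open>\<open>ramp u\<close> lies strictly between 0 and 1 exactly on the open middle third of
  the interval with address \<open>u\<close>, so the condition removes all middle thirds from
  [0, 1].\<close>

definition cantor :: "real set" where
  "cantor = {t. 0 \<le> t \<and> t \<le> 1 \<and> (\<forall>u. ramp u t = 0 \<or> ramp u t = 1)}"

lemma clamp_simps: "t \<le> 0 \<Longrightarrow> clamp t = 0" "1 \<le> t \<Longrightarrow> clamp t = 1" "0 \<le> t \<Longrightarrow> t \<le> 1 \<Longrightarrow> clamp t = t"
  by (auto simp: clamp_def)

lemma pos_Cons_inverse: "3 * pos (b # u) t - 2 * of_bool b = pos u t"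
  by (cases b) (auto simp: field_simps)

lemma pos_append [simp]: "pos (u @ v) t = pos u (pos v t)"
  by (induction u) auto

lemma pos_affine: "pos u t = pos u 0 + t / 3 ^ length u"
  by (induction u) (auto simp: field_simps)

lemma pos_less_iff [simp]: "pos u s < pos u t \<longleftrightarrow> s < t"
  by (simp add: pos_affine [of u s] pos_affine [of u t] divide_less_cancel)

lemma pos_le_iff [simp]: "pos u s \<le> pos u t \<longleftrightarrow> s \<le> t"
  by (meson linorder_not_less pos_less_iff)

lemma pos_eq_iff [simp]: "pos u s = pos u t \<longleftrightarrow> s = t"
  by (metis order_antisym_conv order_refl pos_le_iff)

lemma pos_bounds: "0 \<le> t \<Longrightarrow> t \<le> 1 \<Longrightarrow> 0 \<le> pos u t \<and> pos u t \<le> 1"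
  by (induction u) auto

lemma pos_surj: "\<exists>r. t = pos u r"
  by (rule exI[of _ "(t - pos u 0) * 3 ^ length u"]) (subst pos_affine, simp)

lemma continuous_on_clamp [continuous_intros]: "continuous_on S f \<Longrightarrow> continuous_on S (\<lambda>t. clamp (f t))"
  unfolding clamp_def by (intro continuous_intros)

lemma continuous_on_ramp [continuous_intros]: "continuous_on S f \<Longrightarrow> continuous_on S (\<lambda>t. ramp u (f t))"
proof (induction u arbitrary: f)
  case Nil
  then show ?case unfolding ramp.simps by (intro continuous_intros)
next
  case (Cons b u)
  have "continuous_on S (\<lambda>t. 3 * f t - 2 * of_bool b)" by (intro continuous_intros Cons.prems)
  then show ?case unfolding ramp.simps by (rule Cons.IH)
qed

lemma continuous_on_node [continuous_intros]: "continuous_on S f \<Longrightarrow> continuous_on S (\<lambda>t. node u (f t))"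
proof (induction u arbitrary: f)
  case (Cons b u)
  have "continuous_on S (\<lambda>t. node u (3 * f t - 2 * of_bool b))"
    by (rule Cons.IH) (intro continuous_intros Cons.prems)
  moreover have "continuous_on S (\<lambda>t. if b then clamp (3 * f t - 1) else 1 - clamp (3 * f t - 1))"
    using Cons.prems by (cases b) (simp_all, (intro continuous_intros; assumption)+)
  ultimately show ?case unfolding node.simps by (rule continuous_on_mult[rotated])
qed simp

lemma ramp_bounds: "0 \<le> ramp u t \<and> ramp u t \<le> 1"
  by (induction u arbitrary: t) (auto simp: clamp_def)

lemma ramp_eq_0: "t \<le> 0 \<Longrightarrow> ramp u t = 0"
  by (induction u arbitrary: t) (auto simp: clamp_simps)

lemma ramp_eq_1: "1 \<le> t \<Longrightarrow> ramp u t = 1"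
  by (induction u arbitrary: t) (auto simp: clamp_simps)

lemma ramp_pos_append: "ramp (u @ v) (pos u t) = ramp v t"
  by (induction u) (auto simp: field_simps)

text \<open>If \<open>v\<close> does not extend \<open>u\<close>, the open middle third of
  \<open>v\<close> misses the interval of \<open>u\<close>, which therefore lies on one side of
  it.\<close>

lemma ramp_pos_const:
  "\<not> prefix u v \<Longrightarrow> \<exists>c\<in>{0,1}. \<forall>r. 0 \<le> r \<and> r \<le> 1 \<longrightarrow> ramp v (pos u r) = c"
proof (induction u arbitrary: v)
  case (Cons b u)
  show ?case
  proof (cases v)
    case Nil
    have "ramp v (pos (b # u) r) = of_bool b" if "0 \<le> r \<and> r \<le> 1" for r
      using pos_bounds[of r u] that Nil by (cases b) (auto simp: clamp_def)
    then show ?thesis by (intro bexI[of _ "of_bool b"]) auto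
  next
    case v: (Cons c v')
    show ?thesis
    proof (cases "b = c")
      case True
      then have "\<not> prefix u v'" using Cons.prems v by simp
      then show ?thesis using Cons.IH[of v'] v True by (simp add: field_simps)
    next
      case False
      have "ramp v (pos (b # u) r) = of_bool b" if "0 \<le> r \<and> r \<le> 1" for r
        using pos_bounds[of r u] that False v by (cases b) (auto simp: ramp_eq_0 ramp_eq_1)
      then show ?thesis by (intro bexI[of _ "of_bool b"]) auto
    qed
  qed
qed simp

lemma ramp_between: "0 < ramp u t \<Longrightarrow> ramp u t < 1 \<Longrightarrow> t = pos u ((1 + ramp u t) / 3)"
proof (induction u arbitrary: t)
  case Nil
  then show ?case by (auto simp: clamp_def max_def min_def split: if_splits)
next
  case (Cons b u)
  then have "3 * t - 2 * of_bool b = pos u ((1 + ramp (b # u) t) / 3)" by auto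
  then show ?case by (auto simp: field_simps)
qed

lemma node_pos_append: "0 \<le> r \<Longrightarrow> r \<le> 1 \<Longrightarrow> node (u @ v) (pos u r) = node v r"
proof (induction u)
  case (Cons b u)
  note pos_Cons_inverse[of b u r]
  then have "node ((b # u) @ v) (pos (b # u) r) = (if b then clamp (3 * pos (b # u) r - 1) else 1 - clamp (3 * pos (b # u) r - 1)) * node v r"
    using Cons by (simp only: append_Cons node.simps)
  then show ?case using pos_bounds[of r u] Cons by (cases b) (auto simp: clamp_def)
qed simp

lemma node_pos: "0 \<le> r \<Longrightarrow> r \<le> 1 \<Longrightarrow> node w (pos w r) = 1"
  using node_pos_append[of r w "[]"] by simp

lemma node_pos_prefix: "prefix w u \<Longrightarrow> 0 \<le> r \<Longrightarrow> r \<le> 1 \<Longrightarrow> node w (pos u r) = 1"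
  using node_pos pos_bounds by (auto simp: prefix_def)

lemma node_pos_parallel: "\<not> prefix u w \<Longrightarrow> \<not> prefix w u \<Longrightarrow> 0 \<le> r \<Longrightarrow> r \<le> 1 \<Longrightarrow> node w (pos u r) = 0"
proof (induction u arbitrary: w)
  case (Cons b u)
  then obtain c w' where w: "w = c # w'" by (cases w) auto
  show ?case
  proof (cases "b = c")
    case True
    then have "node w' (pos u r) = 0" using Cons w by (intro Cons.IH) auto
    moreover have "3 * pos (b # u) r - 2 * of_bool c = pos u r" unfolding True by (rule pos_Cons_inverse)
    ultimately show ?thesis unfolding w node.simps by simp
  next
    case False
    then show ?thesis using w pos_bounds[of r u] Cons.prems by (cases b) (auto simp: clamp_def)
  qed
qed simp

lemma node_outside:
  "t \<le> 0 \<Longrightarrow> node w t = node w 0" "1 \<le> t \<Longrightarrow> node w t = node w 1"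
proof -
  show "t \<le> 0 \<Longrightarrow> node w t = node w 0" for t
  proof (induction w arbitrary: t)
    case (Cons b w)
    have "3 * t - 2 * of_bool b \<le> 0" "3 * 0 - 2 * of_bool b \<le> (0::real)" using Cons.prems by (auto simp: of_bool_def)
    then show ?case using Cons.IH[of "3 * t - 2 * of_bool b"] Cons.IH[of "3 * 0 - 2 * of_bool b"] Cons.prems
      unfolding node.simps by (simp only:) (simp add: clamp_def)
  qed simp
  show "1 \<le> t \<Longrightarrow> node w t = node w 1" for t
  proof (induction w arbitrary: t)
    case (Cons b w)
    have "1 \<le> 3 * t - 2 * of_bool b" "(1::real) \<le> 3 * 1 - 2 * of_bool b" using Cons.prems by (auto simp: of_bool_def)
    then show ?case using Cons.IH[of "3 * t - 2 * of_bool b"] Cons.IH[of "3 * 1 - 2 * of_bool b"] Cons.prems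
      unfolding node.simps by (simp only:) (simp add: clamp_def)
  qed simp
qed

lemma ramp_gap:
  assumes "0 \<le> s" "s \<le> 1"
  shows "ramp u (pos u ((1 + s) / 3)) = s"
    and "v \<noteq> u \<Longrightarrow> ramp v (pos u ((1 + s) / 3)) = 0 \<or> ramp v (pos u ((1 + s) / 3)) = 1"
proof -
  show "ramp u (pos u ((1 + s) / 3)) = s" using ramp_pos_append[of u "[]"] assms by (simp add: clamp_def add_divide_distrib)
  assume "v \<noteq> u"
  show "ramp v (pos u ((1 + s) / 3)) = 0 \<or> ramp v (pos u ((1 + s) / 3)) = 1"
  proof (cases "prefix u v")
    case True
    then obtain b v' where v: "v = u @ b # v'" using \<open>v \<noteq> u\<close> by (metis append_Nil2 list.exhaust prefixE)
    have "ramp v (pos u ((1 + s) / 3)) = ramp v' (1 + s - 2 * of_bool b)" unfolding v ramp_pos_append by (simp add: add_divide_distrib)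
    then show ?thesis using assms by (cases b) (auto simp: ramp_eq_0 ramp_eq_1)
  next
    case False
    then show ?thesis using ramp_pos_const[OF False] assms by fastforce
  qed
qed

text \<open>Although \<open>node w\<close> is a product, it is affine along a gap. It can vary there
  only if \<open>w\<close> is a proper descendant of \<open>u\<close>; then a single factor varies,
  and the deeper factors see a position outside [0, 1], where they are constant.\<close>

lemma node_gap:
  assumes "0 \<le> s" "s \<le> 1"
  shows "node w (pos u ((1 + s) / 3)) = (1 - s) * node w (pos u (1/3)) + s * node w (pos u (2/3))"
proof -
  consider "prefix w u" | b v where "w = u @ b # v" | "\<not> prefix w u" "\<not> prefix u w"
    by (metis append_Nil2 list.exhaust prefixE prefix_order.refl)
  then show ?thesis
  proof cases
    case 1
    then show ?thesis using assms by (simp add: node_pos_prefix)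
  next
    case (2 b v)
    have r: "node w (pos u ((1 + r) / 3)) = (if b then r * node v 0 else (1 - r) * node v 1)" if "0 \<le> r" "r \<le> 1" for r
    proof -
      have "node w (pos u ((1 + r) / 3)) = node (b # v) ((1 + r) / 3)" unfolding 2 using that by (intro node_pos_append) auto
      moreover have "3 * ((1 + r) / 3) = 1 + r" by simp
      ultimately show ?thesis using that node_outside[of "r - 1" v] node_outside[of "1 + r" v] by (auto simp: clamp_simps add_divide_distrib)
    qed
    show ?thesis using r[OF assms] r[of 0] r[of 1] by simp
  next
    case 3
    then show ?thesis using assms by (simp add: node_pos_parallel)
  qed
qed

lemma cantor_bounds: "t \<in> cantor \<Longrightarrow> 0 \<le> t \<and> t \<le> 1"
  by (simp add: cantor_def)

lemma cantor_ramp: "t \<in> cantor \<Longrightarrow> ramp u t = 0 \<or> ramp u t = 1"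
  by (simp add: cantor_def)

lemma closed_cantor: "closed cantor"
proof -
  have "cantor = {0..1} \<inter> (\<Inter>u. ramp u -` {0,1})" by (auto simp: cantor_def)
  moreover have "closed (ramp u -` {0,1})" for u
    using continuous_on_ramp[of UNIV "\<lambda>t. t" u] by (intro closed_vimage) auto
  ultimately show ?thesis by (metis closed_INT closed_Int closed_atLeastAtMost)
qed

lemma compact_cantor: "compact cantor"
proof -
  have "cantor = cantor \<inter> {0..1}" by (auto simp: cantor_def)
  then show ?thesis using closed_cantor by (metis closed_Int_compact compact_Icc)
qed

lemma pos_cantor_iff:
  assumes "0 \<le> r" "r \<le> 1"
  shows "pos u r \<in> cantor \<longleftrightarrow> r \<in> cantor"
proof
  assume "pos u r \<in> cantor"
  then show "r \<in> cantor" using assms cantor_ramp[of "pos u r" "u @ v" for v]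
    by (auto simp: cantor_def ramp_pos_append)
next
  assume r: "r \<in> cantor"
  have "ramp v (pos u r) = 0 \<or> ramp v (pos u r) = 1" for v
  proof (cases "prefix u v")
    case True
    then obtain v' where "v = u @ v'" by (auto simp: prefix_def)
    then show ?thesis using cantor_ramp[OF r, of v'] by (simp add: ramp_pos_append)
  next
    case False
    then show ?thesis using ramp_pos_const[OF False] assms by auto
  qed
  then show "pos u r \<in> cantor" using pos_bounds[OF assms] by (auto simp: cantor_def)
qed

lemma cantor_cons: 
  assumes "t \<in> cantor"
  obtains b r where "r \<in> cantor" "t = pos [b] r"
proof -
  have t: "0 \<le> t" "t \<le> 1" "t \<le> 1/3 \<or> t \<ge> 2/3"
    using cantor_bounds[OF assms] cantor_ramp[OF assms, of "[]"] by (auto simp: clamp_def max_def min_def split: if_splits)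
  show ?thesis
  proof (cases "t \<le> 1/3")
    case True
    then have "t = pos [False] (3 * t)" by simp
    then show ?thesis using that[of "3 * t" False] pos_cantor_iff[of "3 * t" "[False]"] assms t True by auto
  next
    case False
    then have "t = pos [True] (3 * t - 2)" by simp
    then show ?thesis using that[of "3 * t - 2" True] pos_cantor_iff[of "3 * t - 2" "[True]"] assms t False by auto
  qed
qed

lemma cantor_address: "t \<in> cantor \<Longrightarrow> \<exists>w r. length w = n \<and> r \<in> cantor \<and> t = pos w r"
proof (induction n arbitrary: t)
  case (Suc n)
  obtain b r where r: "r \<in> cantor" "t = pos [b] r" using Suc.prems cantor_cons by blast
  obtain w q where "length w = n" "q \<in> cantor" "r = pos w q" using Suc.IH[OF r(1)] by blast
  then show ?case using r by (intro exI[of _ "b # w"] exI[of _ q]) auto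
qed auto

lemma node_cantor:
  assumes "t \<in> cantor"
  shows "node w t = of_bool (\<exists>r. 0 \<le> r \<and> r \<le> 1 \<and> t = pos w r)"
proof (cases "\<exists>r. 0 \<le> r \<and> r \<le> 1 \<and> t = pos w r")
  case True
  then show ?thesis using node_pos by auto
next
  case False
  obtain w' r where w': "length w' = length w" "r \<in> cantor" "t = pos w' r"
    using cantor_address[OF assms] by blast
  then have "w' \<noteq> w" using False cantor_bounds by blast
  then have "\<not> prefix w' w" "\<not> prefix w w'" using w' by (auto simp: prefix_def)
  then show ?thesis using False w' node_pos_parallel cantor_bounds by auto
qed

text \<open>Reading off a ternary digit fixes 0 and 1 and exchanges 1/4 = 0.0202... and 3/4 =
  0.2020...\<close>

lemma pos_endpoint:
  assumes "0 \<le> r" "r \<le> 1"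
  shows "pos v r = 0 \<Longrightarrow> r = 0" "pos v r = 1 \<Longrightarrow> r = 1"
    "pos v r = 1/4 \<or> pos v r = 3/4 \<Longrightarrow> r = 1/4 \<or> r = 3/4"
proof -
  show "pos v r = 0 \<Longrightarrow> r = 0" "pos v r = 1 \<Longrightarrow> r = 1"
    using pos_bounds[OF assms] by (induction v) (auto split: if_splits simp: of_bool_def; (smt (verit)))+
  show "pos v r = 1/4 \<or> pos v r = 3/4 \<Longrightarrow> r = 1/4 \<or> r = 3/4"
  proof (induction v)
    case (Cons b v)
    have "pos v r = 1/4 \<or> pos v r = 3/4"
      using Cons.prems pos_bounds[OF assms, of v] by (cases b) auto
    then show ?case by (rule Cons.IH)
  qed simp
qed

text \<open>The four positions are terminals of the two halves. By \<open>pos_endpoint\<close> a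
  terminal of a node has a terminal position in every smaller node that contains it, hence never one
  of these four. So a Cantor point is an end of at most one gap or chord.\<close>

lemma pos_inj:
  assumes "pos u q = pos v r" "q \<in> {1/12, 11/12, 1/3, 2/3}" "r \<in> {1/12, 11/12, 1/3, 2/3}"
  shows "u = v \<and> q = r"
  using assms(1)
proof (induction u arbitrary: v)
  case Nil
  show ?case
  proof (cases v)
    case (Cons b w)
    have "pos w r \<in> {0, 1, 1/4, 3/4}"
      using Nil Cons assms(2) pos_bounds[of r w] assms(3) by (cases b) auto
    then show ?thesis using pos_endpoint[of r w] assms(3) by auto
  qed (use Nil in auto)
next
  case (Cons b u)
  have q: "0 \<le> pos u q \<and> pos u q \<le> 1" using pos_bounds[of q u] assms by auto
  show ?case
  proof (cases v)
    case Nil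
    have "pos u q \<in> {0, 1, 1/4, 3/4}"
      using Nil Cons.prems assms(3) q by (cases b) auto
    then show ?thesis using pos_endpoint[of q u] assms(2) by auto
  next
    case v: (Cons c w)
    have r: "0 \<le> pos w r \<and> pos w r \<le> 1" using pos_bounds[of r w] assms by auto
    have "b = c \<and> pos u q = pos w r" using Cons.prems v q r by (cases b; cases c) auto
    then show ?thesis using Cons.IH[of w] v by auto
  qed
qed

lemma cantor_endpoints [simp]: "0 \<in> cantor" "1 \<in> cantor"
  by (auto simp: cantor_def ramp_eq_0 ramp_eq_1)

lemma ramp_quarter: "t = 1/4 \<or> t = 3/4 \<Longrightarrow> ramp u t = 0 \<or> ramp u t = 1"
proof (induction u arbitrary: t)
  case (Cons b u)
  show ?case
  proof (cases "3 * t - 2 * of_bool b = 1/4 \<or> 3 * t - 2 * of_bool b = 3/4")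
    case True
    then show ?thesis using Cons.IH by auto
  next
    case False
    then have "3 * t - 2 * of_bool b \<le> 0 \<or> 3 * t - 2 * of_bool b \<ge> 1"
      using Cons.prems by (cases b) auto
    then show ?thesis using ramp_eq_0 ramp_eq_1 by auto
  qed
qed (auto simp: clamp_def)

lemma cantor_quarters [simp]: "1/4 \<in> cantor" "3/4 \<in> cantor"
  using ramp_quarter by (auto simp: cantor_def)

lemma cantor_edge_ends [simp]: "1/12 \<in> cantor" "11/12 \<in> cantor" "1/3 \<in> cantor" "2/3 \<in> cantor"
  using pos_cantor_iff[of "1/4" "[False]"] pos_cantor_iff[of "3/4" "[True]"]
    pos_cantor_iff[of 1 "[False]"] pos_cantor_iff[of 0 "[True]"] by auto

text \<open>
  The address of \<open>3/10\<close> is \<open>0110\<close> repeated. In every fourth node its relative position is \<open>3/10\<close>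
  again, and there all three pairings of the terminals have arcs that avoid it.
\<close>

definition hub :: real where "hub = 3/10"

text \<open>Reading off the digits 0110 moves 3/10 to 9/10, 7/10, 1/10 and back to 3/10. With a
  wrong digit the position leaves the open unit interval, and the ramps are constant there.\<close>

lemma ramp_hub: "t \<in> {3/10, 9/10, 7/10, 1/10} \<Longrightarrow> ramp u t = 0 \<or> ramp u t = 1"
proof (induction u arbitrary: t)
  case (Cons b u)
  show ?case
  proof (cases "3 * t - 2 * of_bool b \<in> {3/10, 9/10, 7/10, 1/10}")
    case True
    then show ?thesis using Cons.IH by auto
  next
    case False
    then have "3 * t - 2 * of_bool b \<le> 0 \<or> 3 * t - 2 * of_bool b \<ge> 1"
      using Cons.prems by (cases b) auto
    then show ?thesis using ramp_eq_0 ramp_eq_1 by auto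
  qed
qed (auto simp: clamp_def)

lemma hub_cantor [simp]: "hub \<in> cantor"
  using ramp_hub by (auto simp: cantor_def hub_def)

lemma pos_eq_hub:
  assumes "0 \<le> r" "r \<le> 1"
  shows "length w = 4 * m \<Longrightarrow> pos w r = hub \<Longrightarrow> r = hub"
proof (induction m arbitrary: w)
  case (Suc m)
  then obtain a b c d v where w: "w = a # b # c # d # v" "length v = 4 * m"
    by (auto simp: length_Suc_conv numeral_eq_Suc)
  \<comment> \<open>The factor is 81, for four digits. As \<open>pos v r\<close> is in [0, 1], the
    digits must contribute 24 = 18 + 6 to 24.3, so they are 0110.\<close>
  have "pos v r + 2 * of_bool d + 6 * of_bool c + 18 * of_bool b + 54 * of_bool a = 243 / 10"
    using Suc.prems(2) unfolding w hub_def by (simp add: field_simps)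
  then have "pos v r = hub"
    using pos_bounds[OF assms, of v] unfolding hub_def
    by (cases a; cases b; cases c; cases d) auto
  then show ?case using Suc.IH w by blast
qed simp

text \<open>The orbit of the hub under reading off digits contains no terminal position.
  Consequently the hub is a terminal of no node, and an end of no gap or chord.\<close>

lemma pos_ne_hub: "0 \<le> r \<Longrightarrow> r \<le> 1 \<Longrightarrow> r \<in> {0, 1, 1/4, 3/4} \<Longrightarrow> pos u r \<noteq> hub"
proof -
  have "t \<in> {3/10, 9/10, 7/10, 1/10} \<Longrightarrow> pos u r = t \<Longrightarrow> 0 \<le> r \<Longrightarrow> r \<le> 1 \<Longrightarrow> r \<in> {3/10, 9/10, 7/10, 1/10}" for t
  proof (induction u arbitrary: t)
    case (Cons b u)
    have "pos u r \<in> {3/10, 9/10, 7/10, 1/10}"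
      using Cons.prems pos_bounds[of r u] by (cases b) auto
    then show ?case using Cons by blast
  qed auto
  from this[of hub] show "0 \<le> r \<Longrightarrow> r \<le> 1 \<Longrightarrow> r \<in> {0, 1, 1/4, 3/4} \<Longrightarrow> pos u r \<noteq> hub"
    by (auto simp: hub_def)
qed

lemma pos_separates:
  assumes "s \<noteq> t"
  shows "\<exists>n. \<forall>w. n \<le> length w \<longrightarrow> \<not> (s \<in> pos w ` {0..1} \<and> t \<in> pos w ` {0..1})"
proof -
  obtain n where n: "(1/3::real) ^ n < \<bar>s - t\<bar>"
    using real_arch_pow_inv[of "\<bar>s - t\<bar>" "1/3"] assms by auto
  have "\<bar>s - t\<bar> \<le> (1/3) ^ n" if "n \<le> length w" "s = pos w q" "t = pos w r" "q \<in> {0..1}" "r \<in> {0..1}" for w q r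
  proof -
    have "\<bar>s - t\<bar> = \<bar>q - r\<bar> / 3 ^ length w"
      using that by (simp add: pos_affine[of w q] pos_affine[of w r] diff_divide_distrib[symmetric] abs_divide)
    also have "\<dots> \<le> 1 / 3 ^ length w" using that by (intro divide_right_mono) auto
    also have "\<dots> \<le> (1/3) ^ n" unfolding power_one_over[symmetric] using that by (intro power_decreasing) auto
    finally show ?thesis .
  qed
  then show ?thesis using n by (intro exI[of _ n]) force
qed

lemma node_separates:
  assumes "s \<in> cantor" "t \<in> cantor" "s \<noteq> t"
  shows "\<exists>w. node w s = 1 \<and> node w t = 0"
proof -
  obtain n where n: "\<And>w. n \<le> length w \<Longrightarrow> \<not> (s \<in> pos w ` {0..1} \<and> t \<in> pos w ` {0..1})"
    using pos_separates[OF assms(3)] by blast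
  obtain w q where w: "length w = n" "q \<in> cantor" "s = pos w q" using cantor_address[OF assms(1)] by blast
  then have "s \<in> pos w ` {0..1}" using cantor_bounds by auto
  then have "\<nexists>r. 0 \<le> r \<and> r \<le> 1 \<and> t = pos w r" using n[of w] w by auto
  then have "node w t = 0" using node_cantor[OF assms(2), of w] by simp
  moreover have "node w s = 1" using w node_pos cantor_bounds by auto
  ultimately show ?thesis by blast
qed


section \<open>Disjoint arcs in a blob\<close>

text \<open>
  The chord of a node joins the terminal at \<open>1/4\<close> of its left half, at \<open>1/12\<close> of the node, to the terminal
  at \<open>3/4\<close> of its right half, at \<open>11/12\<close>.
\<close>

locale blob =
  fixes g :: "real \<Rightarrow> 'a::t2_space" and ch :: "bool list \<Rightarrow> 'a set"
  assumes cont: "continuous_on {0..1} g" and inj: "inj_on g {0..1}"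
    and chord: "\<And>u. arc_from (ch u) (g (pos u (1/12))) (g (pos u (11/12)))"
    and chord_base: "\<And>u t. 0 \<le> t \<Longrightarrow> t \<le> 1 \<Longrightarrow> g t \<in> ch u \<Longrightarrow> t = pos u (1/12) \<or> t = pos u (11/12)"
    and chord_chord: "\<And>u v. u \<noteq> v \<Longrightarrow> ch u \<inter> ch v = {}"
begin

definition B :: "bool list \<Rightarrow> 'a set" where
  "B w = g ` {pos w 0..pos w 1} \<union> (\<Union>v. ch (w @ v))"

definition gap :: "bool list \<Rightarrow> 'a set" where
  "gap w = g ` {pos w (1/3)..pos w (2/3)}"

lemma g_eq: "g s = g t \<Longrightarrow> 0 \<le> s \<Longrightarrow> s \<le> 1 \<Longrightarrow> 0 \<le> t \<Longrightarrow> t \<le> 1 \<Longrightarrow> s = t"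
  using inj by (auto simp: inj_on_def)

lemma interval_bounds: "0 \<le> a \<Longrightarrow> b \<le> 1 \<Longrightarrow> t \<in> {pos w a..pos w b} \<Longrightarrow> 0 \<le> t \<and> t \<le> 1"
  by (metis atLeastAtMost_iff order_trans pos_bounds pos_le_iff zero_le_one)

lemma base_arc:
  assumes "0 \<le> a" "a < b" "b \<le> 1"
  shows "arc_from (g ` {pos w a..pos w b}) (g (pos w a)) (g (pos w b))"
proof (rule arc_from_image)
  have "{pos w a..pos w b} \<subseteq> {0..1}" using interval_bounds[OF assms(1,3), of _ w] by (auto simp del: atLeastatMost_subset_iff)
  then show "continuous_on {pos w a..pos w b} g" "inj_on g {pos w a..pos w b}"
    using cont inj continuous_on_subset inj_on_subset by blast+
qed (use assms in auto)

lemma base_disjoint: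
  assumes "0 \<le> a" "b \<le> 1" "0 \<le> c" "d \<le> 1" "pos v b < pos w c"
  shows "g ` {pos v a..pos v b} \<inter> g ` {pos w c..pos w d} = {}"
proof -
  have False if "s \<in> {pos v a..pos v b}" "t \<in> {pos w c..pos w d}" "g s = g t" for s t
    using g_eq[OF that(3)] interval_bounds[OF assms(1,2) that(1)] interval_bounds[OF assms(3,4) that(2)] that assms(5)
    by auto
  then show ?thesis by blast
qed

lemma B_split: "B w = B (w @ [False]) \<union> B (w @ [True]) \<union> gap w \<union> ch w"
proof -
  have "{pos w 0..pos w 1} = {pos (w @ [False]) 0..pos (w @ [False]) 1} \<union> {pos (w @ [True]) 0..pos (w @ [True]) 1} \<union> {pos w (1/3)..pos w (2/3)}"
    (is "_ = ?R")
  proof -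
    have "pos w 0 \<le> pos w (1/3)" "pos w (1/3) \<le> pos w (2/3)" "pos w (2/3) \<le> pos w 1" by simp_all
    then show ?thesis by (auto simp del: pos_le_iff pos_less_iff)
  qed
  moreover have "(\<Union>v. ch (w @ v)) = (\<Union>v. ch ((w @ [False]) @ v)) \<union> (\<Union>v. ch ((w @ [True]) @ v)) \<union> ch w" (is "_ = ?R")
  proof -
    have "ch (w @ v) \<subseteq> ?R" for v by (cases v; cases "hd v") auto
    moreover have "ch w \<subseteq> (\<Union>v. ch (w @ v))" by (metis UNIV_I UN_upper append_Nil2)
    ultimately show ?thesis by auto
  qed
  ultimately show ?thesis unfolding B_def gap_def by (auto simp del: pos_append)
qed

text \<open>A chord is disjoint from all other chords and meets the base line only in its ends. So a
  chord of a node outside \<open>w\<close> reaches \<open>B w\<close> only through its ends.\<close>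

lemma chord_in_B:
  assumes "x \<in> ch u" "x \<in> B w" "\<not> prefix w u"
  shows "\<exists>r. 0 \<le> r \<and> r \<le> 1 \<and> (pos w r = pos u (1/12) \<or> pos w r = pos u (11/12)) \<and> x = g (pos w r)"
proof -
  have "x \<notin> ch (w @ v)" for v using chord_chord[of u "w @ v"] assms by (auto simp: prefix_def)
  then obtain t where t: "t \<in> {pos w 0..pos w 1}" "x = g t" using assms(2) by (auto simp: B_def)
  then obtain r where r: "t = pos w r" "0 \<le> r" "r \<le> 1" using pos_surj[of t w] by auto
  have "0 \<le> t \<and> t \<le> 1" using interval_bounds[OF _ _ t(1)] by simp
  then show ?thesis using chord_base assms(1) t r by blast
qed

lemma base_in_B:
  assumes "g t \<in> B w" "0 \<le> t" "t \<le> 1"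
  shows "\<exists>r. 0 \<le> r \<and> r \<le> 1 \<and> t = pos w r"
proof -
  consider s where "s \<in> {pos w 0..pos w 1}" "g t = g s" | v where "g t \<in> ch (w @ v)"
    using assms(1) by (auto simp: B_def)
  then show ?thesis
  proof cases
    case (1 s)
    then have "t = s" using g_eq assms interval_bounds[OF _ _ 1(1)] by simp
    then show ?thesis using 1 pos_surj[of t w] by auto
  next
    case (2 v)
    then have "t = pos w (pos v (1/12)) \<or> t = pos w (pos v (11/12))" using chord_base[OF assms(2,3) 2] by simp
    then show ?thesis using pos_bounds[of "1/12" v] pos_bounds[of "11/12" v] by auto
  qed
qed

lemma B_disjoint: "B (w @ [False]) \<inter> B (w @ [True]) = {}"
proof -
  have pq: "\<not> (pos (w @ [False]) q = pos (w @ [True]) r)" if "0 \<le> q" "q \<le> 1" "0 \<le> r" "r \<le> 1" for q r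
    using that by auto
  have "x \<notin> B (w @ [True])" if x: "x \<in> B (w @ [False])" for x
  proof
    assume y: "x \<in> B (w @ [True])"
    have False if "x = g t" "0 \<le> t" "t \<le> 1" for t
      using base_in_B[of t] that x y pq by blast
    moreover have False if "x \<in> ch (w @ [False] @ v)" for v
    proof -
      have "\<not> prefix (w @ [True]) (w @ [False] @ v)" by simp
      then obtain r where "0 \<le> r" "r \<le> 1" "x = g (pos (w @ [True]) r)"
        using chord_in_B[OF \<open>x \<in> ch (w @ [False] @ v)\<close> y] by blast
      then show False using calculation[of "pos (w @ [True]) r"] pos_bounds by blast
    qed
    moreover have "(\<exists>t\<in>{pos (w @ [False]) 0..pos (w @ [False]) 1}. x = g t) \<or> (\<exists>v. x \<in> ch (w @ [False] @ v))"
      using x by (auto simp: B_def)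
    ultimately show False using interval_bounds[of 0 1] by (metis order_refl)
  qed
  then show ?thesis by blast
qed

lemma gap_B0: "gap w \<inter> B (w @ [False]) \<subseteq> {g (pos w (1/3))}"
  and gap_B1: "gap w \<inter> B (w @ [True]) \<subseteq> {g (pos w (2/3))}"
proof -
  have *: "\<exists>r. 0 \<le> r \<and> r \<le> 1 \<and> t = pos (w @ [b]) r" if "t \<in> {pos w (1/3)..pos w (2/3)}" "g t \<in> B (w @ [b])" for t b
    using interval_bounds[OF _ _ that(1)] base_in_B[OF that(2)] by simp
  show "gap w \<inter> B (w @ [False]) \<subseteq> {g (pos w (1/3))}"
  proof
    fix x assume "x \<in> gap w \<inter> B (w @ [False])"
    then obtain t where t: "t \<in> {pos w (1/3)..pos w (2/3)}" "x = g t" "x \<in> B (w @ [False])" by (auto simp: gap_def)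
    then obtain r where "0 \<le> r" "r \<le> 1" "t = pos (w @ [False]) r" using * by blast
    then have "t = pos w (1/3)" using t by auto
    then show "x \<in> {g (pos w (1/3))}" using t by simp
  qed
  show "gap w \<inter> B (w @ [True]) \<subseteq> {g (pos w (2/3))}"
  proof
    fix x assume "x \<in> gap w \<inter> B (w @ [True])"
    then obtain t where t: "t \<in> {pos w (1/3)..pos w (2/3)}" "x = g t" "x \<in> B (w @ [True])" by (auto simp: gap_def)
    then obtain r where "0 \<le> r" "r \<le> 1" "t = pos (w @ [True]) r" using * by blast
    then have "t = pos w (2/3)" using t by auto
    then show "x \<in> {g (pos w (2/3))}" using t by simp
  qed
qed

lemma chord_B0: "ch w \<inter> B (w @ [False]) \<subseteq> {g (pos w (1/12))}"
  and chord_B1: "ch w \<inter> B (w @ [True]) \<subseteq> {g (pos w (11/12))}"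
proof -
  have *: "\<not> prefix (w @ [b]) w" for b by (auto simp: prefix_def)
  show "ch w \<inter> B (w @ [False]) \<subseteq> {g (pos w (1/12))}"
  proof
    fix x assume "x \<in> ch w \<inter> B (w @ [False])"
    then obtain r where r: "r \<le> 1" "pos (w @ [False]) r = pos w (1/12) \<or> pos (w @ [False]) r = pos w (11/12)"
      "x = g (pos (w @ [False]) r)" using chord_in_B[OF _ _ *] by blast
    have "pos (w @ [False]) r \<noteq> pos w (11/12)" using r(1) by auto
    then have "pos (w @ [False]) r = pos w (1/12)" using r(2) by blast
    then show "x \<in> {g (pos w (1/12))}" using r(3) by (simp del: pos_append)
  qed
  show "ch w \<inter> B (w @ [True]) \<subseteq> {g (pos w (11/12))}"
  proof
    fix x assume "x \<in> ch w \<inter> B (w @ [True])"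
    then obtain r where r: "0 \<le> r" "pos (w @ [True]) r = pos w (1/12) \<or> pos (w @ [True]) r = pos w (11/12)"
      "x = g (pos (w @ [True]) r)" using chord_in_B[OF _ _ *] by blast
    have "pos (w @ [True]) r \<noteq> pos w (1/12)" using r(1) by auto
    then have "pos (w @ [True]) r = pos w (11/12)" using r(2) by blast
    then show "x \<in> {g (pos w (11/12))}" using r(3) by (simp del: pos_append)
  qed
qed

lemma gap_chord: "gap w \<inter> ch w = {}"
proof -
  have False if t: "t \<in> {pos w (1/3)..pos w (2/3)}" and "g t \<in> ch w" for t
    using chord_base[OF _ _ that(2)] interval_bounds[OF _ _ t] t by auto
  then show ?thesis unfolding gap_def by blast
qed

lemma gap_arc: "arc_from (gap w) (g (pos w (1/3))) (g (pos w (2/3)))"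
  unfolding gap_def by (rule base_arc) auto

text \<open>The two arcs together carry the finite set \<open>F\<close> and avoid \<open>Z\<close>,
  which will be empty or consist of the hub. As they stay in one node, arcs chosen in the two halves
  of a node are disjoint automatically.\<close>

definition link :: "bool list \<Rightarrow> real \<Rightarrow> real \<Rightarrow> real \<Rightarrow> real \<Rightarrow> 'a set \<Rightarrow> 'a set \<Rightarrow> bool" where
  "link w a b c d F Z \<longleftrightarrow>
    (\<exists>A A'. arc_from A (g (pos w a)) (g (pos w b)) \<and> arc_from A' (g (pos w c)) (g (pos w d)) \<and>
       A \<inter> A' = {} \<and> A \<union> A' \<subseteq> B w \<and> F \<subseteq> A \<union> A' \<and> (A \<union> A') \<inter> Z = {})"

text \<open>The terminals of a node sit at the relative positions \<open>0, 1/4, 3/4, 1\<close>; these are the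
  three ways to pair them.\<close>
abbreviation "link_a w \<equiv> link w 0 (1/4) 1 (3/4)"
abbreviation "link_b w \<equiv> link w 0 1 (1/4) (3/4)"
abbreviation "link_c w \<equiv> link w 0 (3/4) (1/4) 1"

lemma link_mono: "link w a b c d F Z \<Longrightarrow> F' \<subseteq> F \<Longrightarrow> link w a b c d F' Z"
  unfolding link_def by blast

lemma link_swap: "link w a b c d F Z \<Longrightarrow> link w c d a b F Z"
  unfolding link_def by (metis Int_commute Un_commute)

lemma link_flip: "link w a b c d F Z \<Longrightarrow> link w a b d c F Z"
  unfolding link_def using arc_from_sym by metis

lemma link_avoid: "link w a b c d F {} \<Longrightarrow> Z \<inter> B w = {} \<Longrightarrow> link w a b c d F Z"
  unfolding link_def by blast

lemma arc_from_join3: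
  assumes "arc_from A u v" "arc_from E v v'" "arc_from C v' w"
    and "A \<inter> E \<subseteq> {v}" "E \<inter> C \<subseteq> {v'}" "A \<inter> C = {}"
  shows "arc_from (A \<union> E \<union> C) u w"
  by (rule arc_from_join[OF arc_from_join[OF assms(1,2,4)] assms(3)]) (use assms in blast)

context
  fixes w :: "bool list" and F0 F1 Z :: "'a set"
  assumes Z: "Z \<inter> (gap w \<union> ch w) = {}"
begin

lemma child_positions:
  "pos (w @ [False]) 0 = pos w 0" "pos (w @ [False]) (1/4) = pos w (1/12)"
  "pos (w @ [False]) 1 = pos w (1/3)" "pos (w @ [False]) (3/4) = pos w (1/4)"
  "pos (w @ [True]) 0 = pos w (2/3)" "pos (w @ [True]) (1/4) = pos w (3/4)"
  "pos (w @ [True]) 1 = pos w 1" "pos (w @ [True]) (3/4) = pos w (11/12)"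
  by auto

lemma side0:
  assumes "P \<subseteq> B (w @ [False])"
  shows "P \<inter> ch w \<subseteq> {g (pos w (1/12))}" "ch w \<inter> P \<subseteq> {g (pos w (1/12))}"
    "P \<inter> gap w \<subseteq> {g (pos w (1/3))}" "gap w \<inter> P \<subseteq> {g (pos w (1/3))}"
  using assms chord_B0[of w] gap_B0[of w] by auto

lemma side1:
  assumes "P \<subseteq> B (w @ [True])"
  shows "P \<inter> ch w \<subseteq> {g (pos w (11/12))}" "ch w \<inter> P \<subseteq> {g (pos w (11/12))}"
    "P \<inter> gap w \<subseteq> {g (pos w (2/3))}" "gap w \<inter> P \<subseteq> {g (pos w (2/3))}"
  using assms chord_B1[of w] gap_B1[of w] by auto

lemma sides_disjoint:
  assumes "P \<subseteq> B (w @ [False])" "Q \<subseteq> B (w @ [True])"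
  shows "P \<inter> Q = {}" "Q \<inter> P = {}"
  using assms B_disjoint[of w] by auto

text \<open>For the case that the only possible common point \<open>y\<close> of \<open>P\<close>
  and the edge \<open>E\<close> already belongs to the other arc \<open>P'\<close> of the
  pair.\<close>

lemma off_edge:
  assumes "P \<inter> E \<subseteq> {y}" "y \<in> P'" "P \<inter> P' = {}"
  shows "P \<inter> E = {}" "E \<inter> P = {}"
  using assms by auto

text \<open>Both arcs cross from the left half to the right half, one along the chord and the other
  along the gap. This needs pairings that separate the edge ends 1/4 and 1 on the left, and 0 and
  3/4 on the right; \<open>a\<close> and \<open>b\<close> do so on both sides, \<open>c\<close> on
  neither.\<close>

lemma link_through:
  assumes "link (w @ [False]) a (1/4) b 1 F0 Z" "link (w @ [True]) 0 c (3/4) d F1 Z"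
    and "pos (w @ [False]) a = pos w a'" "pos (w @ [False]) b = pos w b'"
    and "pos (w @ [True]) c = pos w c'" "pos (w @ [True]) d = pos w d'"
  shows "link w a' d' b' c' (F0 \<union> F1 \<union> gap w \<union> ch w) Z"
proof -
  note E = gap_arc[of w] chord[of w]
  obtain A A' where A: "arc_from A (g (pos (w @ [False]) a)) (g (pos w (1/12)))" "arc_from A' (g (pos (w @ [False]) b)) (g (pos w (1/3)))"
    "A \<inter> A' = {}" "A \<union> A' \<subseteq> B (w @ [False])" "F0 \<subseteq> A \<union> A'" "(A \<union> A') \<inter> Z = {}"
    using assms(1) unfolding link_def child_positions by blast
  obtain C C' where C: "arc_from C (g (pos w (2/3))) (g (pos (w @ [True]) c))" "arc_from C' (g (pos w (11/12))) (g (pos (w @ [True]) d))"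
    "C \<inter> C' = {}" "C \<union> C' \<subseteq> B (w @ [True])" "F1 \<subseteq> C \<union> C'" "(C \<union> C') \<inter> Z = {}"
    using assms(2) unfolding link_def child_positions by blast
  have sub: "A \<subseteq> B (w @ [False])" "A' \<subseteq> B (w @ [False])" "C \<subseteq> B (w @ [True])" "C' \<subseteq> B (w @ [True])"
    using A(4) C(4) by auto
  have swap: "A' \<inter> A = {}" "C' \<inter> C = {}" "gap w \<inter> ch w = {}" "ch w \<inter> gap w = {}"
    using A(3) C(3) gap_chord[of w] by auto
  note S = A(3) C(3) swap side0[OF sub(1)] side0[OF sub(2)] side1[OF sub(3)] side1[OF sub(4)]
    sides_disjoint[OF sub(1,3)] sides_disjoint[OF sub(1,4)] sides_disjoint[OF sub(2,3)] sides_disjoint[OF sub(2,4)]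
  note D = off_edge[OF side0(3)[OF sub(1)] arc_from_mem(2)[OF A(2)] A(3)]
    off_edge[OF side0(1)[OF sub(2)] arc_from_mem(2)[OF A(1)] swap(1)]
    off_edge[OF side1(1)[OF sub(3)] arc_from_mem(1)[OF C(2)] C(3)]
    off_edge[OF side1(3)[OF sub(4)] arc_from_mem(1)[OF C(1)] swap(2)]
  note dist = Int_Un_distrib Int_Un_distrib2
  have 1: "arc_from (A \<union> ch w \<union> C') (g (pos (w @ [False]) a)) (g (pos (w @ [True]) d))"
    by (rule arc_from_join3[OF A(1) E(2) C(2)]) (simp_all add: S D dist)
  have 2: "arc_from (A' \<union> gap w \<union> C) (g (pos (w @ [False]) b)) (g (pos (w @ [True]) c))"
    by (rule arc_from_join3[OF A(2) E(1) C(1)]) (simp_all add: S D dist)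
  have 3: "(A \<union> ch w \<union> C') \<inter> (A' \<union> gap w \<union> C) = {}" by (simp add: S D dist)
  show ?thesis unfolding link_def assms(3-6)[symmetric]
    by (rule exI, rule exI, rule conjI[OF 1], rule conjI[OF 2], rule conjI[OF 3], intro conjI,
        subst B_split, use A(4) C(4) in blast, use A(5) C(5) in blast, use A(6) C(6) Z in blast)
qed

lemma link_aa:
  assumes "link_a (w @ [False]) F0 Z" "link_a (w @ [True]) F1 Z"
  shows "link_b w (F0 \<union> F1 \<union> gap w \<union> ch w) Z"
  by (rule link_through[OF link_flip[OF assms(1)] link_flip[OF assms(2)]]) auto

lemma link_ab:
  assumes "link_a (w @ [False]) F0 Z" "link_b (w @ [True]) F1 Z"
  shows "link_c w (F0 \<union> F1 \<union> gap w \<union> ch w) Z"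
  by (rule link_through[OF link_flip[OF assms(1)] link_flip[OF assms(2)]]) auto

lemma link_bb:
  assumes "link_b (w @ [False]) F0 Z" "link_b (w @ [True]) F1 Z"
  shows "link_b w (F0 \<union> F1 \<union> gap w \<union> ch w) Z"
  by (rule link_swap[OF link_through[OF link_swap[OF link_flip[OF assms(1)]] link_flip[OF assms(2)]]]) auto

lemma link_ba:
  assumes "link_b (w @ [False]) F0 Z" "link_a (w @ [True]) F1 Z"
  shows "link_c w (F0 \<union> F1 \<union> gap w \<union> ch w) Z"
  by (rule link_swap[OF link_through[OF link_swap[OF link_flip[OF assms(1)]] link_flip[OF assms(2)]]]) auto

text \<open>Pairing \<open>c\<close> connects the ends of the chord and of the gap inside the right
  half. So one arc goes over by the chord and returns by the gap, while the other stays in the right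
  half.\<close>

lemma link_ac:
  assumes "link_a (w @ [False]) F0 Z" "link_c (w @ [True]) F1 Z"
  shows "link_a w (F0 \<union> F1 \<union> gap w \<union> ch w) Z"
proof -
  note E = gap_arc[of w] chord[of w]
  obtain A A' where A: "arc_from A (g (pos w 0)) (g (pos w (1/12)))" "arc_from A' (g (pos w (1/3))) (g (pos w (1/4)))"
    "A \<inter> A' = {}" "A \<union> A' \<subseteq> B (w @ [False])" "F0 \<subseteq> A \<union> A'" "(A \<union> A') \<inter> Z = {}"
    using assms(1) unfolding link_def child_positions by blast
  obtain C C' where C: "arc_from C (g (pos w (2/3))) (g (pos w (11/12)))" "arc_from C' (g (pos w (3/4))) (g (pos w 1))"
    "C \<inter> C' = {}" "C \<union> C' \<subseteq> B (w @ [True])" "F1 \<subseteq> C \<union> C'" "(C \<union> C') \<inter> Z = {}"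
    using assms(2) unfolding link_def child_positions by blast
  have sub: "A \<subseteq> B (w @ [False])" "A' \<subseteq> B (w @ [False])" "C \<subseteq> B (w @ [True])" "C' \<subseteq> B (w @ [True])"
    using A(4) C(4) by auto
  have swap: "A' \<inter> A = {}" "C' \<inter> C = {}" "gap w \<inter> ch w = {}" "ch w \<inter> gap w = {}"
    using A(3) C(3) gap_chord[of w] by auto
  note S = A(3) C(3) swap side0[OF sub(1)] side0[OF sub(2)] side1[OF sub(3)] side1[OF sub(4)]
    sides_disjoint[OF sub(1,3)] sides_disjoint[OF sub(1,4)] sides_disjoint[OF sub(2,3)] sides_disjoint[OF sub(2,4)]
  note D = off_edge[OF side0(3)[OF sub(1)] arc_from_mem(1)[OF A(2)] A(3)]
    off_edge[OF side0(1)[OF sub(2)] arc_from_mem(2)[OF A(1)] swap(1)]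
    off_edge[OF side1(1)[OF sub(4)] arc_from_mem(2)[OF C(1)] swap(2)]
    off_edge[OF side1(3)[OF sub(4)] arc_from_mem(1)[OF C(1)] swap(2)]
  note dist = Int_Un_distrib Int_Un_distrib2
  have 0: "arc_from (A \<union> ch w \<union> C) (g (pos w 0)) (g (pos w (2/3)))"
    by (rule arc_from_join3[OF A(1) E(2) arc_from_sym[OF C(1)]]) (simp_all add: S D dist)
  have 1: "arc_from (A \<union> ch w \<union> C \<union> gap w \<union> A') (g (pos w 0)) (g (pos w (1/4)))"
    by (rule arc_from_join3[OF 0 arc_from_sym[OF E(1)] A(2)]) (simp_all add: S D dist)
  note 2 = arc_from_sym[OF C(2)]
  have 3: "(A \<union> ch w \<union> C \<union> gap w \<union> A') \<inter> (C') = {}" by (simp add: S D dist)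
  show ?thesis unfolding link_def
    by (rule exI, rule exI, rule conjI[OF 1], rule conjI[OF 2], rule conjI[OF 3], intro conjI,
        subst B_split, use A(4) C(4) in blast, use A(5) C(5) in blast, use A(6) C(6) Z in blast)
qed

text \<open>The mirror image of \<open>link_ac\<close>: the arc that uses both edges starts and ends
  in the right half, and the other stays in the left half.\<close>

lemma link_ca:
  assumes "link_c (w @ [False]) F0 Z" "link_a (w @ [True]) F1 Z"
  shows "link_a w (F0 \<union> F1 \<union> gap w \<union> ch w) Z"
proof -
  note E = gap_arc[of w] chord[of w]
  obtain A A' where A: "arc_from A (g (pos w 0)) (g (pos w (1/4)))" "arc_from A' (g (pos w (1/12))) (g (pos w (1/3)))"
    "A \<inter> A' = {}" "A \<union> A' \<subseteq> B (w @ [False])" "F0 \<subseteq> A \<union> A'" "(A \<union> A') \<inter> Z = {}"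
    using assms(1) unfolding link_def child_positions by blast
  obtain C C' where C: "arc_from C (g (pos w (2/3))) (g (pos w (3/4)))" "arc_from C' (g (pos w 1)) (g (pos w (11/12)))"
    "C \<inter> C' = {}" "C \<union> C' \<subseteq> B (w @ [True])" "F1 \<subseteq> C \<union> C'" "(C \<union> C') \<inter> Z = {}"
    using assms(2) unfolding link_def child_positions by blast
  have sub: "A \<subseteq> B (w @ [False])" "A' \<subseteq> B (w @ [False])" "C \<subseteq> B (w @ [True])" "C' \<subseteq> B (w @ [True])"
    using A(4) C(4) by auto
  have swap: "A' \<inter> A = {}" "C' \<inter> C = {}" "gap w \<inter> ch w = {}" "ch w \<inter> gap w = {}"
    using A(3) C(3) gap_chord[of w] by auto
  note S = A(3) C(3) swap side0[OF sub(1)] side0[OF sub(2)] side1[OF sub(3)] side1[OF sub(4)]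
    sides_disjoint[OF sub(1,3)] sides_disjoint[OF sub(1,4)] sides_disjoint[OF sub(2,3)] sides_disjoint[OF sub(2,4)]
  note D = off_edge[OF side0(1)[OF sub(1)] arc_from_mem(1)[OF A(2)] A(3)]
    off_edge[OF side0(3)[OF sub(1)] arc_from_mem(2)[OF A(2)] A(3)]
    off_edge[OF side1(1)[OF sub(3)] arc_from_mem(2)[OF C(2)] C(3)]
    off_edge[OF side1(3)[OF sub(4)] arc_from_mem(1)[OF C(1)] swap(2)]
  note dist = Int_Un_distrib Int_Un_distrib2
  have 0: "arc_from (C' \<union> ch w \<union> A') (g (pos w 1)) (g (pos w (1/3)))"
    by (rule arc_from_join3[OF C(2) arc_from_sym[OF E(2)] A(2)]) (simp_all add: S D dist)
  note 1 = A(1)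
  have 2: "arc_from (C' \<union> ch w \<union> A' \<union> gap w \<union> C) (g (pos w 1)) (g (pos w (3/4)))"
    by (rule arc_from_join3[OF 0 E(1) C(1)]) (simp_all add: S D dist)
  have 3: "(A) \<inter> (C' \<union> ch w \<union> A' \<union> gap w \<union> C) = {}" by (simp add: S D dist)
  show ?thesis unfolding link_def
    by (rule exI, rule exI, rule conjI[OF 1], rule conjI[OF 2], rule conjI[OF 3], intro conjI,
        subst B_split, use A(4) C(4) in blast, use A(5) C(5) in blast, use A(6) C(6) Z in blast)
qed

end

lemma link_a_base:
  assumes "F \<subseteq> g ` {pos w 0..pos w (1/4)} \<union> g ` {pos w (3/4)..pos w 1}"
    and "Z \<inter> (g ` {pos w 0..pos w (1/4)} \<union> g ` {pos w (3/4)..pos w 1}) = {}"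
  shows "link_a w F Z"
proof -
  have 1: "arc_from (g ` {pos w 0..pos w (1/4)}) (g (pos w 0)) (g (pos w (1/4)))"
    by (rule base_arc) auto
  have 2: "arc_from (g ` {pos w (3/4)..pos w 1}) (g (pos w 1)) (g (pos w (3/4)))"
    by (rule arc_from_sym[OF base_arc]) auto
  have 3: "g ` {pos w 0..pos w (1/4)} \<inter> g ` {pos w (3/4)..pos w 1} = {}"
    by (rule base_disjoint) auto
  have "{pos w 0..pos w (1/4)} \<subseteq> {pos w 0..pos w 1}" "{pos w (3/4)..pos w 1} \<subseteq> {pos w 0..pos w 1}"
    by auto
  then have 4: "g ` {pos w 0..pos w (1/4)} \<union> g ` {pos w (3/4)..pos w 1} \<subseteq> B w"
    unfolding B_def by blast
  show ?thesis unfolding link_def using 1 2 3 4 assms by blast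
qed

lemma link_empty: "link_a w {} {}" "link_b w {} {}" "link_c w {} {}"
proof -
  show a: "link_a w {} {}" for w by (rule link_a_base) auto
  show b: "link_b w {} {}" for w by (rule link_mono[OF link_aa[OF Int_empty_left a a]]) auto
  show c: "link_c w {} {}" for w by (rule link_mono[OF link_ab[OF Int_empty_left a b]]) auto
qed

lemma link_single_a:
  assumes "r \<in> cantor"
  shows "link_a w {g (pos w r)} {}"
proof -
  have r: "0 \<le> r" "r \<le> 1" "r \<le> 1/3 \<or> r \<ge> 2/3"
    using cantor_bounds[OF assms] cantor_ramp[OF assms, of "[]"] by (auto simp: clamp_def max_def min_def split: if_splits)
  consider "r \<le> 1/4 \<or> r \<ge> 3/4" | "1/4 \<le> r" "r \<le> 1/3" | "2/3 \<le> r" "r \<le> 3/4" using r by linarith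
  then show ?thesis
  proof cases
    case 1
    then show ?thesis using r by (intro link_a_base) auto
  next
    case 2
    \<comment> \<open>Between 1/4 and 1/3 the point is off both base segments of the node. In the
      left half its position \<open>3 * r\<close> is at least 3/4, on a base segment of that
      half.\<close>
    have "pos w r = pos (w @ [False]) (3 * r)" by simp
    then have "link_a (w @ [False]) {g (pos w r)} {}"
      using 2 r by (intro link_a_base) (auto simp del: pos_append)
    from link_mono[OF link_ac[OF Int_empty_left this link_empty(3)]] show ?thesis by auto
  next
    case 3
    have "pos w r = pos (w @ [True]) (3 * r - 2)" by simp
    then have "link_a (w @ [True]) {g (pos w r)} {}"
      using 3 r by (intro link_a_base) (auto simp del: pos_append)
    from link_mono[OF link_ca[OF Int_empty_left link_empty(3) this]] show ?thesis by auto
  qed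
qed

lemma link_single:
  assumes "r \<in> cantor"
  shows "link_b w {g (pos w r)} {}" "link_c w {g (pos w r)} {}"
proof -
  have b: "link_b w {g (pos w r)} {}" if "r \<in> cantor" for w r
  proof -
    obtain b q where q: "q \<in> cantor" "r = pos [b] q" using cantor_cons[OF \<open>r \<in> cantor\<close>] by blast
    then have "link_a (w @ [b]) {g (pos w r)} {}" using link_single_a[OF q(1), of "w @ [b]"] by (simp only: pos_append)
    then show ?thesis
      using link_mono[OF link_aa[OF Int_empty_left link_empty(1), of w "{g (pos w r)}"], of "{g (pos w r)}"]
        link_mono[OF link_aa[OF Int_empty_left _ link_empty(1), of w "{g (pos w r)}"], of "{g (pos w r)}"]
      by (cases b) auto
  qed
  show "link_b w {g (pos w r)} {}" using b assms by blast
  obtain b' q where q: "q \<in> cantor" "r = pos [b'] q" using cantor_cons[OF assms] by blast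
  show "link_c w {g (pos w r)} {}"
  proof (cases b')
    case True
    then have "link_b (w @ [True]) {g (pos w r)} {}" using b[OF q(1), of "w @ [True]"] q(2) by (simp only: pos_append)
    from link_mono[OF link_ab[OF Int_empty_left link_empty(1) this]] show ?thesis by auto
  next
    case False
    then have "link_a (w @ [False]) {g (pos w r)} {}" using link_single_a[OF q(1), of "w @ [False]"] q(2) by (simp only: pos_append)
    from link_mono[OF link_ab[OF Int_empty_left this link_empty(2)]] show ?thesis by auto
  qed
qed

lemma hub_not_on_edges: "g hub \<notin> gap w \<union> ch w"
proof -
  have h: "0 \<le> hub" "hub \<le> 1" by (auto simp: hub_def)
  have ne: "hub \<noteq> pos w (1/12)" "hub \<noteq> pos w (11/12)" "hub \<noteq> pos w (1/3)" "hub \<noteq> pos w (2/3)"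
    using pos_ne_hub[of "1/4" "w @ [False]"] pos_ne_hub[of "3/4" "w @ [True]"]
      pos_ne_hub[of 1 "w @ [False]"] pos_ne_hub[of 0 "w @ [True]"] by auto
  have "g hub \<notin> ch w" using chord_base[OF h] ne by blast
  moreover have "g hub \<notin> gap w"
  proof
    assume "g hub \<in> gap w"
    then obtain t where t: "t \<in> {pos w (1/3)..pos w (2/3)}" "g hub = g t" by (auto simp: gap_def)
    have "0 \<le> t \<and> t \<le> 1" by (rule interval_bounds[OF _ _ t(1)]) auto
    then have ht: "hub = t" using g_eq t h by blast
    obtain r where "t = pos w r" using pos_surj by blast
    moreover from this have "1/3 \<le> r" "r \<le> 2/3" using t(1) by simp_all
    ultimately have r: "hub = pos w r" "1/3 \<le> r" "r \<le> 2/3" using ht by blast+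
    have "r \<in> cantor" using hub_cantor pos_cantor_iff[of r w] r by auto
    then have "r \<le> 1/3 \<or> r \<ge> 2/3" using cantor_ramp[of r "[]"] by (auto simp: clamp_def max_def min_def split: if_splits)
    then have "r = 1/3 \<or> r = 2/3" using r by linarith
    then show False using r(1) ne by metis
  qed
  ultimately show ?thesis by blast
qed

lemma hub_disjoint_arcs:
  assumes "hub \<notin> {pos w a..pos w b}" "0 \<le> a" "b \<le> 1"
  shows "g hub \<notin> g ` {pos w a..pos w b}"
proof
  assume "g hub \<in> g ` {pos w a..pos w b}"
  then obtain t where t: "t \<in> {pos w a..pos w b}" "g hub = g t" by auto
  have "hub = t" using g_eq[OF t(2)] interval_bounds[OF assms(2,3) t(1)] by (auto simp: hub_def)
  then show False using t assms by simp
qed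

text \<open>The hub at 3/10 is between the two base segments of pairing \<open>a\<close>. In the
  left half it is at 9/10, on a base segment, so this half uses \<open>b\<close>, built from
  quarters that do not contain the hub or have it at 7/10, between the segments. With
  \<open>b\<close> on the left, \<open>link_bb\<close> and \<open>link_ba\<close> supply
  \<open>b\<close> and \<open>c\<close>.\<close>

lemma link_avoid_hub:
  assumes "pos w hub = hub"
  shows "link_a w {} {g hub}" "link_b w {} {g hub}" "link_c w {} {g hub}"
proof -
  note e = hub_not_on_edges
  have bead_at: "link_a v {} {g hub}" if "hub \<notin> {pos v 0..pos v (1/4)}" "hub \<notin> {pos v (3/4)..pos v 1}" for v
    using hub_disjoint_arcs that by (intro link_a_base) auto
  have h: "hub = pos w hub" using assms by simp
  have a: "link_a (w @ v) {} {g hub}" if "hub \<notin> {pos v 0..pos v (1/4)}" "hub \<notin> {pos v (3/4)..pos v 1}" for v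
    by (rule bead_at) (use that in \<open>subst h, simp\<close>)+
  show "link_a w {} {g hub}" using a[of "[]"] by (simp add: hub_def)
  have b0: "link_b (w @ [False]) {} {g hub}"
    using link_mono[OF link_aa[of "{g hub}" "w @ [False]" "{}" "{}"], of "{}"] a[of "[False,False]"] a[of "[False,True]"] e[of "w @ [False]"]
    by (simp add: hub_def)
  have a1: "link_a (w @ [True]) {} {g hub}" using a[of "[True]"] by (simp add: hub_def)
  have b1: "link_b (w @ [True]) {} {g hub}"
    using link_mono[OF link_aa[of "{g hub}" "w @ [True]" "{}" "{}"], of "{}"] a[of "[True,False]"] a[of "[True,True]"] e[of "w @ [True]"]
    by (simp add: hub_def)
  show "link_b w {} {g hub}" by (rule link_mono[OF link_bb[OF _ b0 b1]]) (use e in auto)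
  show "link_c w {} {g hub}" by (rule link_mono[OF link_ba[OF _ b0 a1]]) (use e in auto)
qed

section \<open>Finite sets in deep nodes\<close>

lemma chord_nodes:
  assumes "length u < length w" "x \<in> ch u" "x \<in> B w"
  shows "\<exists>t\<in>cantor. x = g t"
proof -
  have "\<not> prefix w u" using assms(1) prefix_length_le by force
  then obtain r where "pos w r = pos u (1/12) \<or> pos w r = pos u (11/12)" "x = g (pos w r)"
    using chord_in_B[OF assms(2,3)] by blast
  then show ?thesis using pos_cantor_iff[of "1/12" u] pos_cantor_iff[of "11/12" u] by auto
qed

text \<open>An inner point of a gap or chord lies only in nodes that contain the whole edge, and
  these are not deeper than the node of the edge.\<close>

lemma deep_nodes_cantor:
  assumes "x \<in> B []"
  shows "\<exists>n. \<forall>w. n \<le> length w \<longrightarrow> x \<in> B w \<longrightarrow> (\<exists>t\<in>cantor. x = g t)"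
proof -
  consider t where "0 \<le> t" "t \<le> 1" "x = g t" | u where "x \<in> ch u"
    using assms by (auto simp: B_def)
  then show ?thesis
  proof cases
    case (1 t)
    show ?thesis
    proof (cases "t \<in> cantor")
      case False
      then obtain u where u: "0 < ramp u t" "ramp u t < 1"
        using 1 ramp_bounds[of _ t] by (fastforce simp: cantor_def order_le_less)
      have "x \<notin> B w" if "Suc (length u) \<le> length w" for w
      proof
        assume "x \<in> B w"
        then obtain r where r: "0 \<le> r" "r \<le> 1" "t = pos w r" using base_in_B 1 by blast
        have "\<not> prefix w u" using that prefix_length_le by force
        then show False using ramp_pos_const[of w u] r u by auto
      qed
      then show ?thesis by blast
    qed (use 1 in blast)
  next
    case (2 u)
    then show ?thesis using chord_nodes[OF _ 2] by (intro exI[of _ "Suc (length u)"]) (simp add: Suc_le_eq)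
  qed
qed

lemma deep_nodes_separate:
  assumes "x \<in> B []" "y \<in> B []" "x \<noteq> y"
  shows "\<exists>n. \<forall>w. n \<le> length w \<longrightarrow> \<not> (x \<in> B w \<and> y \<in> B w)"
proof -
  obtain m where m: "\<And>w. m \<le> length w \<Longrightarrow> x \<in> B w \<Longrightarrow> \<exists>t\<in>cantor. x = g t" using deep_nodes_cantor[OF assms(1)] by blast
  obtain n where n: "\<And>w. n \<le> length w \<Longrightarrow> y \<in> B w \<Longrightarrow> \<exists>t\<in>cantor. y = g t" using deep_nodes_cantor[OF assms(2)] by blast
  show ?thesis
  proof (cases "\<exists>s\<in>cantor. \<exists>t\<in>cantor. x = g s \<and> y = g t")
    case True
    then obtain s t where st: "s \<in> cantor" "t \<in> cantor" "x = g s" "y = g t" by blast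
    then obtain k where k: "\<And>w. k \<le> length w \<Longrightarrow> \<not> (s \<in> pos w ` {0..1} \<and> t \<in> pos w ` {0..1})"
      using pos_separates[of s t] assms(3) by blast
    have "\<not> (x \<in> B w \<and> y \<in> B w)" if "k \<le> length w" for w
      using k[OF that] base_in_B[of s w] base_in_B[of t w] st cantor_bounds by auto
    then show ?thesis by blast
  next
    case False
    then show ?thesis using m n by (intro exI[of _ "max m n"]) (meson max.bounded_iff)
  qed
qed

text \<open>Induction from a deep level up to the root. At the deep level each node contains at most
  one point of \<open>F\<close>, which is then a Cantor point, and the single-point and empty cases
  apply.\<close>

lemma link_exists:
  assumes F: "finite F" "F \<subseteq> B []" and Z: "Z \<subseteq> {g hub}" "Z \<inter> F = {}"
  shows "link_a [] F Z"
proof -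
  \<comment> \<open>With the hub added to \<open>F\<close>, a deep node that contains the hub
    contains no other point of \<open>F\<close>. So covering \<open>F\<close> and avoiding the hub
    never have to be achieved in the same deep node.\<close>
  define G where "G = insert (g hub) F"
  have hub: "g hub \<in> B []" by (auto simp: B_def hub_def)
  have G: "finite G" "G \<subseteq> B []" using F hub by (auto simp: G_def)
  have "\<forall>x\<in>G. \<forall>\<^sub>F n in sequentially. \<forall>w. n \<le> length w \<longrightarrow> x \<in> B w \<longrightarrow> (\<exists>t\<in>cantor. x = g t)"
    using deep_nodes_cantor G(2) unfolding eventually_sequentially by (meson order_trans subsetD)
  then have e1: "\<forall>\<^sub>F n in sequentially. \<forall>x\<in>G. \<forall>w. n \<le> length w \<longrightarrow> x \<in> B w \<longrightarrow> (\<exists>t\<in>cantor. x = g t)"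
    using G(1) by (rule eventually_ball_finite[rotated])
  have "\<forall>p\<in>{p\<in>G \<times> G. fst p \<noteq> snd p}. \<forall>\<^sub>F n in sequentially. \<forall>w. n \<le> length w \<longrightarrow> \<not> (fst p \<in> B w \<and> snd p \<in> B w)"
  proof
    fix p assume "p \<in> {p\<in>G \<times> G. fst p \<noteq> snd p}"
    then have "fst p \<in> B []" "snd p \<in> B []" "fst p \<noteq> snd p" using G(2) by auto
    from deep_nodes_separate[OF this] obtain n where "\<forall>w. n \<le> length w \<longrightarrow> \<not> (fst p \<in> B w \<and> snd p \<in> B w)"
      by blast
    then show "\<forall>\<^sub>F n in sequentially. \<forall>w. n \<le> length w \<longrightarrow> \<not> (fst p \<in> B w \<and> snd p \<in> B w)"
      unfolding eventually_sequentially by (meson order_trans)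
  qed
  then have e2: "\<forall>\<^sub>F n in sequentially. \<forall>p\<in>{p\<in>G \<times> G. fst p \<noteq> snd p}. \<forall>w. n \<le> length w \<longrightarrow> \<not> (fst p \<in> B w \<and> snd p \<in> B w)"
    using G(1) by (intro eventually_ball_finite) auto
  obtain n0 where n0: "\<And>n x w. n0 \<le> n \<Longrightarrow> x \<in> G \<Longrightarrow> n \<le> length w \<Longrightarrow> x \<in> B w \<Longrightarrow> \<exists>t\<in>cantor. x = g t"
    "\<And>n x y w. n0 \<le> n \<Longrightarrow> x \<in> G \<Longrightarrow> y \<in> G \<Longrightarrow> x \<noteq> y \<Longrightarrow> n \<le> length w \<Longrightarrow> \<not> (x \<in> B w \<and> y \<in> B w)"
  proof -
    obtain N where N: "\<forall>n\<ge>N. (\<forall>x\<in>G. \<forall>w. n \<le> length w \<longrightarrow> x \<in> B w \<longrightarrow> (\<exists>t\<in>cantor. x = g t)) \<and>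
        (\<forall>p\<in>{p\<in>G \<times> G. fst p \<noteq> snd p}. \<forall>w. n \<le> length w \<longrightarrow> \<not> (fst p \<in> B w \<and> snd p \<in> B w))"
      using eventually_conj[OF e1 e2] unfolding eventually_sequentially by blast
    show thesis by (rule that[of N]) (use N in force)+
  qed
  \<comment> \<open>A multiple of four, so that in a node of this depth that contains the hub its
    relative position is again \<open>hub\<close>.\<close>
  define N where "N = 4 * n0"
  have N: "n0 \<le> N" by (simp add: N_def)
  have deep: "link_a w (F \<inter> B w) Z \<and> link_b w (F \<inter> B w) Z \<and> link_c w (F \<inter> B w) Z" if w: "length w = N" for w
  proof (cases "Z \<inter> B w = {}")
    case True
    show ?thesis
    proof (cases "F \<inter> B w = {}")
      case True
      then show ?thesis using link_empty[of w] \<open>Z \<inter> B w = {}\<close> by (auto intro: link_avoid)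
    next
      case False
      then obtain x where x: "x \<in> F" "x \<in> B w" by blast
      have "F \<inter> B w \<subseteq> {x}" using n0(2)[OF N, of _ x w] x w by (auto simp: G_def)
      moreover obtain t where t: "t \<in> cantor" "x = g t" using n0(1)[OF N, of x w] x w by (auto simp: G_def)
      moreover obtain r where "0 \<le> r" "r \<le> 1" "t = pos w r" using base_in_B[of t w] x t cantor_bounds by auto
      ultimately show ?thesis
        using link_single_a[of r w] link_single[of r w] pos_cantor_iff[of r w] \<open>Z \<inter> B w = {}\<close>
        by (metis link_avoid link_mono)
    qed
  next
    case False
    then have Zh: "Z = {g hub}" and hw: "g hub \<in> B w" using Z by auto
    have "F \<inter> B w = {}" using n0(2)[OF N, of "g hub" _ w] hw w Z Zh by (auto simp: G_def)
    moreover obtain r where "0 \<le> r" "r \<le> 1" "hub = pos w r" using base_in_B[OF hw] by (auto simp: hub_def)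
    moreover have "pos w hub = hub" using pos_eq_hub[of r w n0] calculation w by (simp add: N_def)
    ultimately show ?thesis using link_avoid_hub[of w] Zh by simp
  qed
  have "link_a w (F \<inter> B w) Z \<and> link_b w (F \<inter> B w) Z \<and> link_c w (F \<inter> B w) Z" if "length w \<le> N" for w
    using that
  proof (induction "N - length w" arbitrary: w)
    case 0
    then show ?case using deep by simp
  next
    case (Suc n)
    have Zw: "Z \<inter> (gap w \<union> ch w) = {}" using hub_not_on_edges Z by auto
    have sub: "F \<inter> B w \<subseteq> (F \<inter> B (w @ [False])) \<union> (F \<inter> B (w @ [True])) \<union> gap w \<union> ch w"
      using B_split[of w] by blast
    have "link_a (w @ [b]) (F \<inter> B (w @ [b])) Z \<and> link_b (w @ [b]) (F \<inter> B (w @ [b])) Z \<and> link_c (w @ [b]) (F \<inter> B (w @ [b])) Z" for b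
      using Suc.hyps(2) by (intro Suc.hyps(1)) auto
    then show ?case
      using link_mono[OF link_ac[OF Zw] sub] link_mono[OF link_aa[OF Zw] sub] link_mono[OF link_ab[OF Zw] sub] by blast
  qed
  from this[of "[]"] show ?thesis using F(2) by (simp add: Int_absorb2)
qed

end


section \<open>The necklace spaces\<close>

text \<open>\<open>Gap k u\<close> and \<open>Chord k u\<close> belong to the node \<open>u\<close>
  of bead \<open>k\<close>, \<open>Roof k\<close> turns its blob into a bead by joining the
  terminals 1/4 and 3/4, \<open>Link k\<close> leads to the next bead, and \<open>Close\<close> runs
  from the limit point back to the first bead.\<close>

datatype edge = Gap nat "bool list" | Chord nat "bool list" | Roof nat | Link nat | Close
datatype coord = Cell nat "bool list" | Tail nat | Bump edge | Skew edge

instance edge :: countable by countable_datatype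
instance coord :: countable by countable_datatype

text \<open>The point type is indexed by \<open>nat\<close>; through an enumeration of
  \<open>coord\<close> the coordinates get meaningful names.\<close>

definition point :: "(coord \<Rightarrow> real) \<Rightarrow> nat \<Rightarrow> real" where "point f = (\<lambda>i. f (from_nat i))"
definition coord :: "coord \<Rightarrow> (nat \<Rightarrow> real) \<Rightarrow> real" where "coord c x = x (to_nat c)"

lemma coord_point [simp]: "coord c (point f) = f c"
  by (simp add: coord_def point_def)

lemma point_eq_iff [simp]: "point f = point g \<longleftrightarrow> f = g"
  by (metis coord_point ext)

lemma continuous_on_point:
  assumes "\<And>c. continuous_on S (\<lambda>t. f t c)"
  shows "continuous_on S (\<lambda>t. point (f t))"
  unfolding point_def using assms by (intro continuous_on_coordinatewise_then_product)

lemma continuous_on_coord [continuous_intros]: "continuous_on S f \<Longrightarrow> continuous_on S (\<lambda>x. coord c (f x))"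
  unfolding coord_def by (rule continuous_on_product_then_coordinatewise)

lemma continuous_on_if_const: "continuous_on A f \<Longrightarrow> continuous_on A g \<Longrightarrow> continuous_on A (\<lambda>x. if b then f x else g x)"
  by (cases b) simp_all

lemma open_contains_box:
  fixes U :: "(nat \<Rightarrow> real) set"
  assumes "open U" "x \<in> U"
  obtains I where "finite I" "\<exists>e>0. {y. \<forall>i\<in>I. \<bar>y i - x i\<bar> < e} \<subseteq> U"
proof -
  have "openin (product_topology (\<lambda>i. euclidean) UNIV) U" using assms(1) by (simp add: euclidean_product_topology)
  then obtain W where W: "x \<in> Pi\<^sub>E UNIV W" "\<And>i. open (W i)" "finite {i. W i \<noteq> UNIV}" "Pi\<^sub>E UNIV W \<subseteq> U"
    using product_topology_open_contains_basis[of "\<lambda>i. euclidean" UNIV U x] assms(2) by auto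
  define I where "I = {i. W i \<noteq> UNIV}"
  have "\<forall>i\<in>I. \<exists>e>0. {y. \<bar>y - x i\<bar> < e} \<subseteq> W i"
  proof
    fix i assume "i \<in> I"
    have "x i \<in> W i" using W(1) by (auto simp: PiE_iff)
    then obtain e where e: "0 < e" "ball (x i) e \<subseteq> W i" using openE[OF W(2)[of i]] by metis
    have "{y. \<bar>y - x i\<bar> < e} = ball (x i) e" by (auto simp: dist_real_def)
    then show "\<exists>e>0. {y. \<bar>y - x i\<bar> < e} \<subseteq> W i" using e by auto
  qed
  then obtain e where e: "\<And>i. i \<in> I \<Longrightarrow> 0 < e i" "\<And>i. i \<in> I \<Longrightarrow> {y. \<bar>y - x i\<bar> < e i} \<subseteq> W i" by metis
  have fin: "finite I" using W(3) by (simp add: I_def)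
  define d where "d = Min (insert 1 (e ` I))"
  have d: "0 < d" "\<And>i. i \<in> I \<Longrightarrow> d \<le> e i" using fin e(1) by (auto simp: d_def)
  have "y \<in> U" if "\<forall>i\<in>I. \<bar>y i - x i\<bar> < d" for y
  proof -
    have "y i \<in> W i" for i
    proof (cases "i \<in> I")
      case True
      then show ?thesis using that d(2)[of i] e(2)[of i] by force
    next
      case False
      then show ?thesis by (simp add: I_def)
    qed
    then show ?thesis using W(4) by (auto simp: PiE_iff)
  qed
  then show thesis using that[OF fin] d(1) by blast
qed

text \<open>By compactness one finite set \<open>C\<close> serves all points of \<open>S\<close>.
  Convergence to a compact set thus becomes exact agreement in finitely many coordinates, without
  estimates.\<close>

lemma compact_determined_by_coordinates:
  fixes S :: "(nat \<Rightarrow> real) set"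
  assumes "compact S" "open U" "S \<subseteq> U"
  obtains C where "finite C" "\<And>f g. point f \<in> S \<Longrightarrow> (\<And>c. c \<in> C \<Longrightarrow> g c = f c) \<Longrightarrow> point g \<in> U"
proof -
  have "\<forall>x\<in>S. \<exists>I e. finite I \<and> e > 0 \<and> {y. \<forall>i\<in>I. \<bar>y i - x i\<bar> < e} \<subseteq> U"
  proof
    fix x assume "x \<in> S"
    then have "x \<in> U" using assms(3) by blast
    then obtain I where "finite I" "\<exists>e>0. {y. \<forall>i\<in>I. \<bar>y i - x i\<bar> < e} \<subseteq> U"
      by (rule open_contains_box[OF assms(2)])
    then show "\<exists>I e. finite I \<and> e > 0 \<and> {y. \<forall>i\<in>I. \<bar>y i - x i\<bar> < e} \<subseteq> U" by blast
  qed
  from bchoice[OF this] obtain I where "\<forall>x\<in>S. \<exists>e. finite (I x) \<and> e > 0 \<and> {y. \<forall>i\<in>I x. \<bar>y i - x i\<bar> < e} \<subseteq> U" ..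
  from bchoice[OF this] obtain e where Ie: "\<And>x. x \<in> S \<Longrightarrow> finite (I x) \<and> e x > 0 \<and> {y. \<forall>i\<in>I x. \<bar>y i - x i\<bar> < e x} \<subseteq> U"
    by blast
  define W where "W = (\<lambda>x. {y. \<forall>i\<in>I x. y i \<in> ball (x i) (e x)})"
  have "open (W x)" if "x \<in> S" for x
    unfolding W_def using Ie[OF that] product_topology_basis'[of "I x" "\<lambda>i. ball (x i) (e x)" "\<lambda>i. i"] by auto
  moreover have "S \<subseteq> (\<Union>x\<in>S. W x)" using Ie by (auto simp: W_def)
  ultimately obtain D where D: "D \<subseteq> S" "finite D" "S \<subseteq> (\<Union>x\<in>D. W x)"
    using compactE_image[OF assms(1), of S W] by metis
  show thesis
  proof (rule that[of "from_nat ` (\<Union>x\<in>D. I x) :: coord set"])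
    have "finite (\<Union>x\<in>D. I x)" using D Ie by (intro finite_UN_I) auto
    then show "finite (from_nat ` (\<Union>x\<in>D. I x) :: coord set)" by (rule finite_imageI)
    fix f g assume f: "point f \<in> S" and eq: "\<And>c. c \<in> from_nat ` (\<Union>x\<in>D. I x) \<Longrightarrow> g c = f c"
    then obtain x where x: "x \<in> D" "point f \<in> W x" using D(3) by blast
    have "point g i = point f i" if "i \<in> I x" for i
      using eq[of "from_nat i"] that x(1) by (auto simp: point_def)
    then have "point g \<in> W x" using x(2) by (simp add: W_def)
    moreover have "W x = {y. \<forall>i\<in>I x. \<bar>y i - x i\<bar> < e x}" by (auto simp: W_def dist_real_def abs_minus_commute)
    ultimately show "point g \<in> U" using Ie[of x] x(1) D(1) by blast
  qed
qed

text \<open>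
  The points of bead \<open>k\<close>. Subtracting the value at the hub makes the \<open>Cell\<close> coordinates of all hubs
  vanish; the \<open>Tail\<close> coordinates then separate hubs of different groups. The coordinates \<open>Bump e\<close>
  and \<open>Skew e\<close> are nonzero only inside the edge \<open>e\<close>, where \<open>Skew e / Bump e\<close> is the parameter along \<open>e\<close>.
\<close>

fun bead_at :: "(nat \<Rightarrow> nat) \<Rightarrow> nat \<Rightarrow> real \<Rightarrow> coord \<Rightarrow> real" where
  "bead_at grp k t (Cell j w) = (if j = k then node w t - node w hub else 0)"
| "bead_at grp k t (Tail n) = of_bool (n \<le> grp k)"
| "bead_at grp k t (Bump (Gap j u)) = (if j = k then ramp u t * (1 - ramp u t) else 0)"
| "bead_at grp k t (Skew (Gap j u)) = (if j = k then ramp u t * ramp u t * (1 - ramp u t) else 0)"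
| "bead_at grp k t _ = 0"

text \<open>The limit of the beads: with growing \<open>k\<close> each \<open>Tail\<close>
  coordinate becomes 1, since the group numbers tend to infinity, and every other coordinate becomes
  0.\<close>

fun limit_at :: "coord \<Rightarrow> real" where
  "limit_at (Tail n) = 1"
| "limit_at _ = 0"

fun src :: "(nat \<Rightarrow> nat) \<Rightarrow> edge \<Rightarrow> coord \<Rightarrow> real" and dst :: "(nat \<Rightarrow> nat) \<Rightarrow> edge \<Rightarrow> coord \<Rightarrow> real" where
  "src grp (Gap k u) = bead_at grp k (pos u (1/3))"
| "dst grp (Gap k u) = bead_at grp k (pos u (2/3))"
| "src grp (Chord k u) = bead_at grp k (pos u (1/12))"
| "dst grp (Chord k u) = bead_at grp k (pos u (11/12))"
| "src grp (Roof k) = bead_at grp k (1/4)"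
| "dst grp (Roof k) = bead_at grp k (3/4)"
| "src grp (Link k) = bead_at grp k 1"
| "dst grp (Link k) = bead_at grp (Suc k) 0"
| "src grp Close = limit_at"
| "dst grp Close = bead_at grp 0 0"

fun edge_at :: "(nat \<Rightarrow> nat) \<Rightarrow> edge \<Rightarrow> real \<Rightarrow> coord \<Rightarrow> real" where
  "edge_at grp e s (Bump e') = (if e' = e then s * (1 - s) else 0)"
| "edge_at grp e s (Skew e') = (if e' = e then s * s * (1 - s) else 0)"
| "edge_at grp e s c = (1 - s) * src grp e c + s * dst grp e c"

text \<open>\<open>grp k\<close> is the group of bead \<open>k\<close>; hubs of beads in the same
  group coincide. The assumptions make each group a finite block of consecutive beads and let the
  beads converge. \<open>cl\<close> tells whether the closing edge is present.\<close>

locale necklace =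
  fixes grp :: "nat \<Rightarrow> nat" and cl :: bool
  assumes grp_mono: "mono grp" and grp_fin: "\<And>n. finite {k. grp k < n}"
begin

definition P :: "nat \<Rightarrow> real \<Rightarrow> nat \<Rightarrow> real" where "P k t = point (bead_at grp k t)"
definition Q :: "nat \<Rightarrow> real" where "Q = point limit_at"
definition S :: "edge \<Rightarrow> real \<Rightarrow> nat \<Rightarrow> real" where "S e s = point (edge_at grp e s)"
definition E :: "edge set" where "E = {e. e = Close \<longrightarrow> cl}"
definition V :: "(nat \<Rightarrow> real) set" where "V = insert Q (\<Union>k. P k ` cantor)"
definition X :: "(nat \<Rightarrow> real) set" where "X = V \<union> (\<Union>e\<in>E. S e ` {0..1})"

abbreviation T :: "(nat \<Rightarrow> real) topology" where "T \<equiv> top_of_set X"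

definition vertex :: "(coord \<Rightarrow> real) \<Rightarrow> bool" where
  "vertex f \<longleftrightarrow> f = limit_at \<or> (\<exists>k. \<exists>t\<in>cantor. f = bead_at grp k t)"

lemma point_in_V: "point f \<in> V \<longleftrightarrow> vertex f"
  by (auto simp: V_def Q_def P_def vertex_def)

lemma V_cases: assumes "x \<in> V" obtains f where "x = point f" "vertex f"
  using assms by (auto simp: V_def Q_def P_def vertex_def)

lemma vertex_bump: "vertex f \<Longrightarrow> f (Bump e) = 0" "vertex f \<Longrightarrow> f (Skew e) = 0"
proof -
  show "vertex f \<Longrightarrow> f (Bump e) = 0"
    by (cases e) (auto simp: vertex_def dest: cantor_ramp)
  show "vertex f \<Longrightarrow> f (Skew e) = 0"
    by (cases e) (auto simp: vertex_def dest: cantor_ramp)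
qed

lemma pos_edge_ends_cantor [simp]:
  "pos u (1/3) \<in> cantor" "pos u (2/3) \<in> cantor" "pos u (1/12) \<in> cantor" "pos u (11/12) \<in> cantor"
  by (simp_all add: pos_cantor_iff)

lemma vertex_base [simp]: "t \<in> cantor \<Longrightarrow> vertex (bead_at grp k t)" and vertex_lim [simp]: "vertex limit_at"
  by (auto simp: vertex_def)

lemma vertex_src [simp]: "vertex (src grp e)" and vertex_dst [simp]: "vertex (dst grp e)"
  by (cases e; simp)+

lemma S_0: "S e 0 = point (src grp e)" and S_1: "S e 1 = point (dst grp e)"
proof -
  have "edge_at grp e 0 c = src grp e c" "edge_at grp e 1 c = dst grp e c" for c
    by (cases c; simp add: vertex_bump)+
  then show "S e 0 = point (src grp e)" "S e 1 = point (dst grp e)" by (auto simp: S_def)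
qed

text \<open>The \<open>Cell k\<close> coordinates vanish on all other beads, so a point common to
  two beads has the node values of the hub and is the hub by \<open>node_separates\<close>. The
  \<open>Tail\<close> coordinates then compare the groups.\<close>

lemma base_eqD:
  assumes "bead_at grp k t = bead_at grp j s" "t \<in> cantor" "s \<in> cantor"
  shows "k = j \<and> t = s \<or> t = hub \<and> s = hub \<and> grp k = grp j"
proof (cases "k = j")
  case True
  have "node w t = node w s" for w using fun_cong[OF assms(1), of "Cell k w"] True by simp
  then have "t = s" using node_separates[OF assms(2,3)] by fastforce
  then show ?thesis using True by simp
next
  case False
  have "node w t = node w hub" "node w s = node w hub" for w
    using fun_cong[OF assms(1), of "Cell k w"] fun_cong[OF assms(1), of "Cell j w"] False by auto
  then have "t = hub" "s = hub" using node_separates[of t hub] node_separates[of s hub] assms by fastforce+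
  moreover have "grp k = grp j"
    using fun_cong[OF assms(1), of "Tail (grp k)"] fun_cong[OF assms(1), of "Tail (grp j)"] by (auto simp: of_bool_def split: if_splits)
  ultimately show ?thesis by simp
qed

lemma base_inj: "bead_at grp k t = bead_at grp k s \<Longrightarrow> t \<in> cantor \<Longrightarrow> s \<in> cantor \<Longrightarrow> t = s"
  using base_eqD by metis

lemma base_ne_lim: "bead_at grp k t \<noteq> limit_at"
proof
  assume eq: "bead_at grp k t = limit_at"
  show False using fun_cong[OF eq, of "Tail (Suc (grp k))"] by simp
qed

lemma src_ne_dst: "src grp e \<noteq> dst grp e"
proof
  assume eq: "src grp e = dst grp e"
  show False
  proof (cases e)
    case (Gap k u)
    then show False using base_inj[of k "pos u (1/3)" "pos u (2/3)"] eq by auto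
  next
    case (Chord k u)
    then show False using base_inj[of k "pos u (1/12)" "pos u (11/12)"] eq by auto
  next
    case (Roof k)
    then show False using base_inj[of k "1/4" "3/4"] eq by auto
  next
    case (Link k)
    then show False using base_eqD[of k 1 "Suc k" 0] eq by (auto simp: hub_def)
  next
    case Close
    then show False using eq base_ne_lim[of 0 0] by (metis dst.simps(5) src.simps(5))
  qed
qed

lemma S_bump: "coord (Bump e') (S e s) = (if e' = e then s * (1 - s) else 0)"
  and S_skew: "coord (Skew e') (S e s) = (if e' = e then s * s * (1 - s) else 0)"
  by (auto simp: S_def)

lemma S_vertex_iff:
  assumes "0 \<le> s" "s \<le> 1"
  shows "S e s \<in> V \<longleftrightarrow> s = 0 \<or> s = 1"
proof
  assume "S e s \<in> V"
  then have "coord (Bump e) (S e s) = 0" by (metis V_cases coord_point vertex_bump(1))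
  then show "s = 0 \<or> s = 1" by (simp add: S_bump)
qed (auto simp: S_0 S_1 point_in_V)

lemma S_inj:
  assumes "S e s = S e' s'" "0 < s" "s < 1" "0 \<le> s'" "s' \<le> 1"
  shows "e = e' \<and> s = s'"
proof -
  have "coord (Bump e) (S e' s') \<noteq> 0" using assms(2,3) by (simp add: S_bump flip: assms(1))
  then have e: "e = e'" by (simp add: S_bump split: if_splits)
  have b: "s * (1 - s) = s' * (1 - s')" using arg_cong[OF assms(1), of "coord (Bump e)"] e by (simp add: S_bump)
  have "s * s * (1 - s) = s' * s' * (1 - s')" using arg_cong[OF assms(1), of "coord (Skew e)"] e by (simp add: S_skew)
  then have "s * (s * (1 - s)) = s' * (s * (1 - s))" using b by (simp add: mult.assoc)
  then have "s = s'" using assms by simp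
  then show ?thesis using e by simp
qed

lemma continuous_on_S: "continuous_on A (S e)"
  unfolding S_def
proof (rule continuous_on_point)
  show "continuous_on A (\<lambda>t. edge_at grp e t c)" for c
    by (cases c) (auto intro!: continuous_intros continuous_on_if_const)
qed

lemma S_arc: "arc_from (S e ` {0..1}) (point (src grp e)) (point (dst grp e))"
proof -
  have "inj_on (S e) {0..1}"
  proof (rule inj_onI)
    fix s s' assume s: "s \<in> {0..1}" "s' \<in> {0..1}" "S e s = S e s'"
    show "s = s'"
    proof (cases "(0 < s \<and> s < 1) \<or> (0 < s' \<and> s' < 1)")
      case True
      then show ?thesis using S_inj[of e s e s'] S_inj[of e s' e s] s by auto
    next
      case False
      then have "s \<in> {0,1}" "s' \<in> {0,1}" using s by auto
      then show ?thesis using s src_ne_dst[of e] by (auto simp: S_0 S_1)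
    qed
  qed
  then show ?thesis using arc_from_image[of 0 1 "S e"] continuous_on_S by (simp add: S_0 S_1)
qed

text \<open>Therefore \<open>P k\<close>, which is defined on all of [0, 1], runs through vertices
  and gap edges only and can serve as the base line of a blob.\<close>

lemma P_gap:
  assumes "0 \<le> s" "s \<le> 1"
  shows "P k (pos u ((1 + s) / 3)) = S (Gap k u) s"
proof -
  have "bead_at grp k (pos u ((1 + s) / 3)) c = edge_at grp (Gap k u) s c" for c
  proof (cases c)
    case (Cell j w)
    then show ?thesis using node_gap[OF assms] by (simp add: algebra_simps)
  next
    case (Tail n)
    then show ?thesis by (simp add: algebra_simps)
  next
    case (Bump e)
    then show ?thesis using ramp_gap[OF assms, of u] by (cases e) (auto dest: ramp_gap(2)[OF assms])
  next
    case (Skew e)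
    then show ?thesis using ramp_gap[OF assms, of u] by (cases e) (auto dest: ramp_gap(2)[OF assms])
  qed
  then show ?thesis by (auto simp: P_def S_def)
qed

lemma gap_param:
  assumes "0 \<le> t" "t \<le> 1" "t \<notin> cantor"
  obtains u s where "0 < s" "s < 1" "t = pos u ((1 + s) / 3)"
proof -
  obtain u where u: "0 < ramp u t" "ramp u t < 1"
    using assms ramp_bounds[of _ t] by (fastforce simp: cantor_def order_le_less)
  then show thesis using that[of "ramp u t" u] ramp_between[OF u] by simp
qed

lemma P_in_X: "0 \<le> t \<Longrightarrow> t \<le> 1 \<Longrightarrow> P k t \<in> X"
proof (cases "t \<in> cantor")
  case False
  assume "0 \<le> t" "t \<le> 1"
  then obtain u s where "0 < s" "s < 1" "t = pos u ((1 + s) / 3)" using gap_param False by metis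
  then have "P k t = S (Gap k u) s" "s \<in> {0..1}" "Gap k u \<in> E" using P_gap by (auto simp: E_def)
  then show ?thesis unfolding X_def by blast
qed (auto simp: X_def V_def)

lemma P_in_V_iff:
  assumes "0 \<le> t" "t \<le> 1"
  shows "P k t \<in> V \<longleftrightarrow> t \<in> cantor"
proof
  assume v: "P k t \<in> V"
  show "t \<in> cantor"
  proof (rule ccontr)
    assume "t \<notin> cantor"
    then obtain u s where us: "0 < s" "s < 1" "t = pos u ((1 + s) / 3)" using gap_param assms by metis
    then show False using v P_gap[of s k u] S_vertex_iff[of s] by simp
  qed
qed (auto simp: V_def)

lemma P_eqD:
  assumes "P k t = P j s" "0 \<le> t" "t \<le> 1" "0 \<le> s" "s \<le> 1"
  shows "k = j \<and> t = s \<or> t = hub \<and> s = hub \<and> grp k = grp j"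
proof (cases "t \<in> cantor")
  case True
  then have "s \<in> cantor" using P_in_V_iff assms by metis
  then show ?thesis using base_eqD True assms(1) by (auto simp: P_def)
next
  case False
  then have s: "s \<notin> cantor" using P_in_V_iff assms by metis
  obtain u a where a: "0 < a" "a < 1" "t = pos u ((1 + a) / 3)" using gap_param assms False by metis
  obtain v b where b: "0 < b" "b < 1" "s = pos v ((1 + b) / 3)" using gap_param assms s by metis
  have "S (Gap k u) a = S (Gap j v) b" using assms(1) a b P_gap by simp
  then show ?thesis using S_inj[of "Gap k u" a "Gap j v" b] a b by auto
qed

lemma continuous_on_P: "continuous_on A (P k)"
  unfolding P_def
proof (rule continuous_on_point)
  fix c
  show "continuous_on A (\<lambda>t. bead_at grp k t c)"
  proof (cases c)
    case (Bump e)
    then show ?thesis by (cases e) (auto intro!: continuous_intros continuous_on_if_const)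
  next
    case (Skew e)
    then show ?thesis by (cases e) (auto intro!: continuous_intros continuous_on_if_const)
  qed (auto intro!: continuous_intros continuous_on_if_const)
qed

lemma P_ne_Q: "0 \<le> t \<Longrightarrow> t \<le> 1 \<Longrightarrow> P k t \<noteq> Q"
  using base_ne_lim by (simp add: P_def Q_def)

lemma P_on_edge:
  assumes "P k t = S e s" "0 \<le> t" "t \<le> 1" "0 \<le> s" "s \<le> 1" "\<And>u. e \<noteq> Gap k u"
  shows "s = 0 \<or> s = 1"
proof (rule ccontr)
  assume n: "\<not> (s = 0 \<or> s = 1)"
  then have "P k t \<notin> V" using S_vertex_iff assms by auto
  then have "t \<notin> cantor" using P_in_V_iff assms by blast
  then obtain u a where "0 < a" "a < 1" "t = pos u ((1 + a) / 3)" using gap_param assms by metis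
  then have "S (Gap k u) a = S e s" using P_gap assms(1) by simp
  then show False using S_inj[of "Gap k u" a e s] \<open>0 < a\<close> \<open>a < 1\<close> assms by auto
qed

lemma blob_P: "blob (P k) (\<lambda>u. S (Chord k u) ` {0..1})"
proof
  show "continuous_on {0..1} (P k)" by (rule continuous_on_P)
  show "inj_on (P k) {0..1}" using P_eqD[of k _ k] by (intro inj_onI) auto
  show "arc_from (S (Chord k u) ` {0..1}) (P k (pos u (1/12))) (P k (pos u (11/12)))" for u
    using S_arc[of "Chord k u"] by (simp add: P_def)
  show "t = pos u (1/12) \<or> t = pos u (11/12)" if t: "0 \<le> t" "t \<le> 1" "P k t \<in> S (Chord k u) ` {0..1}" for u t
  proof -
    obtain s where s: "0 \<le> s" "s \<le> 1" "P k t = S (Chord k u) s" using t(3) by auto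
    then have "s = 0 \<or> s = 1" using P_on_edge t by blast
    then have "P k t = P k (pos u (1/12)) \<or> P k t = P k (pos u (11/12))" using s(3) by (auto simp: S_0 S_1 P_def)
    then show ?thesis using P_eqD[of k t k "pos u (1/12)"] P_eqD[of k t k "pos u (11/12)"] t pos_bounds[of "1/12" u] pos_bounds[of "11/12" u] by auto
  qed
  show "S (Chord k u) ` {0..1} \<inter> S (Chord k v) ` {0..1} = {}" if uv: "u \<noteq> v" for u v
  proof -
    have False if s: "s \<in> {0..1}" "r \<in> {0..1}" "S (Chord k u) s = S (Chord k v) r" for s r
    proof -
      have "\<not> (0 < s \<and> s < 1)" "\<not> (0 < r \<and> r < 1)"
        using S_inj[of "Chord k u" s "Chord k v" r] S_inj[of "Chord k v" r "Chord k u" s] s uv by auto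
      then have "s = 0 \<or> s = 1" "r = 0 \<or> r = 1" using s by auto
      then obtain a b where ab: "a \<in> {1/12, 11/12}" "b \<in> {1/12, 11/12}" "bead_at grp k (pos u a) = bead_at grp k (pos v b)"
        using s(3) S_0[of "Chord k u"] S_1[of "Chord k u"] S_0[of "Chord k v"] S_1[of "Chord k v"] by force
      then have "pos u a = pos v b" using base_inj[of k "pos u a" "pos v b"] by (metis insertE pos_edge_ends_cantor(3,4) singletonD)
      then show False using pos_inj[of u a v b] ab uv by auto
    qed
    then show ?thesis by blast
  qed
qed

end


section \<open>Necklaces are graph-like continua\<close>

lemma node_pos_const:
  assumes "\<not> prefix v w" "0 \<le> a" "a \<le> 1"
  shows "node w (pos v a) = of_bool (prefix w v)"
  using assms node_pos_prefix[of w v a] node_pos_parallel[of v w a] by (cases "prefix w v") auto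

lemma node_ne_imp_prefix:
  assumes "node w (pos v a) \<noteq> node w (pos v b)" "0 \<le> a" "a \<le> 1" "0 \<le> b" "b \<le> 1"
  shows "prefix v w"
  using assms node_pos_const by metis

lemma finite_prefixes: "finite {v. prefix v w}"
  by (metis List.finite_set set_prefixes_eq)

fun edge_index :: "edge \<Rightarrow> nat" where
  "edge_index (Gap k u) = k" | "edge_index (Chord k u) = k" | "edge_index (Roof k) = k"
| "edge_index (Link k) = k" | "edge_index Close = 0"

context necklace
begin

text \<open>\<open>node w\<close> changes along a gap or chord only if the node of this edge is
  \<open>w\<close> or one of its finitely many ancestors. Apart from these only the roof and the
  links of bead \<open>j\<close> and the closing edge can matter.\<close>

lemma finite_crossing_Cell: "finite {e. src grp e (Cell j w) \<noteq> dst grp e (Cell j w)}"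
proof (rule finite_subset)
  show "{e. src grp e (Cell j w) \<noteq> dst grp e (Cell j w)} \<subseteq>
      {Roof j, Link j, Link (j - 1), Close} \<union> Gap j ` {v. prefix v w} \<union> Chord j ` {v. prefix v w}"
  proof
    fix e assume "e \<in> {e. src grp e (Cell j w) \<noteq> dst grp e (Cell j w)}"
    then show "e \<in> {Roof j, Link j, Link (j - 1), Close} \<union> Gap j ` {v. prefix v w} \<union> Chord j ` {v. prefix v w}"
      by (cases e) (auto dest: node_ne_imp_prefix split: if_splits)
  qed
qed (auto simp: finite_prefixes)

lemma crossing_Tail:
  assumes "src grp e (Tail n) \<noteq> dst grp e (Tail n)"
  shows "e = Close \<or> (\<exists>k. e = Link k \<and> grp k < n \<and> n \<le> grp (Suc k))"
proof (cases e)
  case (Link k)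
  then show ?thesis using assms monoD[OF grp_mono, of k "Suc k"] by (auto simp: of_bool_def split: if_splits)
qed (use assms in auto)

text \<open>A monotone sequence passes a level in a single step. So each \<open>Tail\<close>
  coordinate changes along at most one link.\<close>

lemma group_jump_unique:
  assumes "grp j < n \<and> n \<le> grp (Suc j)" "grp k < n \<and> n \<le> grp (Suc k)"
  shows "j = k"
proof (rule ccontr)
  assume "j \<noteq> k"
  then have "Suc j \<le> k \<or> Suc k \<le> j" by linarith
  then show False using monoD[OF grp_mono, of "Suc j" k] monoD[OF grp_mono, of "Suc k" j] assms by linarith
qed

lemma finite_crossing_Tail: "finite {e. src grp e (Tail n) \<noteq> dst grp e (Tail n)}"
proof (rule finite_subset)
  show "{e. src grp e (Tail n) \<noteq> dst grp e (Tail n)} \<subseteq> insert Close (Link ` {k. grp k < n})"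
    using crossing_Tail by blast
qed (auto simp: grp_fin)

lemma seg_Cell_Tail: "edge_at grp e s c = (1 - s) * src grp e c + s * dst grp e c" if "\<forall>e'. c \<noteq> Bump e' \<and> c \<noteq> Skew e'"
  using that by (cases c) auto

text \<open>Together with \<open>compact_determined_by_coordinates\<close> this puts all but
  finitely many edges into a given neighbourhood of the vertex set, since an edge agrees with its
  initial vertex in the relevant coordinates.\<close>

lemma finite_nonconstant: "finite {e. \<exists>s. edge_at grp e s c \<noteq> src grp e c}"
proof -
  have *: "{e. \<exists>s. edge_at grp e s c \<noteq> src grp e c} \<subseteq> {e. src grp e c \<noteq> dst grp e c}" if "\<forall>e'. c \<noteq> Bump e' \<and> c \<noteq> Skew e'"
    unfolding seg_Cell_Tail[OF that] by (auto simp: algebra_simps)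
  show ?thesis
  proof (cases c)
    case (Cell j w)
    then show ?thesis using * finite_crossing_Cell[of j w] finite_subset by auto
  next
    case (Tail n)
    then show ?thesis using * finite_crossing_Tail[of n] finite_subset by auto
  next
    case (Bump e')
    then have "{e. \<exists>s. edge_at grp e s c \<noteq> src grp e c} \<subseteq> {e'}" by (auto simp: vertex_bump split: if_splits)
    then show ?thesis using finite_subset by auto
  next
    case (Skew e')
    then have "{e. \<exists>s. edge_at grp e s c \<noteq> src grp e c} \<subseteq> {e'}" by (auto simp: vertex_bump split: if_splits)
    then show ?thesis using finite_subset by auto
  qed
qed

lemma finite_far: "finite {k. \<exists>t. bead_at grp k t c \<noteq> limit_at c}"
proof -
  have "{k. \<exists>t. bead_at grp k t c \<noteq> limit_at c} \<subseteq> (case c of Cell j w \<Rightarrow> {j} | Tail n \<Rightarrow> {k. grp k < n} | Bump e \<Rightarrow> {edge_index e} | Skew e \<Rightarrow> {edge_index e})"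
  proof (cases c)
    case (Bump e)
    then show ?thesis by (cases e) (auto split: if_splits)
  next
    case (Skew e)
    then show ?thesis by (cases e) (auto split: if_splits)
  qed (auto split: if_splits)
  moreover have "finite (case c of Cell j w \<Rightarrow> {j} | Tail n \<Rightarrow> {k. grp k < n} | Bump e \<Rightarrow> {edge_index e} | Skew e \<Rightarrow> {edge_index e})"
    using grp_fin by (cases c) auto
  ultimately show ?thesis by (rule finite_subset)
qed

lemma compact_V: "compact V"
proof -
  have "compact ({Q} \<union> (\<Union>k\<in>UNIV. P k ` cantor))"
  proof (rule compact_UN_converging)
    show "compact (P k ` cantor)" for k using compact_continuous_image[OF continuous_on_P compact_cantor] .
    fix U :: "(nat \<Rightarrow> real) set" assume U: "open U" "{Q} \<subseteq> U"
    obtain C where C: "finite C" "\<And>f g. point f \<in> {Q} \<Longrightarrow> (\<And>c. c \<in> C \<Longrightarrow> g c = f c) \<Longrightarrow> point g \<in> U"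
      using compact_determined_by_coordinates[OF _ U] by auto
    have "{k \<in> UNIV. \<not> P k ` cantor \<subseteq> U} \<subseteq> (\<Union>c\<in>C. {k. \<exists>t. bead_at grp k t c \<noteq> limit_at c})"
    proof
      fix k assume "k \<in> {k \<in> UNIV. \<not> P k ` cantor \<subseteq> U}"
      then obtain t where "point (bead_at grp k t) \<notin> U" by (auto simp: P_def)
      then have "\<exists>c\<in>C. bead_at grp k t c \<noteq> limit_at c" using C(2)[of limit_at "bead_at grp k t"] by (auto simp: Q_def)
      then show "k \<in> (\<Union>c\<in>C. {k. \<exists>t. bead_at grp k t c \<noteq> limit_at c})" by blast
    qed
    then show "finite {k \<in> UNIV. \<not> P k ` cantor \<subseteq> U}"
      by (rule finite_subset) (use C(1) finite_far in blast)
  qed auto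
  then show ?thesis by (simp add: V_def)
qed

lemma compact_X: "compact X"
  unfolding X_def
proof (rule compact_UN_converging[OF compact_V])
  show "compact (S e ` {0..1})" for e using compact_continuous_image[OF continuous_on_S compact_Icc] .
  fix U :: "(nat \<Rightarrow> real) set" assume U: "open U" "V \<subseteq> U"
  obtain C where C: "finite C" "\<And>f g. point f \<in> V \<Longrightarrow> (\<And>c. c \<in> C \<Longrightarrow> g c = f c) \<Longrightarrow> point g \<in> U"
    using compact_determined_by_coordinates[OF compact_V U] by auto
  have "{e \<in> E. \<not> S e ` {0..1} \<subseteq> U} \<subseteq> (\<Union>c\<in>C. {e. \<exists>s. edge_at grp e s c \<noteq> src grp e c})"
  proof
    fix e assume "e \<in> {e \<in> E. \<not> S e ` {0..1} \<subseteq> U}"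
    then obtain s where "S e s \<notin> U" by auto
    then show "e \<in> (\<Union>c\<in>C. {e. \<exists>s. edge_at grp e s c \<noteq> src grp e c})"
      using C(2)[of "src grp e" "edge_at grp e s"] by (auto simp: S_def point_in_V)
  qed
  then show "finite {e \<in> E. \<not> S e ` {0..1} \<subseteq> U}"
    by (rule finite_subset) (use C(1) finite_nonconstant in blast)
qed

lemma beads_converge:
  assumes "open U" "Q \<in> U"
  obtains N where "\<And>k t. N \<le> k \<Longrightarrow> P k t \<in> U" "\<And>e s. e \<noteq> Close \<Longrightarrow> N \<le> edge_index e \<Longrightarrow> S e s \<in> U"
proof -
  obtain C where C: "finite C" "\<And>f g. point f \<in> {Q} \<Longrightarrow> (\<And>c. c \<in> C \<Longrightarrow> g c = f c) \<Longrightarrow> point g \<in> U"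
    using compact_determined_by_coordinates[of "{Q}", OF _ assms(1)] assms(2) by auto
  define F where "F = (\<Union>c\<in>C. {k. \<exists>t. bead_at grp k t c \<noteq> limit_at c}) \<union> edge_index ` (\<Union>c\<in>C. {e. \<exists>s. edge_at grp e s c \<noteq> src grp e c})"
  have "finite F" unfolding F_def by (intro finite_UnI finite_UN_I finite_imageI C(1) finite_far finite_nonconstant)
  then obtain N where N: "\<And>k. k \<in> F \<Longrightarrow> k < N" unfolding finite_nat_set_iff_bounded by blast
  have bead_at: "bead_at grp k t c = limit_at c" if "N \<le> k" "c \<in> C" for k t c
  proof (rule ccontr)
    assume "bead_at grp k t c \<noteq> limit_at c"
    then have "k \<in> F" using that(2) unfolding F_def by blast
    then show False using N[of k] that(1) by simp
  qed
  show thesis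
  proof
    show "P k t \<in> U" if "N \<le> k" for k t
      using C(2)[of limit_at "bead_at grp k t"] bead_at[OF that] by (simp add: P_def Q_def)
    show "S e s \<in> U" if e: "e \<noteq> Close" "N \<le> edge_index e" for e s
    proof -
      have "edge_at grp e s c = limit_at c" if "c \<in> C" for c
      proof -
        have "edge_at grp e s c = src grp e c"
        proof (rule ccontr)
          assume "edge_at grp e s c \<noteq> src grp e c"
          then have "edge_index e \<in> F" using that unfolding F_def by blast
          then show False using N[of "edge_index e"] e(2) by simp
        qed
        also have "\<dots> = limit_at c" using e bead_at[OF _ that, of "edge_index e"] by (cases e) auto
        finally show ?thesis .
      qed
      then show ?thesis using C(2)[of limit_at "edge_at grp e s"] by (simp add: S_def Q_def)
    qed
  qed
qed

section \<open>Zero-dimensionality of the vertex set and the product structure of its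
  complement\<close>

lemma V_subset_X: "V \<subseteq> X"
  by (auto simp: X_def)

lemma vertex_Ints: "vertex f \<Longrightarrow> f c \<in> \<int>"
proof -
  have "bead_at grp k t c \<in> \<int>" if "t \<in> cantor" for k t
  proof -
    have "vertex (bead_at grp k t)" using that by simp
    then show ?thesis using node_cantor[OF that] node_cantor[OF hub_cantor] by (cases c) (simp_all add: vertex_bump)
  qed
  moreover have "limit_at c \<in> \<int>" by (cases c) auto
  ultimately show "vertex f \<Longrightarrow> f c \<in> \<int>" by (auto simp: vertex_def)
qed

lemma zero_dimensional_V: "top_of_set V dim_le 0"
  unfolding dimension_le_0_neighbourhood_base_of_clopen neighbourhood_base_of
proof (intro allI impI)
  fix W x assume W: "openin (top_of_set V) W \<and> x \<in> W"
  then obtain O' where O': "open O'" "W = V \<inter> O'" by (auto simp: openin_open)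
  obtain f where f: "x = point f" "vertex f" using W O' V_cases by blast
  have "compact {x}" "{x} \<subseteq> O'" using W O' by auto
  then obtain C where C: "finite C" "\<And>g. (\<And>c. c \<in> C \<Longrightarrow> g c = f c) \<Longrightarrow> point g \<in> O'"
    using compact_determined_by_coordinates[OF _ O'(1), of "{x}"] f(1) by (metis singletonI)
  define U where "U = V \<inter> (\<Inter>c\<in>C. {y. coord c y = f c})"
  \<comment> \<open>Vertices have integer coordinates, so equality with \<open>f c\<close> and
    distance below 1 are the same condition. One description shows that \<open>U\<close> is closed,
    the other that it is open.\<close>
  have U: "U = V \<inter> (\<Inter>c\<in>C. {y. \<bar>coord c y - f c\<bar> < 1})"
  proof -
    have "coord c y = f c" if y: "y \<in> V" "\<bar>coord c y - f c\<bar> < 1" for c y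
    proof -
      obtain g where g: "y = point g" "vertex g" using y(1) V_cases by blast
      then have "g c \<in> \<int>" "f c \<in> \<int>" using vertex_Ints f by auto
      then have "g c - f c \<in> \<int>" by (rule Ints_diff)
      then show ?thesis using Ints_nonzero_abs_ge1[of "g c - f c"] y(2) g by force
    qed
    then show ?thesis unfolding U_def by fastforce
  qed
  have "open {y. \<bar>coord c y - f c\<bar> < 1}" for c
    by (rule open_Collect_less) (auto intro!: continuous_intros simp: continuous_on_coord)
  then have op: "openin (top_of_set V) U" unfolding U using C(1) by (intro openin_open_Int open_INT) auto
  have "closed {y. coord c y = f c}" for c
    by (rule closed_Collect_eq) (auto intro!: continuous_intros simp: continuous_on_coord)
  then have cl: "closedin (top_of_set V) U" unfolding U_def by (intro closedin_closed_Int closed_INT) auto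
  have "x \<in> U" using f by (auto simp: U_def point_in_V)
  moreover have "U \<subseteq> W"
  proof
    fix y assume y: "y \<in> U"
    then have "y \<in> V" by (simp add: U_def)
    then obtain g where "y = point g" using V_cases by metis
    then show "y \<in> W" using y C(2)[of g] O' by (auto simp: U_def)
  qed
  ultimately show "\<exists>U' V'. openin (top_of_set V) U' \<and> (closedin (top_of_set V) V' \<and> openin (top_of_set V) V') \<and> x \<in> U' \<and> U' \<subseteq> V' \<and> V' \<subseteq> W"
    using op cl by blast
qed

lemma X_minus_V: "X - V = (\<Union>e\<in>E. S e ` {0<..<1})"
proof
  show "X - V \<subseteq> (\<Union>e\<in>E. S e ` {0<..<1})"
  proof
    fix x assume x: "x \<in> X - V"
    then obtain e s where e: "e \<in> E" "0 \<le> s" "s \<le> 1" "x = S e s" by (auto simp: X_def)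
    then have "s \<noteq> 0 \<and> s \<noteq> 1" using x S_vertex_iff by blast
    then show "x \<in> (\<Union>e\<in>E. S e ` {0<..<1})" using e by force
  qed
  show "(\<Union>e\<in>E. S e ` {0<..<1}) \<subseteq> X - V"
    using S_vertex_iff by (fastforce simp: X_def)
qed

text \<open>The discrete factor has to be a set of points, so each edge is represented by its
  midpoint. Positivity of \<open>Bump e\<close> cuts out the inner points of \<open>e\<close>, which
  shows that they form an open set.\<close>

lemma homeomorphic_edges:
  "top_of_set (X - V) homeomorphic_space
     prod_topology (discrete_topology ((\<lambda>e. S e (1/2)) ` E)) (top_of_set {0<..<1::real})"
proof -
  let ?D = "discrete_topology ((\<lambda>e. S e (1/2)) ` E)"
  let ?I = "top_of_set {0<..<1::real}"
  define pick where "pick = (\<lambda>m. THE e. m = S e (1/2))"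
  have pick: "pick (S e (1/2)) = e" for e
    unfolding pick_def using S_inj[of e "1/2" _ "1/2"] by (intro the_equality) auto
  define edge where "edge = (\<lambda>x. THE e. coord (Bump e) x > 0)"
  have edge: "edge (S e s) = e" if "0 < s" "s < 1" for e s
    unfolding edge_def by (intro the_equality) (use that in \<open>auto simp: S_bump split: if_splits\<close>)
  define f where "f = (\<lambda>e x. (S e (1/2), coord (Skew e) x / coord (Bump e) x))"
  have fS: "f e (S e s) = (S e (1/2), s)" if "0 < s" "s < 1" for e s
    using that by (auto simp: f_def S_bump S_skew)
  have T: "{x \<in> X - V. coord (Bump e) x > 0} = S e ` {0<..<1}" if "e \<in> E" for e
  proof
    show "{x \<in> X - V. coord (Bump e) x > 0} \<subseteq> S e ` {0<..<1}"
      unfolding X_minus_V by (auto simp: S_bump split: if_splits)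
    show "S e ` {0<..<1} \<subseteq> {x \<in> X - V. coord (Bump e) x > 0}"
      unfolding X_minus_V using that by (auto simp: S_bump)
  qed
  have 1: "continuous_map (top_of_set (X - V)) (prod_topology ?D ?I) (\<lambda>x. f (edge x) x)"
  proof (rule pasting_lemma[where I = E and T = "\<lambda>e. S e ` {0<..<1}" and f = f])
    fix e assume e: "e \<in> E"
    have "open {x. coord (Bump e) x > 0}"
      by (rule open_Collect_less) (auto intro!: continuous_intros)
    moreover have "S e ` {0<..<1} = (X - V) \<inter> {x. coord (Bump e) x > 0}" using T[OF e] by auto
    ultimately show "openin (top_of_set (X - V)) (S e ` {0<..<1})" by (metis openin_open_Int)
    have sub: "S e ` {0<..<1} \<subseteq> X - V" using T[OF e] by auto
    have "continuous_on (S e ` {0<..<1}) (\<lambda>x. coord (Skew e) x / coord (Bump e) x)"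
      by (intro continuous_intros) (auto simp: S_bump)
    then have "continuous_map (top_of_set (S e ` {0<..<1})) ?I (\<lambda>x. coord (Skew e) x / coord (Bump e) x)"
      by (auto simp: continuous_map_in_subtopology S_bump S_skew)
    then show "continuous_map (subtopology (top_of_set (X - V)) (S e ` {0<..<1})) (prod_topology ?D ?I) (f e)"
      using e sub by (auto simp: f_def subtopology_subtopology Int_absorb1 intro!: continuous_map_pairedI)
  next
    fix i j x assume "i \<in> E" "j \<in> E" "x \<in> topspace (top_of_set (X - V)) \<inter> S i ` {0<..<1} \<inter> S j ` {0<..<1}"
    then show "f i x = f j x" using S_inj by (auto dest!: S_inj)
  next
    fix x assume "x \<in> topspace (top_of_set (X - V))"
    then show "\<exists>j. j \<in> E \<and> x \<in> S j ` {0<..<1} \<and> f (edge x) x = f j x"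
      unfolding X_minus_V using edge by auto
  qed
  have 2: "continuous_map (prod_topology ?D ?I) (top_of_set (X - V)) (\<lambda>p. S (pick (fst p)) (snd p))"
  proof (rule pasting_lemma[where I = E and T = "\<lambda>e. {S e (1/2)} \<times> {0<..<1}" and f = "\<lambda>e p. S e (snd p)"])
    fix e assume e: "e \<in> E"
    show "openin (prod_topology ?D ?I) ({S e (1/2)} \<times> {0<..<1})"
      using e by (auto simp: openin_prod_Times_iff)
    have "continuous_map ?I (top_of_set (X - V)) (S e)"
      using e continuous_on_S by (auto simp: continuous_map_in_subtopology X_minus_V)
    then have "continuous_map (prod_topology ?D ?I) (top_of_set (X - V)) (\<lambda>p. S e (snd p))"
      using continuous_map_compose[OF continuous_map_snd, of ?I _ "S e" ?D] by (simp add: o_def)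
    then show "continuous_map (subtopology (prod_topology ?D ?I) ({S e (1/2)} \<times> {0<..<1})) (top_of_set (X - V)) (\<lambda>p. S e (snd p))"
      by (rule continuous_map_from_subtopology)
  next
    fix i j x assume "x \<in> topspace (prod_topology ?D ?I) \<inter> {S i (1/2)} \<times> {0<..<1} \<inter> {S j (1/2)} \<times> {0<..<1}"
    then have "S i (1/2) = S j (1/2)" by auto
    then have "i = j" using S_inj[of i "1/2" j "1/2"] by simp
    then show "S i (snd x) = S j (snd x)" by simp
  next
    fix x assume "x \<in> topspace (prod_topology ?D ?I)"
    then show "\<exists>j. j \<in> E \<and> x \<in> {S j (1/2)} \<times> {0<..<1} \<and> S (pick (fst x)) (snd x) = S j (snd x)"
      using pick by (cases x) auto
  qed
  have "homeomorphic_maps (top_of_set (X - V)) (prod_topology ?D ?I) (\<lambda>x. f (edge x) x) (\<lambda>p. S (pick (fst p)) (snd p))"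
    unfolding homeomorphic_maps_def
  proof (intro conjI 1 2 ballI)
    fix x assume "x \<in> topspace (top_of_set (X - V))"
    then obtain e s where "e \<in> E" "0 < s" "s < 1" "x = S e s" unfolding X_minus_V by auto
    then show "S (pick (fst (f (edge x) x))) (snd (f (edge x) x)) = x" by (simp add: edge fS pick)
  next
    fix y assume "y \<in> topspace (prod_topology ?D ?I)"
    then obtain e s where "e \<in> E" "0 < s" "s < 1" "y = (S e (1/2), s)" by (cases y) auto
    then show "f (edge (S (pick (fst y)) (snd y))) (S (pick (fst y)) (snd y)) = y" by (simp add: edge fS pick)
  qed
  then show ?thesis by (rule homeomorphic_maps_imp_homeomorphic_space)
qed

lemma graph_like_if_connected:
  assumes "connected X"
  shows "graph_like_continuum T"
proof -
  have "metrizable_space T"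
    by (metis metrizable_space_euclidean metrizable_space_subtopology)
  moreover have "compact_space T" using compact_X by (simp add: compact_space_subtopology)
  moreover have "closedin T V"
    using compact_imp_closed[OF compact_V] V_subset_X by (metis closed_subset)
  moreover have "X \<noteq> {}" by (auto simp: X_def V_def)
  moreover have "subtopology T V = top_of_set V" "subtopology T (X - V) = top_of_set (X - V)"
    using V_subset_X by (auto simp: subtopology_subtopology Int_absorb1)
  moreover have "continuum T"
    unfolding continuum_def using calculation assms by (simp add: connected_space_subtopology)
  ultimately show ?thesis
    unfolding graph_like_continuum_def
    using zero_dimensional_V homeomorphic_edges
    by (intro conjI exI[of _ V] exI[of _ "(\<lambda>e. S e (1/2)) ` E"]) simp_all
qed

end


section \<open>Arcs and simple closed curves in necklaces\<close>

context necklace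
begin

definition bead :: "nat \<Rightarrow> (nat \<Rightarrow> real) set" where
  "bead k = P k ` {0..1} \<union> (\<Union>u. S (Chord k u) ` {0..1}) \<union> S (Roof k) ` {0..1}"

lemma S_meets:
  assumes "S e s = S e' s'" "e \<noteq> e'" "0 \<le> s" "s \<le> 1" "0 \<le> s'" "s' \<le> 1"
  shows "s = 0 \<or> s = 1" "s' = 0 \<or> s' = 1"
  using S_inj[of e s e' s'] S_inj[of e' s' e s] assms by force+

lemma bead_cases:
  assumes "x \<in> bead k"
  obtains t where "0 \<le> t" "t \<le> 1" "x = P k t"
  | e s where "0 < s" "s < 1" "x = S e s" "e = Roof k \<or> (\<exists>u. e = Chord k u)"
proof -
  consider t where "0 \<le> t" "t \<le> 1" "x = P k t" | e s where "0 \<le> s" "s \<le> 1" "x = S e s" "e = Roof k \<or> (\<exists>u. e = Chord k u)"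
    using assms unfolding bead_def by auto
  then show thesis
  proof cases
    case (2 e s)
    show thesis
    proof (cases "s = 0 \<or> s = 1")
      case True
      have "x \<in> P k ` {0..1}"
        using 2 True pos_bounds[of "1/12"] pos_bounds[of "11/12"] by (auto simp: S_0 S_1 simp flip: P_def intro!: imageI)
      then show thesis using that(1) by auto
    next
      case False
      then show thesis using 2 that(2)[of s e] by auto
    qed
  qed (use that in blast)
qed

lemma Q_notin_bead: "Q \<notin> bead k"
proof
  assume "Q \<in> bead k"
  then show False
  proof (cases rule: bead_cases)
    case (1 t)
    then show False using P_ne_Q by metis
  next
    case (2 e s)
    have "S e s \<in> V" using 2(3) by (metis V_def insertI1)
    then show False using 2 S_vertex_iff[of s e] by auto
  qed
qed

lemma base_in_bead: "P j t \<in> bead k \<Longrightarrow> 0 \<le> t \<Longrightarrow> t \<le> 1 \<Longrightarrow> \<exists>s. 0 \<le> s \<and> s \<le> 1 \<and> P j t = P k s"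
proof (erule bead_cases)
  fix e s assume "0 < s" "s < 1" "P j t = S e s" "e = Roof k \<or> (\<exists>u. e = Chord k u)" "0 \<le> t" "t \<le> 1"
  then show ?thesis using P_on_edge[of j t e s] by auto
qed auto

lemma beads_meet:
  assumes "k \<noteq> j" "x \<in> bead k" "x \<in> bead j"
  shows "x = P k hub \<and> x = P j hub \<and> grp k = grp j"
  using assms(2)
proof (cases rule: bead_cases)
  case (1 t)
  then obtain s where "0 \<le> s" "s \<le> 1" "P k t = P j s" using base_in_bead assms(3) by blast
  then show ?thesis using P_eqD[of k t j s] 1 assms(1) by auto
next
  case (2 e s)
  note * = 2
  from assms(3) show ?thesis
  proof (cases rule: bead_cases)
    case (1 t)
    then have "P j t = S e s" using 2 by simp
    then show ?thesis using P_on_edge[of j t e s] 1 2 by auto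
  next
    case (2 e' s')
    then show ?thesis using S_inj[of e s e' s'] * assms(1) by auto
  qed
qed

lemma Link_meets_bead:
  assumes "0 \<le> s" "s \<le> 1" "S (Link k) s \<in> bead j"
  shows "s = 0 \<and> j = k \<or> s = 1 \<and> j = Suc k"
proof -
  have s: "s = 0 \<or> s = 1" using assms(3)
  proof (cases rule: bead_cases)
    case (1 t)
    then show ?thesis using P_on_edge[of j t "Link k" s] assms by auto
  next
    case (2 e r)
    then show ?thesis using S_meets(1)[of "Link k" s e r] assms by auto
  qed
  define i where "i = (if s = 0 then k else Suc k)"
  define t where "t = (if s = 0 then 1 else 0 :: real)"
  have e: "S (Link k) s = P i t" using s by (auto simp: i_def t_def S_0 S_1 P_def)
  have "P i t \<in> bead j" "0 \<le> t" "t \<le> 1" using assms(3) e by (auto simp: t_def)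
  from base_in_bead[OF this] obtain r where "0 \<le> r" "r \<le> 1" "P i t = P j r" by blast
  then have "i = j" using P_eqD[of i t j r] by (auto simp: t_def hub_def split: if_splits)
  then show ?thesis using s by (auto simp: i_def)
qed

lemma Links_disjoint:
  assumes "k \<noteq> j"
  shows "S (Link k) ` {0..1} \<inter> S (Link j) ` {0..1} = {}"
proof -
  have False if s: "s \<in> {0..1}" "r \<in> {0..1}" "S (Link k) s = S (Link j) r" for s r
  proof -
    have "(s = 0 \<or> s = 1) \<and> (r = 0 \<or> r = 1)" using S_meets[OF s(3)] s assms by auto
    moreover have "P k 1 \<noteq> P j 1" "P (Suc k) 0 \<noteq> P (Suc j) 0" "P k 1 \<noteq> P (Suc j) 0" "P (Suc k) 0 \<noteq> P j 1"
      using P_eqD[of k 1 j 1] P_eqD[of "Suc k" 0 "Suc j" 0] P_eqD[of k 1 "Suc j" 0] P_eqD[of "Suc k" 0 j 1] assms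
      by (auto simp: hub_def)
    ultimately show False using s(3) by (auto simp: S_0 S_1 P_def)
  qed
  then show ?thesis by blast
qed

lemma Q_notin_Link: "0 \<le> s \<Longrightarrow> s \<le> 1 \<Longrightarrow> S (Link k) s \<noteq> Q"
proof
  assume s: "0 \<le> s" "s \<le> 1" "S (Link k) s = Q"
  then have "s = 0 \<or> s = 1" using S_vertex_iff[of s "Link k"] by (simp add: V_def)
  then show False using s(3) base_ne_lim by (auto simp: S_0 S_1 Q_def)
qed

lemma bead_subset_X: "bead k \<subseteq> X"
proof
  fix x assume "x \<in> bead k"
  then show "x \<in> X"
  proof (cases rule: bead_cases)
    case (1 t)
    then show ?thesis using P_in_X by simp
  next
    case (2 e s)
    then have "e \<in> E" by (auto simp: E_def)
    then show ?thesis using 2 by (force simp: X_def)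
  qed
qed

text \<open>Pairing \<open>a\<close> gives disjoint arcs from 0 to 1/4 and from 1 to 3/4; the roof
  joins them into one arc from end to end. The hub is put into the set to be avoided unless it is
  prescribed.\<close>

lemma bead_arc:
  assumes "finite F" "F \<subseteq> bead k"
  obtains A where "arc_from A (P k 0) (P k 1)" "A \<subseteq> bead k" "F \<subseteq> A" "P k hub \<in> A \<Longrightarrow> P k hub \<in> F"
proof -
  interpret b: blob "P k" "\<lambda>u. S (Chord k u) ` {0..1}" by (rule blob_P)
  let ?R = "S (Roof k) ` {0..1}"
  have B: "b.B [] = P k ` {0..1} \<union> (\<Union>u. S (Chord k u) ` {0..1})" by (simp add: b.B_def)
  define Z where "Z = (if P k hub \<in> F then {} else {P k hub})"
  have "b.link_a [] (F \<inter> b.B []) Z"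
    by (rule b.link_exists) (use assms in \<open>auto simp: Z_def\<close>)
  then obtain A A' where A: "arc_from A (P k 0) (P k (1/4))" "arc_from A' (P k 1) (P k (3/4))"
      "A \<inter> A' = {}" "A \<union> A' \<subseteq> b.B []" "F \<inter> b.B [] \<subseteq> A \<union> A'" "(A \<union> A') \<inter> Z = {}"
    unfolding b.link_def by auto
  have roof: "arc_from ?R (P k (1/4)) (P k (3/4))" using S_arc[of "Roof k"] by (simp add: P_def)
  have roof_end: "x = P k (1/4) \<or> x = P k (3/4)" if x: "x \<in> ?R" "x \<in> b.B [] \<or> x = P k hub" for x
  proof -
    obtain s where s: "0 \<le> s" "s \<le> 1" "x = S (Roof k) s" using x(1) by auto
    have "P k hub \<in> P k ` {0..1}" by (auto simp: hub_def)
    then have "x \<in> P k ` {0..1} \<union> (\<Union>u. S (Chord k u) ` {0..1})" using x(2) unfolding B by blast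
    then have "s = 0 \<or> s = 1"
    proof (elim UnE UN_E imageE)
      fix t assume "t \<in> {0..1}" "x = P k t"
      then show ?thesis using P_on_edge[of k t "Roof k" s] s by simp
    next
      fix u r assume "r \<in> {0..1}" "x = S (Chord k u) r"
      then show ?thesis using S_meets(1)[of "Roof k" s "Chord k u" r] s by simp
    qed
    then show ?thesis using s(3) by (auto simp: S_0 S_1 P_def)
  qed
  have na: "P k (3/4) \<notin> A" "P k (1/4) \<notin> A'"
    using A(3) arc_from_ends[OF A(1)] arc_from_ends[OF A(2)] by auto
  have roofA: "A \<inter> ?R \<subseteq> {P k (1/4)}"
  proof
    fix x assume x: "x \<in> A \<inter> ?R"
    then have "x \<in> ?R" "x \<in> b.B []" using A(4) by blast+
    then have "x = P k (1/4) \<or> x = P k (3/4)" using roof_end by blast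
    then show "x \<in> {P k (1/4)}" using x na by blast
  qed
  have roofA': "?R \<inter> A' \<subseteq> {P k (3/4)}"
  proof
    fix x assume x: "x \<in> ?R \<inter> A'"
    then have "x \<in> ?R" "x \<in> b.B []" using A(4) by blast+
    then have "x = P k (1/4) \<or> x = P k (3/4)" using roof_end by blast
    then show "x \<in> {P k (3/4)}" using x na by blast
  qed
  have arc: "arc_from (A \<union> ?R \<union> A') (P k 0) (P k 1)"
    by (rule b.arc_from_join3[OF A(1) roof arc_from_sym[OF A(2)] roofA roofA' A(3)])
  show thesis
  proof (rule that[OF arc])
    have bead: "bead k = b.B [] \<union> ?R" by (simp add: B bead_def)
    show "A \<union> ?R \<union> A' \<subseteq> bead k" using A(4) unfolding bead by auto
    show "F \<subseteq> A \<union> ?R \<union> A'"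
    proof
      fix x assume "x \<in> F"
      then show "x \<in> A \<union> ?R \<union> A'" using A(5) assms(2) unfolding bead by (cases "x \<in> b.B []") auto
    qed
    assume h: "P k hub \<in> A \<union> ?R \<union> A'"
    have "P k hub \<noteq> P k (1/4)" "P k hub \<noteq> P k (3/4)"
      using P_eqD[of k hub k "1/4"] P_eqD[of k hub k "3/4"] by (auto simp: hub_def)
    then have "P k hub \<notin> ?R" using roof_end by blast
    then show "P k hub \<in> F" using h A(6) by (auto simp: Z_def split: if_splits)
  qed
qed

lemma P_hub_eq_iff: "P k hub = P j hub \<longleftrightarrow> grp k = grp j"
proof
  assume "grp k = grp j"
  then have "bead_at grp k hub c = bead_at grp j hub c" for c
    using vertex_bump[of "bead_at grp k hub"] vertex_bump[of "bead_at grp j hub"] by (cases c) simp_all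
  then show "P k hub = P j hub" by (auto simp: P_def)
next
  assume "P k hub = P j hub"
  then show "grp k = grp j" using P_eqD[of k hub j hub] by (auto simp: hub_def)
qed

lemma X_cases:
  assumes "x \<in> X"
  obtains "x = Q" | k where "x \<in> bead k" | k s where "0 \<le> s" "s \<le> 1" "x = S (Link k) s"
  | s where "cl" "0 < s" "s < 1" "x = S Close s"
proof (cases "x \<in> V")
  case True
  then consider "x = Q" | k t where "t \<in> cantor" "x = P k t" by (auto simp: V_def)
  then show thesis
  proof cases
    case (2 k t)
    then have "x \<in> bead k" using cantor_bounds by (auto simp: bead_def)
    then show thesis using that by blast
  qed (use that in blast)
next
  case False
  then have "x \<in> X - V" using assms by simp
  then obtain e s where e: "e \<in> E" "0 < s" "s < 1" "x = S e s" unfolding X_minus_V by auto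
  show thesis
  proof (cases e)
    case (Gap k u)
    have "0 \<le> pos u ((1 + s) / 3) \<and> pos u ((1 + s) / 3) \<le> 1" using e by (intro pos_bounds) auto
    moreover have "x = P k (pos u ((1 + s) / 3))" using P_gap[of s k u] e Gap by simp
    ultimately have "x \<in> P k ` {0..1}" by simp
    then have "x \<in> bead k" by (simp add: bead_def)
    then show thesis using that by blast
  next
    case (Chord k u)
    then have "x \<in> S (Chord k u) ` {0..1}" using e by auto
    then have "x \<in> bead k" unfolding bead_def by blast
    then show thesis using that by blast
  next
    case (Roof k)
    then have "x \<in> bead k" using e by (auto simp: bead_def)
    then show thesis using that by blast
  next
    case (Link k)
    then show thesis using that(3)[of s k] e by auto
  next
    case Close
    then show thesis using that(4)[of s] e by (auto simp: E_def)
  qed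
qed

text \<open>Everything except the interior of the closing edge.\<close>

definition spine :: "(nat \<Rightarrow> real) set" where
  "spine = insert Q (\<Union>k. bead k \<union> S (Link k) ` {0..1})"

lemma spine_subset_X: "spine \<subseteq> X"
proof -
  have "S (Link k) ` {0..1} \<subseteq> X" for k by (auto simp: X_def E_def)
  then show ?thesis using bead_subset_X V_subset_X unfolding spine_def V_def by blast
qed

lemma X_subset: "X \<subseteq> spine \<union> (if cl then S Close ` {0<..<1} else {})"
proof
  fix x assume "x \<in> X"
  then show "x \<in> spine \<union> (if cl then S Close ` {0<..<1} else {})"
  proof (cases rule: X_cases)
    case (3 k s)
    then have "x \<in> S (Link k) ` {0..1}" by simp
    then show ?thesis unfolding spine_def by blast
  qed (auto simp: spine_def)
qed

lemma spine_arc: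
  assumes F: "finite F" "F \<subseteq> spine"
  obtains A where "arc_from A (P 0 0) Q" "F \<subseteq> A" "A \<subseteq> spine"
proof -
  \<comment> \<open>Only the first bead of a group may pass through the common hub of the group.\<close>
  define first where "first = (\<lambda>k. \<forall>j<k. grp j \<noteq> grp k)"
  define G where "G = (\<lambda>k. (F \<inter> bead k) - (if first k then {} else {P k hub}))"
  have "\<exists>A. arc_from A (P k 0) (P k 1) \<and> A \<subseteq> bead k \<and> G k \<subseteq> A \<and> (P k hub \<in> A \<longrightarrow> P k hub \<in> G k)" for k
  proof -
    have "finite (G k)" "G k \<subseteq> bead k" using F by (auto simp: G_def)
    then show ?thesis using bead_arc by metis
  qed
  then obtain A where A: "\<And>k. arc_from (A k) (P k 0) (P k 1)" "\<And>k. A k \<subseteq> bead k" "\<And>k. G k \<subseteq> A k"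
      "\<And>k. P k hub \<in> A k \<Longrightarrow> P k hub \<in> G k" by metis
  let ?L = "\<lambda>k. S (Link k) ` {0..1}"
  define C where "C = (\<lambda>k. A k \<union> ?L k)"
  have L: "arc_from (?L k) (P k 1) (P (Suc k) 0)" for k using S_arc[of "Link k"] by (simp add: P_def)
  have L0: "S (Link k) 0 = P k 1" "S (Link k) 1 = P (Suc k) 0" for k by (auto simp: S_0 S_1 P_def)
  have AA: "A k \<inter> A j = {}" if "k \<noteq> j" for k j
  proof -
    have False if x: "x \<in> A k" "x \<in> A j" for x
    proof -
      have h: "x = P k hub" "x = P j hub" "grp k = grp j"
        using beads_meet[OF \<open>k \<noteq> j\<close>, of x] x A(2) by blast+
      then have "first k" "first j" using A(4) x by (metis G_def DiffD2 insertI1)+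
      then show False using h(3) \<open>k \<noteq> j\<close> unfolding first_def by (metis nat_neq_iff)
    qed
    then show ?thesis by blast
  qed
  have LA: "?L k \<inter> A j \<subseteq> (if j = k then {P k 1} else if j = Suc k then {P j 0} else {})" for k j
    using Link_meets_bead[of _ k j] A(2)[of j] L0 by fastforce
  have "arc_from (insert Q (\<Union>k. C k)) (P 0 0) Q"
  proof (rule arc_from_infinite_join[where p = "\<lambda>k. P k 0"])
    show "arc_from (C k) (P k 0) (P (Suc k) 0)" for k
      unfolding C_def by (rule arc_from_join[OF A(1) L]) (use LA[of k k] in auto)
    show "C k \<inter> C (Suc k) \<subseteq> {P (Suc k) 0}" for k
      using AA[of k "Suc k"] LA[of k "Suc k"] LA[of "Suc k" k] Links_disjoint[of k "Suc k"] unfolding C_def by auto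
    show "C j \<inter> C k = {}" if "Suc j < k" for j k
      using AA[of j k] LA[of j k] LA[of k j] Links_disjoint[of j k] that unfolding C_def by auto
    show "Q \<notin> C k" for k
      using A(2)[of k] Q_notin_bead[of k] Q_notin_Link[of _ k] unfolding C_def by fastforce
    show "\<exists>N. \<forall>k\<ge>N. C k \<subseteq> U" if U: "open U" "Q \<in> U" for U
    proof -
      obtain N where N: "\<And>k t. N \<le> k \<Longrightarrow> P k t \<in> U" "\<And>e s. e \<noteq> Close \<Longrightarrow> N \<le> edge_index e \<Longrightarrow> S e s \<in> U"
        using beads_converge[OF U] by metis
      have "C k \<subseteq> U" if "N \<le> k" for k
      proof -
        have "bead k \<subseteq> U" "?L k \<subseteq> U" using N that by (auto simp: bead_def)
        then show ?thesis using A(2)[of k] unfolding C_def by blast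
      qed
      then show ?thesis by blast
    qed
  qed
  moreover have "F \<subseteq> insert Q (\<Union>k. C k)"
  proof
    fix x assume x: "x \<in> F"
    then have "x \<in> spine" using F by blast
    then consider "x = Q" | k where "x \<in> ?L k" | k where "x \<in> bead k" unfolding spine_def by blast
    then show "x \<in> insert Q (\<Union>k. C k)"
    proof cases
      case (3 k)
      show ?thesis
      proof (cases "x = P k hub")
        case True
        \<comment> \<open>A prescribed hub is picked up in the first bead of its group, whatever
          bead it was given in.\<close>
        define j where "j = (LEAST j. grp j = grp k)"
        have j: "grp j = grp k" unfolding j_def by (rule LeastI) simp
        have "first j" unfolding first_def j using not_less_Least unfolding j_def by blast
        moreover have "x = P j hub" using True j P_hub_eq_iff by simp
        moreover have "P j hub \<in> bead j" by (auto simp: bead_def hub_def)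
        ultimately have "x \<in> G j" using x by (simp add: G_def)
        then show ?thesis using A(3)[of j] by (auto simp: C_def)
      next
        case False
        then have "x \<in> G k" using x 3 by (simp add: G_def)
        then show ?thesis using A(3)[of k] by (auto simp: C_def)
      qed
    qed (auto simp: C_def)
  qed
  moreover have "insert Q (\<Union>k. C k) \<subseteq> spine" using A(2) unfolding spine_def C_def by blast
  ultimately show thesis using that by blast
qed

lemma Close_arc: "arc_from (S Close ` {0..1}) Q (P 0 0)"
  using S_arc[of Close] by (simp add: P_def Q_def)

lemma Close_meets_spine: "S Close ` {0..1} \<inter> spine \<subseteq> {P 0 0, Q}"
proof -
  have "s = 0 \<or> s = 1" if s: "0 \<le> s" "s \<le> 1" "S Close s \<in> spine" for s
  proof -
    consider "S Close s = Q" | k where "S Close s \<in> bead k" | k r where "0 \<le> r" "r \<le> 1" "S Close s = S (Link k) r"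
      using s(3) by (auto simp: spine_def)
    then show ?thesis
    proof cases
      case 1
      then show ?thesis using S_vertex_iff[of s Close] s by (simp add: V_def)
    next
      case (2 k)
      then show ?thesis
      proof (cases rule: bead_cases)
        case (1 t)
        then show ?thesis using P_on_edge[of k t Close s] s by auto
      next
        case (2 e r)
        then show ?thesis using S_meets(1)[of Close s e r] s by auto
      qed
    next
      case (3 k r)
      then show ?thesis using S_meets(1)[of Close s "Link k" r] s by auto
    qed
  qed
  note ends = this
  show ?thesis
  proof
    fix x assume "x \<in> S Close ` {0..1} \<inter> spine"
    then obtain s where s: "0 \<le> s" "s \<le> 1" "S Close s \<in> spine" "x = S Close s" by auto
    from ends[OF s(1-3)] show "x \<in> {P 0 0, Q}" by (auto simp: s(4) S_0 S_1 P_def Q_def)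
  qed
qed

lemma Close_in_E: "cl \<Longrightarrow> Close \<in> E"
  unfolding E_def by simp

lemma S_subset_X: "e \<in> E \<Longrightarrow> S e ` {0..1} \<subseteq> X"
  unfolding X_def by blast

text \<open>Every point is joined to \<open>Q\<close> by an arc in the spine or by the closing
  edge.\<close>

lemma connected_X: "connected X"
proof -
  have "\<exists>T. connected T \<and> Q \<in> T \<and> x \<in> T \<and> T \<subseteq> X" if x: "x \<in> X" for x
  proof (cases "x \<in> spine")
    case True
    then obtain A where A: "arc_from A (P 0 0) Q" "{x} \<subseteq> A" "A \<subseteq> spine" using spine_arc[of "{x}"] by auto
    then show ?thesis using spine_subset_X arc_from_connected[OF A(1)] arc_from_ends[OF A(1)] by (intro exI[of _ A]) auto
  next
    case False
    then have "cl" "x \<in> S Close ` {0..1}" using X_subset x by (auto split: if_splits)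
    moreover have "S Close ` {0..1} \<subseteq> X" using calculation by (intro S_subset_X Close_in_E)
    ultimately show ?thesis using arc_from_connected[OF Close_arc] arc_from_ends[OF Close_arc]
      by (intro exI[of _ "S Close ` {0..1}"]) simp
  qed
  then have "X \<subseteq> \<Union>{T. connected T \<and> Q \<in> T \<and> T \<subseteq> X}" by (intro subsetI) (metis (mono_tags, lifting) UnionI mem_Collect_eq)
  then have "X = \<Union>{T. connected T \<and> Q \<in> T \<and> T \<subseteq> X}" by auto
  moreover have "connected (\<Union>{T. connected T \<and> Q \<in> T \<and> T \<subseteq> X})" by (rule connected_Union) auto
  ultimately show ?thesis by simp
qed

lemma graph_like_X: "graph_like_continuum T"
  by (rule graph_like_if_connected[OF connected_X])

lemma omega_ac_X:
  assumes "\<not> cl"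
  shows "omega_ac T"
  unfolding omega_ac_def n_ac_def
proof (intro allI impI)
  fix n F assume F: "F \<subseteq> topspace T \<and> finite F \<and> card F \<le> n"
  then have "F \<subseteq> spine" using X_subset assms by auto
  then obtain A where A: "arc_from A (P 0 0) Q" "F \<subseteq> A" "A \<subseteq> spine" using spine_arc F by metis
  then have "arc_in T A" using spine_subset_X by (intro arc_in_arc_from) auto
  then show "\<exists>A. arc_in T A \<and> F \<subseteq> A" using A by blast
qed

lemma omega_cc_X:
  assumes "cl"
  shows "omega_cc T"
  unfolding omega_cc_def n_cc_def
proof (intro allI impI)
  fix n F assume F: "F \<subseteq> topspace T \<and> finite F \<and> card F \<le> n"
  let ?K = "S Close ` {0..1}"
  obtain A where A: "arc_from A (P 0 0) Q" "F \<inter> spine \<subseteq> A" "A \<subseteq> spine" using spine_arc[of "F \<inter> spine"] F by auto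
  have "?K \<subseteq> X" using assms by (intro S_subset_X Close_in_E)
  then have "simple_closed_curve_in T (A \<union> ?K)"
    using A Close_meets_spine spine_subset_X
    by (intro simple_closed_curve_in_arcs[OF A(1) arc_from_sym[OF Close_arc]]) auto
  moreover have "F \<subseteq> A \<union> ?K"
  proof
    fix x assume "x \<in> F"
    then show "x \<in> A \<union> ?K" using A(2) X_subset F assms by fastforce
  qed
  ultimately show "\<exists>C. simple_closed_curve_in T C \<and> F \<subseteq> C" by blast
qed

end

section \<open>Links between different groups as bridges\<close>

lemma circle_properties:
  assumes "top_of_set C homeomorphic_space top_of_set (sphere (0::complex) 1)"
  shows "connected C" "connected (C - {p})" "C \<noteq> {p}"
proof -
  obtain f g where fg: "continuous_map (top_of_set C) (top_of_set (sphere (0::complex) 1)) f"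
      "continuous_map (top_of_set (sphere (0::complex) 1)) (top_of_set C) g"
      "\<forall>x\<in>C. g (f x) = x" "\<forall>y\<in>sphere 0 1. f (g y) = y"
    using assms unfolding homeomorphic_space_def homeomorphic_maps_def by auto
  have g: "continuous_on (sphere 0 1) g" "g ` sphere 0 1 \<subseteq> C" and f: "f ` C \<subseteq> sphere 0 1"
    using fg(1,2) by (auto simp: continuous_map_in_subtopology)
  have C: "C = g ` sphere 0 1" using g f fg(3) by force
  show "connected C" unfolding C by (rule connected_continuous_image[OF g(1)]) (simp add: connected_sphere)
  show "C \<noteq> {p}"
  proof
    assume "C = {p}"
    then have "g 1 = p" "g (-1) = p" using g(2) by (auto simp: image_subset_iff)
    then have "g 1 = g (-1)" by simp
    moreover have "f (g 1) = 1" "f (g (-1)) = -1" using fg(4) by simp_all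
    ultimately show False by simp
  qed
  show "connected (C - {p})"
  proof (cases "p \<in> C")
    case True
    have "C - {p} = g ` (sphere 0 1 - {f p})"
    proof
      show "C - {p} \<subseteq> g ` (sphere 0 1 - {f p})"
      proof
        fix x assume x: "x \<in> C - {p}"
        then have "f x \<noteq> f p" using fg(3) True by (metis DiffD1 DiffD2 singletonI)
        moreover have "f x \<in> sphere 0 1" "x = g (f x)" using x f fg(3) by auto
        ultimately show "x \<in> g ` (sphere 0 1 - {f p})" by blast
      qed
      show "g ` (sphere 0 1 - {f p}) \<subseteq> C - {p}"
      proof (rule image_subsetI)
        fix y assume y: "y \<in> sphere 0 1 - {f p}"
        then have "f (g y) = y" using fg(4) by blast
        then have "g y \<noteq> p" using y by auto
        then show "g y \<in> C - {p}" using y g(2) by blast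
      qed
    qed
    moreover have "connected (sphere 0 1 - {f p})"
    proof -
      have "f p \<in> sphere 0 1" using f True by auto
      then have "sphere 0 1 - {f p} homeomorphic {z::complex. 1 \<bullet> z = 0}"
        by (intro homeomorphic_punctured_sphere_hyperplane) auto
      moreover have "connected {z::complex. 1 \<bullet> z = 0}"
        by (intro convex_connected convex_hyperplane)
      ultimately show ?thesis using homeomorphic_connectedness by blast
    qed
    ultimately show ?thesis
      using connected_continuous_image[OF continuous_on_subset[OF g(1)]] by (metis Diff_subset)
  next
    case False
    then show ?thesis using \<open>connected C\<close> by simp
  qed
qed

lemma connected_crosses_level:
  fixes f :: "'a::topological_space \<Rightarrow> real"
  assumes "connected C" "continuous_on C f" "a \<in> C" "b \<in> C" "f a < c" "c < f b"
  shows "\<exists>p\<in>C. f p = c"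
proof -
  have "{f a..f b} \<subseteq> f ` C"
    using connected_contains_Icc[OF connected_continuous_image[OF assms(2,1)]] assms by blast
  moreover have "c \<in> {f a..f b}" using assms by simp
  ultimately show ?thesis by (metis imageE subsetD)
qed

context necklace
begin

text \<open>A single point already fails: the midpoint of a link between two groups lies on no
  simple closed curve. The \<open>Tail\<close> coordinate of the next group is the parameter along
  this link, and each value strictly between 0 and 1 is attained at one point only; removing a point
  cannot disconnect a circle.\<close>

lemma not_2cc_X:
  assumes "\<not> cl" "grp k < grp (Suc k)"
  shows "\<not> n_cc 2 T"
proof
  assume cc: "n_cc 2 T"
  define f where "f = coord (Tail (grp (Suc k)))"
  have f: "continuous_on A f" for A unfolding f_def by (rule continuous_on_subset[OF _ subset_UNIV]) (simp add: continuous_on_coord[of _ "\<lambda>x. x"])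
  have fk: "f (S (Link k) s) = s" for s using assms(2) by (simp add: f_def S_def)
  \<comment> \<open>A non-integral \<open>Tail\<close> coordinate can occur only inside an edge
    along which it changes. Without the closing edge this is just the link into the next
    group.\<close>
  have level: "x = S (Link k) c" if x: "x \<in> X" "f x = c" "0 < c" "c < 1" for x c
  proof -
    have "x \<notin> V"
    proof
      assume "x \<in> V"
      then obtain g where g: "x = point g" "vertex g" by (rule V_cases)
      then have "g (Tail (grp (Suc k))) \<in> \<int>" using vertex_Ints by blast
      then have "f x \<in> \<int>" using g by (simp add: f_def)
      then show False using x by (auto elim!: Ints_cases)
    qed
    then have "x \<in> X - V" using x by simp
    then obtain e s where e: "e \<in> E" "x = S e s" unfolding X_minus_V by auto
    have ne: "src grp e (Tail (grp (Suc k))) \<noteq> dst grp e (Tail (grp (Suc k)))"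
    proof
      assume eq: "src grp e (Tail (grp (Suc k))) = dst grp e (Tail (grp (Suc k)))"
      have "f x = dst grp e (Tail (grp (Suc k)))" using e eq by (simp add: f_def S_def algebra_simps)
      then have "f x \<in> \<int>" using vertex_Ints[OF vertex_dst] by simp
      then show False using x by (auto elim!: Ints_cases)
    qed
    have "e \<noteq> Close" using e(1) assms(1) unfolding E_def by blast
    then obtain j where j: "e = Link j" "grp j < grp (Suc k) \<and> grp (Suc k) \<le> grp (Suc j)"
      using crossing_Tail[OF ne] by blast
    have "grp k < grp (Suc k) \<and> grp (Suc k) \<le> grp (Suc k)" using assms(2) by simp
    from group_jump_unique[OF j(2) this] have "e = Link k" using j(1) by simp
    then show ?thesis using e x fk by metis
  qed
  have "Link k \<in> E" by (simp add: E_def)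
  then have p: "S (Link k) (1/2) \<in> X" by (auto simp: X_def intro!: image_eqI[of _ _ "1/2"])
  define p where "p = S (Link k) (1/2)"
  obtain C where C: "simple_closed_curve_in T C" "p \<in> C"
    using cc p unfolding n_cc_def p_def by (auto dest!: spec[of _ "{S (Link k) (1/2)}"])
  then have CX: "C \<subseteq> X" and hom: "top_of_set C homeomorphic_space top_of_set (sphere (0::complex) 1)"
    by (auto simp: simple_closed_curve_in_def subtopology_subtopology Int_absorb1)
  note circ = circle_properties[OF hom]
  \<comment> \<open>Without its only point at level \<open>c\<close> the curve is still connected
    and has points on both sides, so it would have to cross the level once more.\<close>
  have no: False if ab: "a \<in> C" "b \<in> C" "f a < c" "c < f b" "0 < c" "c < 1" for a b c
  proof -
    have "\<exists>q\<in>C - {S (Link k) c}. f q = c"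
      by (rule connected_crosses_level[OF circ(2) f, of a _ b]) (use ab fk in auto)
    then show False using level[of _ c] CX ab by blast
  qed
  have fp: "f p = 1/2" using fk by (simp add: p_def)
  obtain q where q: "q \<in> C" "q \<noteq> p" using circ(3)[of p] C(2) by blast
  have "f q \<noteq> 1/2" using level[of q "1/2"] q CX by (auto simp: p_def)
  then consider "f q < 1/2" | "f q > 1/2" by linarith
  then show False
  proof cases
    case 1
    then have "max 0 (f q) < 1/2" by simp
    from dense[OF this] obtain c where "max 0 (f q) < c" "c < 1/2" by blast
    then show False using no[of q p c] q C fp by auto
  next
    case 2
    then have "1/2 < min 1 (f q)" by simp
    from dense[OF this] obtain c where "1/2 < c" "c < min 1 (f q)" by blast
    then show False using no[of p q c] q C fp by auto
  qed
qed

end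


section \<open>Orders of points\<close>

text \<open>The order of a point in the sense of Menger and Urysohn.\<close>

definition order_at_most :: "'a topology \<Rightarrow> 'a \<Rightarrow> nat \<Rightarrow> bool" where
  "order_at_most T x c \<longleftrightarrow> (\<forall>U. openin T U \<and> x \<in> U \<longrightarrow>
     (\<exists>W. openin T W \<and> x \<in> W \<and> W \<subseteq> U \<and> finite (T frontier_of W) \<and> card (T frontier_of W) \<le> c))"

lemma order_at_most_mono: "order_at_most T x c \<Longrightarrow> c \<le> d \<Longrightarrow> order_at_most T x d"
  unfolding order_at_most_def by (meson order_trans)

lemma order_at_most_homeomorphic:
  assumes h: "homeomorphic_map T T' h" and x: "x \<in> topspace T" "order_at_most T x c"
  shows "order_at_most T' (h x) c"
  unfolding order_at_most_def
proof (intro allI impI)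
  fix U assume U: "openin T' U \<and> h x \<in> U"
  have "continuous_map T T' h" using h homeomorphic_eq_everything_map by blast
  then have "openin T {y \<in> topspace T. h y \<in> U}" using U openin_continuous_map_preimage by blast
  then obtain W where W: "openin T W" "x \<in> W" "W \<subseteq> {y \<in> topspace T. h y \<in> U}"
      "finite (T frontier_of W)" "card (T frontier_of W) \<le> c"
    using x U unfolding order_at_most_def by blast
  have Wt: "W \<subseteq> topspace T" using W(1) openin_subset by blast
  have "T' frontier_of (h ` W) = h ` (T frontier_of W)" using homeomorphic_map_frontier_of[OF h Wt] .
  moreover have "card (h ` (T frontier_of W)) \<le> c" using card_image_le[OF W(4), of h] W(5) by simp
  moreover have "openin T' (h ` W)" using homeomorphic_map_openness[OF h Wt] W(1) by simp
  ultimately show "\<exists>W. openin T' W \<and> h x \<in> W \<and> W \<subseteq> U \<and> finite (T' frontier_of W) \<and> card (T' frontier_of W) \<le> c"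
    using W by (intro exI[of _ "h ` W"]) auto
qed

text \<open>For a Cantor point these are the choices of halves down to depth \<open>n\<close>:
  comparison with 1/2 decides correctly because the open middle third is empty.\<close>

primrec address :: "real \<Rightarrow> nat \<Rightarrow> bool list" where
  "address t 0 = []"
| "address t (Suc n) = (1/2 < t) # address (3 * t - 2 * of_bool (1/2 < t)) n"

lemma length_address [simp]: "length (address t n) = n"
  by (induction n arbitrary: t) auto

lemma prefix_address: "prefix (address t n) (address t (Suc n))"
proof (induction n arbitrary: t)
  case (Suc n)
  have "address t (Suc m) = (1/2 < t) # address (3 * t - 2 * of_bool (1/2 < t)) m" for m by (rule address.simps(2))
  note e = this[of n] this[of "Suc n"]
  show ?case unfolding e Cons_prefix_Cons using Suc.IH by blast
qed simp

lemma pos_address: "t \<in> cantor \<Longrightarrow> \<exists>r\<in>cantor. t = pos (address t n) r"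
proof (induction n arbitrary: t)
  case (Suc n)
  obtain b q where q: "q \<in> cantor" "t = pos [b] q" using cantor_cons Suc.prems by blast
  then have b: "(1/2 < t) = b" using cantor_bounds[OF q(1)] by (cases b) auto
  then have s: "3 * t - 2 * of_bool (1/2 < t) = q" unfolding b unfolding q(2)
    using pos_Cons_inverse[of b "[]" q] by (simp only: pos.simps(1))
  obtain r where r: "r \<in> cantor" "q = pos (address q n) r" using Suc.IH[OF q(1)] by blast
  have "address t (Suc n) = b # address q n" using address.simps(2)[of t n] unfolding b s[unfolded b] .
  moreover have "pos (b # address q n) r = t" using q(2) r(2)[symmetric] by simp
  ultimately show ?case using r(1) by metis
qed auto

lemma node_address: "t \<in> cantor \<Longrightarrow> node (address t n) t = 1"
  using pos_address[of t n] node_pos cantor_bounds by metis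

lemma node_antimono_prefix:
  assumes "prefix v w" "t \<in> cantor"
  shows "node w t \<le> node v t"
proof -
  obtain u where "w = v @ u" using assms(1) by (auto simp: prefix_def)
  then have "(\<exists>r. 0 \<le> r \<and> r \<le> 1 \<and> t = pos w r) \<longrightarrow> (\<exists>r. 0 \<le> r \<and> r \<le> 1 \<and> t = pos v r)"
    using pos_bounds[of _ u] by auto
  then show ?thesis unfolding node_cantor[OF assms(2)] of_bool_less_eq_iff .
qed

lemma node_address_eventually_0:
  assumes "t \<in> cantor" "s \<in> cantor" "s \<noteq> t"
  shows "\<exists>n. \<forall>m\<ge>n. node (address t m) s = 0"
proof -
  obtain n where n: "\<And>w. n \<le> length w \<Longrightarrow> \<not> (s \<in> pos w ` {0..1} \<and> t \<in> pos w ` {0..1})"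
    using pos_separates[OF assms(3)] by blast
  have "node (address t m) s = 0" if "n \<le> m" for m
  proof -
    have "t \<in> pos (address t m) ` {0..1}" using pos_address[OF assms(1), of m] cantor_bounds by auto
    then have "s \<notin> pos (address t m) ` {0..1}" using n[of "address t m"] that by auto
    then have "\<nexists>r. 0 \<le> r \<and> r \<le> 1 \<and> s = pos (address t m) r" by auto
    then show ?thesis using node_cantor[OF assms(2)] by simp
  qed
  then show ?thesis by blast
qed

lemma inner_edge_end:
  assumes "pos v r \<in> {1/12, 11/12, 1/3, 2/3}" "0 \<le> r" "r \<le> 1" "v \<noteq> []"
  shows "r \<in> {0, 1/4, 3/4, 1}"
proof -
  obtain b u where v: "v = b # u" using assms(4) by (cases v) auto
  have "pos u r \<in> {0, 1, 1/4, 3/4}"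
    using assms(1) pos_bounds[OF assms(2,3), of u] unfolding v by (cases b) auto
  then show ?thesis using pos_endpoint[OF assms(2,3), of u] by auto
qed

lemma pos_edge_end_ne:
  assumes "q \<in> {1/12, 11/12, 1/3, 2/3}" shows "pos u q \<notin> {0, 1, 1/4, 3/4}"
proof
  assume "pos u q \<in> {0, 1, 1/4, 3/4}"
  then show False using pos_endpoint[of q u] assms by auto
qed

text \<open>If an edge of \<open>u\<close> has one end inside \<open>w\<close> and one outside, then
  \<open>w\<close> is a proper descendant of \<open>u\<close>, and by \<open>inner_edge_end\<close>
  the end inside is a terminal of \<open>w\<close>.\<close>

lemma crossing_terminal:
  assumes "node w (pos u a) \<noteq> node w (pos u b)" "a \<in> {1/12, 11/12, 1/3, 2/3}" "b \<in> {1/12, 11/12, 1/3, 2/3}"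
  shows "\<exists>q\<in>{a, b}. \<exists>r\<in>{0, 1/4, 3/4, 1}. pos u q = pos w r"
proof -
  have D: "x \<in> cantor" if "x \<in> {1/12, 11/12, 1/3, 2/3}" for x :: real
    using that by (elim insertE emptyE) (simp_all only: cantor_edge_ends)
  have c: "pos u a \<in> cantor" "pos u b \<in> cantor" using D assms(2,3) cantor_bounds pos_cantor_iff by blast+
  have "node w (pos u a) = 1 \<or> node w (pos u b) = 1"
    using assms(1) node_cantor[OF c(1), of w] node_cantor[OF c(2), of w] by (auto simp: of_bool_def split: if_splits)
  then obtain q where q: "q \<in> {a, b}" "node w (pos u q) = 1" by blast
  then obtain r where r: "0 \<le> r" "r \<le> 1" "pos u q = pos w r"
    using node_cantor[of "pos u q" w] c by (auto split: if_splits)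
  have "prefix u w" using node_ne_imp_prefix[OF assms(1)] assms(2,3) by auto
  then obtain v where v: "w = u @ v" by (auto simp: prefix_def)
  have "v \<noteq> []" using assms node_pos[of a u] node_pos[of b u] v by auto
  moreover have "pos v r = q" using r(3) v by simp
  ultimately have "r \<in> {0, 1/4, 3/4, 1}" using inner_edge_end[of v r] r q(1) assms(2,3) by blast
  then show ?thesis using q r by blast
qed

lemma terminal_of_node:
  assumes "node w t = 1" "t \<in> {0, 1/4, 3/4, 1}"
  shows "\<exists>r\<in>{0, 1/4, 3/4, 1}. t = pos w r"
proof -
  have "t \<in> cantor" using assms(2) by (elim insertE emptyE) (simp_all only: cantor_endpoints cantor_quarters)
  then obtain r where "0 \<le> r" "r \<le> 1" "t = pos w r"
    using node_cantor[of t w] assms(1) by (auto split: if_splits)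
  moreover from this have "r \<in> {0, 1/4, 3/4, 1}"
    using pos_endpoint[of r w] assms(2) by auto
  ultimately show ?thesis by blast
qed

text \<open>Ends are recorded as bead and position, before hubs are identified. The end of
  \<open>Close\<close> at the limit point is omitted, as it has no position on a bead.\<close>

fun ends :: "edge \<Rightarrow> (nat \<times> real) set" where
  "ends (Gap k u) = {(k, pos u (1/3)), (k, pos u (2/3))}"
| "ends (Chord k u) = {(k, pos u (1/12)), (k, pos u (11/12))}"
| "ends (Roof k) = {(k, 1/4), (k, 3/4)}"
| "ends (Link k) = {(k, 1), (Suc k, 0)}"
| "ends Close = {(0, 0)}"

text \<open>With respect to base positions the edges form a matching. Counting the edges that leave
  a node thus reduces to counting its terminals.\<close>

lemma ends_unique:
  assumes "p \<in> ends e" "p \<in> ends e'"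
  shows "e = e'"
proof -
  have [simp]: "pos u q = 0 \<longleftrightarrow> False" "pos u q = 1 \<longleftrightarrow> False" "pos u q * 4 = 1 \<longleftrightarrow> False" "pos u q * 4 = 3 \<longleftrightarrow> False"
    "0 = pos u q \<longleftrightarrow> False" "1 = pos u q \<longleftrightarrow> False" "1/4 = pos u q \<longleftrightarrow> False" "3/4 = pos u q \<longleftrightarrow> False"
    "pos u q = 1/4 \<longleftrightarrow> False" "pos u q = 3/4 \<longleftrightarrow> False"
    if "q \<in> {1/12, 11/12, 1/3, 2/3}" for u q
    using pos_edge_end_ne[OF that, of u] by auto
  show ?thesis
    using assms by (cases e; cases e') (auto dest: pos_inj)
qed

section \<open>Upper bounds for the order\<close>

context necklace
begin

text \<open>On vertices \<open>F\<close> is the indicator function of the node \<open>w\<close>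
  taken in all beads of \<open>K\<close>. An edge along which \<open>F\<close> changes leaves this
  set, and it can do so only at a terminal.\<close>

lemma bead_value_crossing:
  fixes F :: "(coord \<Rightarrow> real) \<Rightarrow> real"
  assumes F: "\<And>k t. t \<in> cantor \<Longrightarrow> F (bead_at grp k t) = of_bool (k \<in> K) * node w t" "F limit_at = 0"
    and ne: "F (src grp e) \<noteq> F (dst grp e)"
  shows "\<exists>k\<in>K. \<exists>r\<in>{0, 1/4, 3/4, 1}. (k, pos w r) \<in> ends e"
proof (cases e)
  case (Gap k u)
  then have k: "k \<in> K" "node w (pos u (1/3)) \<noteq> node w (pos u (2/3))" using ne F by (auto split: if_splits)
  obtain q r where q: "q \<in> {1/3, 2/3}" and r: "r \<in> {0, 1/4, 3/4, 1}" "pos u q = pos w r"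
    using crossing_terminal[OF k(2)] by blast
  have "(k, pos u q) \<in> ends e" using q Gap by auto
  then show ?thesis using k(1) r by metis
next
  case (Chord k u)
  then have k: "k \<in> K" "node w (pos u (1/12)) \<noteq> node w (pos u (11/12))" using ne F by (auto split: if_splits)
  obtain q r where q: "q \<in> {1/12, 11/12}" and r: "r \<in> {0, 1/4, 3/4, 1}" "pos u q = pos w r"
    using crossing_terminal[OF k(2)] by blast
  have "(k, pos u q) \<in> ends e" using q Chord by auto
  then show ?thesis using k(1) r by metis
next
  case (Roof k)
  then have k: "k \<in> K" "node w (1/4) \<noteq> node w (3/4)" using ne F by (auto split: if_splits)
  then have "node w (1/4) = 1 \<or> node w (3/4) = 1" using node_cantor[of "1/4" w] node_cantor[of "3/4" w] by (auto simp: of_bool_def split: if_splits)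
  then have "\<exists>t\<in>{1/4, 3/4}. \<exists>r\<in>{0, 1/4, 3/4, 1}. t = pos w r" using terminal_of_node[of w] by blast
  then show ?thesis using k(1) unfolding Roof ends.simps by (metis insertE insertI1 insertI2 singletonD)
next
  case (Link k)
  then have "of_bool (k \<in> K) * node w 1 \<noteq> of_bool (Suc k \<in> K) * node w 0" using ne F by auto
  then have "k \<in> K \<and> node w 1 = 1 \<or> Suc k \<in> K \<and> node w 0 = 1"
    using node_cantor[of 0 w] node_cantor[of 1 w] by (auto simp: of_bool_def split: if_splits)
  then show ?thesis using terminal_of_node[of w 0] terminal_of_node[of w 1] unfolding Link ends.simps
    by (metis insertI1 insertI2)
next
  case Close
  then have "0 \<in> K \<and> node w 0 = 1" using ne F node_cantor[of 0 w] by (auto simp: of_bool_def split: if_splits)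
  then show ?thesis using terminal_of_node[of w 0] unfolding Close ends.simps by (metis insertI1)
qed

lemma bead_value_crossing_card:
  fixes F :: "(coord \<Rightarrow> real) \<Rightarrow> real"
  assumes F: "\<And>k t. t \<in> cantor \<Longrightarrow> F (bead_at grp k t) = of_bool (k \<in> K) * node w t" "F limit_at = 0"
    and K: "finite K"
  shows "finite {e. F (src grp e) \<noteq> F (dst grp e)} \<and> card {e. F (src grp e) \<noteq> F (dst grp e)} \<le> 4 * card K"
proof -
  let ?A = "{e. F (src grp e) \<noteq> F (dst grp e)}"
  let ?T = "{0, 1/4, 3/4, 1} :: real set"
  let ?B = "K \<times> pos w ` ?T"
  have "\<forall>e\<in>?A. \<exists>p. p \<in> ?B \<and> p \<in> ends e"
  proof
    fix e assume "e \<in> ?A"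
    then obtain k r where "k \<in> K" "r \<in> ?T" "(k, pos w r) \<in> ends e"
      using bead_value_crossing[of F K w e, OF F] by blast
    then show "\<exists>p. p \<in> ?B \<and> p \<in> ends e" by blast
  qed
  from bchoice[OF this] obtain p where p: "\<forall>e\<in>?A. p e \<in> ?B \<and> p e \<in> ends e" ..
  have inj: "inj_on p ?A" using p ends_unique by (intro inj_onI) metis
  have sub: "p ` ?A \<subseteq> ?B" using p by blast
  have fB: "finite ?B" using K by simp
  have "card (pos w ` ?T) \<le> card ?T" by (rule card_image_le) simp
  moreover have "card ?T \<le> 4" by (simp add: card_insert_if)
  ultimately have "card ?B \<le> 4 * card K" by (simp add: card_cartesian_product)
  moreover have "finite ?A" by (rule finite_imageD[OF finite_subset[OF sub fB] inj])
  moreover have "card ?A \<le> card ?B" using card_inj_on_le[OF inj sub fB] .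
  ultimately show ?thesis by linarith
qed

text \<open>The sets where \<open>f d\<close> exceeds a threshold \<open>\<theta> d\<close> shrink
  to the point, and their frontiers have at most one point on each edge along which
  \<open>f d\<close> changes, and none elsewhere.\<close>

lemma order_from_cuts:
  fixes f :: "nat \<Rightarrow> (nat \<Rightarrow> real) \<Rightarrow> real"
  assumes cont: "\<And>d. continuous_on X (f d)"
    and vert: "\<And>d g. vertex g \<Longrightarrow> f d (point g) = 0 \<or> f d (point g) = 1"
    and aff: "\<And>d e s. f d (S e s) = (1 - s) * f d (point (src grp e)) + s * f d (point (dst grp e))"
    and decr: "\<And>d g. vertex g \<Longrightarrow> f (Suc d) (point g) \<le> f d (point g)"
    and cut: "\<And>d. finite {e. f d (point (src grp e)) \<noteq> f d (point (dst grp e))}"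
      "\<And>d. card {e. f d (point (src grp e)) \<noteq> f d (point (dst grp e))} \<le> c"
    and x0: "vertex g0" "\<And>d. f d (point g0) = 1"
    and uniq: "\<And>g. vertex g \<Longrightarrow> (\<And>d. f d (point g) = 1) \<Longrightarrow> g = g0"
  shows "order_at_most T (point g0) c"
  unfolding order_at_most_def
proof (intro allI impI)
  fix U assume U: "openin T U \<and> point g0 \<in> U"
  then obtain O' where O': "open O'" "U = X \<inter> O'" by (auto simp: openin_open)
  \<comment> \<open>The thresholds tend to 1, because a fixed threshold would not shrink the
    neighbourhoods along edges that end at the point itself.\<close>
  define \<theta> where "\<theta> = (\<lambda>d::nat. 1 - 1 / (real d + 2))"
  have \<theta>: "0 < \<theta> d" "\<theta> d < 1" for d by (auto simp: \<theta>_def)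
  have \<theta>_mono: "\<theta> d \<le> \<theta> j" if "d \<le> j" for d j
    unfolding \<theta>_def using that by (intro diff_left_mono divide_left_mono) auto
  have f01: "0 \<le> f d (point g) \<and> f d (point g) \<le> 1" if "vertex g" for d g using vert[OF that, of d] by auto
  have X_edge: "\<exists>g. vertex g \<and> x = point g \<or> (\<exists>e s. 0 < s \<and> s < 1 \<and> x = S e s)" if "x \<in> X" for x
  proof (cases "x \<in> V")
    case True
    then show ?thesis using V_cases by metis
  next
    case False
    then have "x \<in> X - V" using that by simp
    then obtain e s where "0 < s" "s < 1" "x = S e s" unfolding X_minus_V by auto
    then show ?thesis by blast
  qed
  have mono1: "f (Suc d) x \<le> f d x" if "x \<in> X" for d x
  proof -
    consider g where "vertex g" "x = point g" | e s where "0 < s" "s < 1" "x = S e s" using X_edge[OF \<open>x \<in> X\<close>] by blast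
    then show ?thesis
    proof cases
      case (2 e s)
      then show ?thesis using decr[of "src grp e" d] decr[of "dst grp e" d] by (simp add: aff add_mono mult_left_mono)
    qed (use decr in auto)
  qed
  have mono: "f j x \<le> f d x" if "x \<in> X" "d \<le> j" for x d j
    using that(2) by (induction j rule: dec_induct) (use mono1[OF that(1)] order_trans in blast)+
  define W where "W = (\<lambda>d. {x \<in> X. \<theta> d < f d x})"
  define K where "K = (\<lambda>d. {x \<in> X. \<theta> d \<le> f d x})"
  have Wopen: "openin T (W d)" for d
  proof -
    have "W d = X \<inter> f d -` {\<theta> d<..}" by (auto simp: W_def)
    then show ?thesis using continuous_openin_preimage_gen[OF cont, of "{\<theta> d<..}" d] by simp
  qed
  have Kclosedin: "closedin T (K d)" for d
  proof -
    have "K d = X \<inter> f d -` {\<theta> d..}" by (auto simp: K_def)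
    then show ?thesis using continuous_closedin_preimage[OF cont, of "{\<theta> d..}" d] by simp
  qed
  have Kclosed: "closed (K d)" for d
    using Kclosedin closedin_closed_trans compact_imp_closed[OF compact_X] by blast
  \<comment> \<open>Otherwise compactness gives a point outside \<open>O'\<close> in all the nested
    sets \<open>K d\<close>. Every \<open>f j\<close> is at least 1 there. Inside an edge this would
    make both of its ends equal to \<open>point g0\<close>, so the point is \<open>point g0\<close>
    itself, which lies in \<open>O'\<close>.\<close>
  have "\<exists>d. K d \<subseteq> O'"
  proof (rule ccontr)
    assume none: "\<not> (\<exists>d. K d \<subseteq> O')"
    have "compact (X - O')" using compact_diff[OF compact_X O'(1)] .
    then have "(X - O') \<inter> (\<Inter>d\<in>UNIV. K d) \<noteq> {}"
    proof (rule compact_imp_fip_image)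
      fix I :: "nat set" assume I: "finite I" "I \<subseteq> UNIV"
      define m where "m = Max (insert 0 I)"
      obtain x where x: "x \<in> K m" "x \<notin> O'" using none by blast
      have "x \<in> K d" if "d \<in> I" for d
      proof -
        have "d \<le> m" using I that by (auto simp: m_def)
        then show ?thesis using x(1) mono[of x d m] \<theta>_mono[of d m] by (auto simp: K_def)
      qed
      moreover have "x \<in> X" using x(1) by (simp add: K_def)
      ultimately show "(X - O') \<inter> (\<Inter>d\<in>I. K d) \<noteq> {}" using x(2) by blast
    qed (use Kclosed in auto)
    then obtain x where x: "x \<in> X" "x \<notin> O'" "\<And>d. x \<in> K d" by blast
    have one: "1 \<le> f j x" for j
    proof (rule ccontr)
      assume "\<not> 1 \<le> f j x"
      then obtain n where n: "0 < n" "inverse (real n) < 1 - f j x" using reals_Archimedean2 ex_inverse_of_nat_less[of "1 - f j x"] by auto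
      define d where "d = max j n"
      have "\<theta> d \<le> f j x" using x(3)[of d] mono[OF x(1), of j d] by (auto simp: K_def d_def)
      moreover have "1 / (real d + 2) \<le> inverse (real n)"
        using n by (simp add: inverse_eq_divide d_def) (intro divide_left_mono, auto)
      ultimately show False using n by (simp add: \<theta>_def)
    qed
    consider g where "vertex g" "x = point g" | e s where "0 < s" "s < 1" "x = S e s" using X_edge[OF x(1)] by blast
    then show False
    proof cases
      case (1 g)
      then have "g = g0" using uniq[of g] one vert[of g] by (metis not_one_le_zero)
      then show False using 1 U O' x(2) by auto
    next
      case (2 e s)
      have "f d (point (src grp e)) = 1 \<and> f d (point (dst grp e)) = 1" for d
        using one[of d] 2 vert[of "src grp e" d] vert[of "dst grp e" d] by (auto simp: aff)
      then have "src grp e = g0" "dst grp e = g0" using uniq by simp_all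
      then show False using src_ne_dst by metis
    qed
  qed
  then obtain d where d: "K d \<subseteq> O'" by blast
  define A where "A = {e. f d (point (src grp e)) \<noteq> f d (point (dst grp e))}"
  have "W d \<subseteq> K d" by (auto simp: W_def K_def)
  then have "T closure_of W d \<subseteq> K d" using Kclosedin closure_of_minimal by blast
  then have fr: "x \<in> X \<and> f d x = \<theta> d" if "x \<in> T frontier_of W d" for x
    using that unfolding frontier_of_openin[OF Wopen] by (auto simp: W_def K_def)
  have "T frontier_of W d \<subseteq> (\<lambda>e. S e (if f d (point (src grp e)) = 0 then \<theta> d else 1 - \<theta> d)) ` A"
  proof
    fix x assume "x \<in> T frontier_of W d"
    then have x: "x \<in> X" "f d x = \<theta> d" using fr by auto
    have "\<not> (\<exists>g. vertex g \<and> x = point g)" using vert[of _ d] x(2) \<theta>[of d] by force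
    then obtain e s where e: "x = S e s" using X_edge[OF x(1)] by blast
    \<comment> \<open>Along the edge \<open>f d\<close> runs affinely from 0 to 1 or from 1 to 0, so
      it takes the value \<open>\<theta> d\<close> at exactly this parameter.\<close>
    have "e \<in> A" "s = (if f d (point (src grp e)) = 0 then \<theta> d else 1 - \<theta> d)"
      using x(2) \<theta>[of d] vert[of "src grp e" d] vert[of "dst grp e" d] unfolding e aff A_def by auto
    then show "x \<in> (\<lambda>e. S e (if f d (point (src grp e)) = 0 then \<theta> d else 1 - \<theta> d)) ` A" using e by blast
  qed
  then have "finite (T frontier_of W d)" "card (T frontier_of W d) \<le> c"
    using cut[of d] unfolding A_def[symmetric]
    by (auto intro: finite_subset, meson card_image_le card_mono finite_imageI order_trans)
  moreover have "point g0 \<in> W d" using U O' x0(2) \<theta> by (auto simp: W_def)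
  moreover have "W d \<subseteq> U" using \<open>W d \<subseteq> K d\<close> d O' by (auto simp: W_def)
  ultimately show "\<exists>W. openin T W \<and> point g0 \<in> W \<and> W \<subseteq> U \<and>
      finite (T frontier_of W) \<and> card (T frontier_of W) \<le> c"
    using Wopen by blast
qed

text \<open>The cuts are the nodes of depth \<open>n + d\<close> around \<open>t\<close>, taken in
  all beads of \<open>K\<close> at once, and each bead contributes four terminals. The shift
  \<open>n\<close> allows the nodes to start at a suitable depth.\<close>

lemma order_from_node_values:
  fixes f :: "nat \<Rightarrow> (nat \<Rightarrow> real) \<Rightarrow> real"
  assumes cont: "\<And>d. continuous_on X (f d)"
    and aff: "\<And>d e s. f d (S e s) = (1 - s) * f d (point (src grp e)) + s * f d (point (dst grp e))"
    and fb: "\<And>d j s. f d (point (bead_at grp j s)) = of_bool (j \<in> K) * node (address t (n + d)) s"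
    and fl: "\<And>d. f d (point limit_at) = 0"
    and t: "t \<in> cantor" and K: "finite K" "k \<in> K" "\<And>j. j \<in> K \<Longrightarrow> bead_at grp j t = bead_at grp k t"
  shows "order_at_most T (P k t) (4 * card K)"
  unfolding P_def
proof (rule order_from_cuts[of f, OF cont _ aff])
  note card = bead_value_crossing_card[of "\<lambda>g. f d (point g)" K "address t (n + d)" for d, OF fb fl K(1)]
  show "f d (point g) = 0 \<or> f d (point g) = 1" if "vertex g" for d g
    using that unfolding vertex_def by (auto simp: fb fl node_cantor)
  show "f (Suc d) (point g) \<le> f d (point g)" if "vertex g" for d g
    using that node_antimono_prefix[OF prefix_address[of t "n + d"]] unfolding vertex_def by (auto simp: fb fl)
  show "finite {e. f d (point (src grp e)) \<noteq> f d (point (dst grp e))}" "card {e. f d (point (src grp e)) \<noteq> f d (point (dst grp e))} \<le> 4 * card K" for d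
    using card[of d] by auto
  show "vertex (bead_at grp k t)" using t by simp
  show "f d (point (bead_at grp k t)) = 1" for d using node_address[OF t] K(2) by (simp add: fb)
  show "g = bead_at grp k t" if g: "vertex g" "\<And>d. f d (point g) = 1" for g
  proof -
    have "g \<noteq> limit_at" using g(2)[of 0] fl by auto
    then obtain j s where s: "s \<in> cantor" "g = bead_at grp j s" using g(1) by (auto simp: vertex_def)
    have "j \<in> K" using g(2)[of 0] by (cases "j \<in> K") (simp_all add: s fb)
    moreover have "s = t"
    proof (rule ccontr)
      assume "s \<noteq> t"
      then obtain m where m: "\<And>i. m \<le> i \<Longrightarrow> node (address t i) s = 0" using node_address_eventually_0[OF t s(1)] by metis
      then show False using g(2)[of m] m[of "n + m"] by (simp add: s fb)
    qed
    ultimately show ?thesis using s K(3) by simp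
  qed
qed

lemma order_base:
  assumes t: "t \<in> cantor" "t \<noteq> hub"
  shows "order_at_most T (P k t) 4"
proof -
  \<comment> \<open>From depth \<open>n\<close> on the nodes around \<open>t\<close> miss the hub.
    Then the hub value subtracted in the \<open>Cell\<close> coordinate is 0, and the coordinate is
    the indicator of the node.\<close>
  obtain n where n: "\<And>m. n \<le> m \<Longrightarrow> node (address t m) hub = 0"
    using node_address_eventually_0[OF t(1) hub_cantor] t(2) by metis
  have "order_at_most T (P k t) (4 * card {k})"
  proof (rule order_from_node_values[of "\<lambda>d. coord (Cell k (address t (n + d)))"])
    show "continuous_on X (coord (Cell k (address t (n + d))))" for d
      by (rule continuous_on_coord[of _ "\<lambda>x. x"]) (rule continuous_on_id)
  qed (use t n in \<open>auto simp: S_def\<close>)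
  then show ?thesis by simp
qed

lemma finite_group: "finite {j. grp j = n}"
  by (rule finite_subset[OF _ grp_fin[of "Suc n"]]) auto

lemma order_hub: "order_at_most T (P k hub) (4 * card {j. grp j = grp k})"
proof -
  define K where "K = {j. grp j = grp k}"
  have K: "finite K" using finite_group by (simp add: K_def)
  \<comment> \<open>On vertices the difference of the two \<open>Tail\<close> coordinates is 1 in
    the group of \<open>k\<close> and 0 elsewhere. In the group it compensates for the value 1 at
    the hub that the \<open>Cell\<close> coordinates subtract.\<close>
  define f where "f = (\<lambda>d x. coord (Tail (grp k)) x - coord (Tail (Suc (grp k))) x + (\<Sum>j\<in>K. coord (Cell j (address hub (0 + d))) x))"
  show ?thesis unfolding K_def[symmetric]
  proof (rule order_from_node_values[of f])
    show "f d (point (bead_at grp j s)) = of_bool (j \<in> K) * node (address hub (0 + d)) s" for d j s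
    proof -
      have "(\<Sum>i\<in>K. bead_at grp j s (Cell i (address hub (0 + d)))) = (\<Sum>i\<in>K. if i = j then node (address hub (0 + d)) s - 1 else 0)"
        using node_address[OF hub_cantor] by (intro sum.cong) auto
      also have "\<dots> = of_bool (j \<in> K) * (node (address hub (0 + d)) s - 1)" using K by simp
      finally show ?thesis by (auto simp: f_def K_def)
    qed
    show "continuous_on X (f d)" for d unfolding f_def
      by (intro continuous_intros continuous_on_coord[of _ "\<lambda>x. x"] continuous_on_id)
    show "f d (S e s) = (1 - s) * f d (point (src grp e)) + s * f d (point (dst grp e))" for d e s
      by (simp add: f_def S_def sum.distrib sum_subtractf sum_distrib_left algebra_simps)
    show "bead_at grp j hub = bead_at grp k hub" if "j \<in> K" for j
      using P_hub_eq_iff[of j k] that by (simp add: P_def K_def)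
  qed (auto simp: f_def K_def finite_group)
qed

text \<open>A cut at a level of a \<open>Tail\<close> coordinate meets only the closing edge and one
  link. The bound 4 is the common one for all points other than hubs.\<close>

lemma order_Q: "order_at_most T Q 4"
proof -
  define f where "f = (\<lambda>d. coord (Tail d))"
  have cross: "{e. f d (point (src grp e)) \<noteq> f d (point (dst grp e))} \<subseteq> {Close, Link (THE k. grp k < d \<and> d \<le> grp (Suc k))}" for d
  proof
    fix e assume "e \<in> {e. f d (point (src grp e)) \<noteq> f d (point (dst grp e))}"
    then have "src grp e (Tail d) \<noteq> dst grp e (Tail d)" by (simp add: f_def)
    then consider "e = Close" | k where "e = Link k" "grp k < d \<and> d \<le> grp (Suc k)" using crossing_Tail by blast
    then show "e \<in> {Close, Link (THE k. grp k < d \<and> d \<le> grp (Suc k))}"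
    proof cases
      case (2 k)
      then have "(THE k. grp k < d \<and> d \<le> grp (Suc k)) = k" using group_jump_unique by blast
      then show ?thesis using 2 by simp
    qed simp
  qed
  show ?thesis unfolding Q_def
  proof (rule order_from_cuts[of f])
    show "continuous_on X (f d)" for d unfolding f_def by (rule continuous_on_coord[of _ "\<lambda>x. x"]) (rule continuous_on_id)
    show "f d (point g) = 0 \<or> f d (point g) = 1" if "vertex g" for d g
      using that unfolding vertex_def by (auto simp: f_def)
    show "f d (S e s) = (1 - s) * f d (point (src grp e)) + s * f d (point (dst grp e))" for d e s
      by (simp add: f_def S_def)
    show "f (Suc d) (point g) \<le> f d (point g)" if "vertex g" for d g
      using that unfolding vertex_def by (auto simp: f_def of_bool_def)
    show "finite {e. f d (point (src grp e)) \<noteq> f d (point (dst grp e))}" for d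
      by (rule finite_subset[OF cross]) simp
    have "card {e. f d (point (src grp e)) \<noteq> f d (point (dst grp e))} \<le> card {Close, Link (THE k. grp k < d \<and> d \<le> grp (Suc k))}" for d
      by (rule card_mono[OF _ cross]) simp
    then show "card {e. f d (point (src grp e)) \<noteq> f d (point (dst grp e))} \<le> 4" for d
      by (rule order_trans) (simp add: card_insert_if)
    show "vertex limit_at" by simp
    show "f d (point limit_at) = 1" for d by (simp add: f_def)
    show "g = limit_at" if g: "vertex g" "\<And>d. f d (point g) = 1" for g
    proof (rule ccontr)
      assume "g \<noteq> limit_at"
      then obtain j s where s: "g = bead_at grp j s" using g(1) by (auto simp: vertex_def)
      show False using g(2)[of "Suc (grp j)"] by (simp add: s f_def)
    qed
  qed
qed

lemma order_edge:
  assumes e: "e \<in> E" and s: "0 < s" "s < 1"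
  shows "order_at_most T (S e s) 4"
  unfolding order_at_most_def
proof (intro allI impI)
  fix U assume U: "openin T U \<and> S e s \<in> U"
  then obtain O' where O': "open O'" "U = X \<inter> O'" by (auto simp: openin_open)
  have "open (S e -` O')" using continuous_on_S[of UNIV e] O'(1) by (simp add: open_vimage)
  moreover have "s \<in> S e -` O'" using U O' by simp
  ultimately obtain r where r: "0 < r" "ball s r \<subseteq> S e -` O'" using openE by blast
  \<comment> \<open>Halving the distances keeps the closed segment around \<open>s\<close> strictly
    inside the edge and its image inside \<open>O'\<close>.\<close>
  define \<delta> where "\<delta> = min (r / 2) (min (s / 2) ((1 - s) / 2))"
  have "0 < \<delta>" using r s by (simp add: \<delta>_def)
  have "\<delta> < r" using r by (simp add: \<delta>_def min_less_iff_disj)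
  have "\<delta> < s" using s by (simp add: \<delta>_def min_less_iff_disj)
  have "\<delta> < 1 - s" using s by (simp add: \<delta>_def min_less_iff_disj)
  note \<delta> = \<open>0 < \<delta>\<close> \<open>\<delta> < r\<close> \<open>\<delta> < s\<close> \<open>\<delta> < 1 - s\<close>
  define W where "W = S e ` {s - \<delta> <..< s + \<delta>}"
  define K where "K = S e ` {s - \<delta>..s + \<delta>}"
  have WX: "W \<subseteq> K" by (auto simp: W_def K_def)
  have KX: "K \<subseteq> X"
  proof -
    have "K \<subseteq> S e ` {0..1}" unfolding K_def using \<delta> by (intro image_mono) auto
    then show ?thesis using S_subset_X[OF e] by blast
  qed
  \<comment> \<open>The two inequalities force \<open>Bump e\<close> to be positive, so the point is
    inside \<open>e\<close>, and then say that its parameter \<open>Skew e / Bump e\<close> differs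
    from \<open>s\<close> by less than \<open>\<delta>\<close>.\<close>
  have "W = X \<inter> ({x. (s - \<delta>) * coord (Bump e) x < coord (Skew e) x} \<inter> {x. coord (Skew e) x < (s + \<delta>) * coord (Bump e) x})" (is "_ = X \<inter> (?L \<inter> ?R)")
  proof
    show "W \<subseteq> X \<inter> (?L \<inter> ?R)"
    proof
      fix x assume "x \<in> W"
      then obtain r where r: "s - \<delta> < r" "r < s + \<delta>" "x = S e r" by (auto simp: W_def)
      have b: "0 < r * (1 - r)" using r \<delta> by (intro mult_pos_pos) auto
      have "(s - \<delta>) * (r * (1 - r)) < r * (r * (1 - r))" "r * (r * (1 - r)) < (s + \<delta>) * (r * (1 - r))"
        using mult_strict_right_mono[OF r(1) b] mult_strict_right_mono[OF r(2) b] .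
      then have "x \<in> ?L \<inter> ?R" unfolding r(3) mem_Collect_eq Int_iff S_bump S_skew by (simp add: mult.assoc)
      then show "x \<in> X \<inter> (?L \<inter> ?R)" using \<open>x \<in> W\<close> WX KX by blast
    qed
    show "X \<inter> (?L \<inter> ?R) \<subseteq> W"
    proof
      fix x assume x: "x \<in> X \<inter> (?L \<inter> ?R)"
      then have "(s - \<delta>) * coord (Bump e) x < (s + \<delta>) * coord (Bump e) x" by auto
      then have bump: "0 < coord (Bump e) x" using \<delta>(1) by (simp add: algebra_simps zero_less_mult_iff)
      then have "x \<notin> V" using vertex_bump(1) V_cases by (metis coord_point less_irrefl)
      then have "x \<in> X - V" using x by blast
      then obtain i r where r: "0 < r" "r < 1" "x = S i r" unfolding X_minus_V by auto
      have i: "i = e" using bump unfolding r(3) by (simp add: S_bump split: if_splits)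
      have b: "0 < r * (1 - r)" using r by (intro mult_pos_pos) auto
      have "(s - \<delta>) * (r * (1 - r)) < r * (r * (1 - r))" "r * (r * (1 - r)) < (s + \<delta>) * (r * (1 - r))"
        using x unfolding r(3) i Int_iff mem_Collect_eq S_bump S_skew by (simp_all add: mult.assoc)
      then have "s - \<delta> < r" "r < s + \<delta>" using b mult_less_cancel_right_pos by blast+
      then show "x \<in> W" using r(3) i by (auto simp: W_def)
    qed
  qed
  moreover have "open ?L" "open ?R"
    by (rule open_Collect_less; intro continuous_intros continuous_on_coord[of _ "\<lambda>x. x"] continuous_on_id)+
  ultimately have Wopen: "openin T W" by (metis openin_open_Int open_Int)
  have "compact K" unfolding K_def by (intro compact_continuous_image continuous_on_S compact_Icc)
  then have "closedin T K" using KX compact_imp_closed closed_subset by blast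
  then have "T closure_of W \<subseteq> K" using WX closure_of_minimal by blast
  then have "T frontier_of W \<subseteq> K - W" unfolding frontier_of_openin[OF Wopen] by blast
  also have "K - W \<subseteq> {S e (s - \<delta>), S e (s + \<delta>)}"
  proof
    fix x assume x: "x \<in> K - W"
    then obtain r where r: "s - \<delta> \<le> r" "r \<le> s + \<delta>" "x = S e r" by (auto simp: K_def)
    then have "\<not> (s - \<delta> < r \<and> r < s + \<delta>)" using x by (auto simp: W_def)
    then have "r = s - \<delta> \<or> r = s + \<delta>" using r by linarith
    then show "x \<in> {S e (s - \<delta>), S e (s + \<delta>)}" using r(3) by blast
  qed
  finally have fr: "T frontier_of W \<subseteq> {S e (s - \<delta>), S e (s + \<delta>)}" .
  have "card (T frontier_of W) \<le> card {S e (s - \<delta>), S e (s + \<delta>)}" by (rule card_mono[OF _ fr]) simp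
  also have "\<dots> \<le> 4" by (simp add: card_insert_if)
  finally have "card (T frontier_of W) \<le> 4" .
  moreover have "finite (T frontier_of W)" by (rule finite_subset[OF fr]) simp
  moreover have "S e s \<in> W" using \<delta>(1) by (auto simp: W_def)
  moreover have "W \<subseteq> U"
  proof
    fix x assume "x \<in> W"
    then obtain r' where r': "s - \<delta> < r'" "r' < s + \<delta>" "x = S e r'" by (auto simp: W_def)
    then have "r' \<in> ball s r" using \<delta>(2) by (auto simp: dist_real_def)
    then show "x \<in> U" using r(2) r'(3) O'(2) \<open>x \<in> W\<close> WX KX by blast
  qed
  ultimately show "\<exists>W. openin T W \<and> S e s \<in> W \<and> W \<subseteq> U \<and>
      finite (T frontier_of W) \<and> card (T frontier_of W) \<le> 4"
    using Wopen by blast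
qed

text \<open>On each bead of the group two base arcs leave the hub, and any two of all these arcs
  meet only there. The frontier of a neighbourhood of the hub that omits their far ends has a point
  on each of them.\<close>

lemma order_hub_lower:
  assumes "order_at_most T (P k hub) c"
  shows "2 * card {j. grp j = grp k} \<le> c"
proof -
  define K where "K = {j. grp j = grp k}"
  have K: "finite K" using finite_group by (simp add: K_def)
  define I where "I = (\<lambda>b. if b then {1/4..hub} else {hub..3/4})"
  define q where "q = (\<lambda>b. if b then 1/4 else 3/4 :: real)"
  have I: "connected (I b)" "hub \<in> I b" "q b \<in> I b" "I b \<subseteq> {0..1}" "q b \<noteq> hub" for b
    by (auto simp: I_def hub_def q_def)
  have II: "I True \<inter> I False = {hub}" by (auto simp: I_def hub_def)
  have Peq: "P j hub = P k hub" if "j \<in> K" for j using that P_hub_eq_iff by (simp add: K_def)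
  define D where "D = (\<lambda>(j, b). P j (q b)) ` (K \<times> UNIV)"
  have D: "finite D" "P k hub \<notin> D"
  proof -
    show "finite D" using K by (simp add: D_def)
    have "P k hub \<noteq> P j (q b)" for j b using P_eqD[of k hub j "q b"] I(4,5) I(3)[of b] by (auto simp: hub_def q_def split: if_splits)
    then show "P k hub \<notin> D" by (auto simp: D_def)
  qed
  have "openin T (X - D)" using finite_imp_closed[OF D(1)] by (metis Diff_eq openin_open_Int open_Compl)
  moreover have "P k hub \<in> X - D" using D(2) P_in_X[of hub k] by (simp add: hub_def)
  ultimately obtain W where W: "openin T W" "P k hub \<in> W" "W \<subseteq> X - D"
      "finite (T frontier_of W)" "card (T frontier_of W) \<le> c"
    using assms unfolding order_at_most_def by blast
  define Fr where "Fr = T frontier_of W"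
  have hubFr: "P k hub \<notin> Fr" using W(2) unfolding Fr_def frontier_of_openin[OF W(1)] by blast
  have meet: "\<exists>x. x \<in> P j ` I b \<and> x \<in> Fr" if "j \<in> K" for j b
  proof -
    have sub: "P j ` I b \<subseteq> X"
    proof (rule image_subsetI)
      fix t assume "t \<in> I b"
      then have "0 \<le> t" "t \<le> 1" using I(4)[of b] by auto
      then show "P j t \<in> X" by (rule P_in_X)
    qed
    have "connected (P j ` I b)" by (rule connected_continuous_image[OF continuous_on_P I(1)])
    then have "connectedin T (P j ` I b)" using sub by (simp add: connectedin_subtopology)
    moreover have "P k hub \<in> P j ` I b" using I(2)[of b] Peq[OF that] by (metis imageI)
    moreover have "P j (q b) \<in> P j ` I b" using I(3) by blast
    moreover have "P j (q b) \<in> D" unfolding D_def by (rule image_eqI[of _ _ "(j, b)"]) (use that in auto)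
    then have "P j (q b) \<notin> W" using W(3) by blast
    ultimately have "P j ` I b \<inter> T frontier_of W \<noteq> {}"
      using W(2) by (intro connectedin_Int_frontier_of) blast+
    then show ?thesis by (auto simp: Fr_def)
  qed
  then have "\<forall>p\<in>K \<times> UNIV. \<exists>x. x \<in> P (fst p) ` I (snd p) \<and> x \<in> Fr" by auto
  from bchoice[OF this] obtain x where x: "\<forall>p\<in>K \<times> UNIV. x p \<in> P (fst p) ` I (snd p) \<and> x p \<in> Fr" ..
  have "inj_on x (K \<times> UNIV)"
  proof (rule inj_onI)
    fix p p' assume p: "p \<in> K \<times> UNIV" "p' \<in> K \<times> UNIV" "x p = x p'"
    obtain t where t: "t \<in> I (snd p)" "x p = P (fst p) t" using x p(1) by blast
    obtain t' where t': "t' \<in> I (snd p')" "x p' = P (fst p') t'" using x p(2) by blast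
    have b: "0 \<le> t" "t \<le> 1" "0 \<le> t'" "t' \<le> 1" using t(1) t'(1) I(4)[of "snd p"] I(4)[of "snd p'"] by auto
    have "t \<noteq> hub"
    proof
      assume "t = hub"
      then have "x p = P k hub" using t(2) Peq p(1) by auto
      then show False using x p(1) hubFr by metis
    qed
    then have e: "fst p = fst p'" "t = t'" using P_eqD[of "fst p" t "fst p'" t'] t t' p(3) b by auto
    have "snd p = snd p'"
    proof (rule ccontr)
      assume "snd p \<noteq> snd p'"
      then have "t \<in> I True \<inter> I False" using t(1) t'(1) e(2) by (cases "snd p"; cases "snd p'") auto
      then show False using II \<open>t \<noteq> hub\<close> by blast
    qed
    then show "p = p'" using e(1) by (simp add: prod_eq_iff)
  qed
  moreover have "x ` (K \<times> UNIV) \<subseteq> Fr" using x by blast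
  ultimately have "card (K \<times> (UNIV :: bool set)) \<le> card Fr" using W(4) card_inj_on_le unfolding Fr_def by blast
  then show ?thesis using W(5) by (simp add: card_cartesian_product Fr_def K_def mult.commute)
qed

lemma order_cases:
  assumes "x \<in> X"
  shows "order_at_most T x 4 \<or> (\<exists>k. x = P k hub)"
proof (cases "x \<in> V")
  case True
  then show ?thesis using order_Q order_base unfolding V_def by blast
next
  case False
  then have "x \<in> X - V" using assms by simp
  then obtain e s where "e \<in> E" "0 < s" "s < 1" "x = S e s" unfolding X_minus_V by auto
  then show ?thesis using order_edge by blast
qed

end


section \<open>Continuum many necklaces\<close>

definition offset :: "(nat \<Rightarrow> nat) \<Rightarrow> nat \<Rightarrow> nat" where
  "offset m n = (\<Sum>j<n. m j)"

text \<open>Group \<open>n\<close> becomes the block of \<open>m n\<close> consecutive beads that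
  begins with bead \<open>offset m n\<close>.\<close>

definition group_of :: "(nat \<Rightarrow> nat) \<Rightarrow> nat \<Rightarrow> nat" where
  "group_of m k = (LEAST n. k < offset m (Suc n))"

lemma offset_mono: "i \<le> j \<Longrightarrow> offset m i \<le> offset m j"
  unfolding offset_def by (intro sum_mono2) auto

lemma group_of_eq_iff:
  assumes "\<And>n. 1 \<le> m n"
  shows "group_of m k = n \<longleftrightarrow> offset m n \<le> k \<and> k < offset m (Suc n)"
proof -
  have "n \<le> offset m n" for n
    unfolding offset_def using sum_mono[of "{..<n}" "\<lambda>_. 1" m] assms by simp
  then have ex: "\<exists>n. k < offset m (Suc n)" by (metis Suc_le_lessD)
  have lt: "k < offset m (Suc (group_of m k))" unfolding group_of_def by (rule LeastI_ex[OF ex])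
  have ge: "offset m (group_of m k) \<le> k"
  proof (cases "group_of m k")
    case (Suc i)
    then have "\<not> k < offset m (Suc i)" unfolding group_of_def by (intro not_less_Least) simp
    then show ?thesis using Suc by simp
  qed (simp add: offset_def)
  have "i = n" if "offset m i \<le> k" "k < offset m (Suc i)" "offset m n \<le> k" "k < offset m (Suc n)" for i n
    using that offset_mono[of "Suc i" n m] offset_mono[of "Suc n" i m] by (metis leD le_trans not_less_eq_eq nat_neq_iff Suc_leI)
  then show ?thesis using lt ge by blast
qed

lemma card_group:
  assumes "\<And>n. 1 \<le> m n"
  shows "card {k. group_of m k = n} = m n"
proof -
  have "{k. group_of m k = n} = {offset m n..<offset m (Suc n)}"
    using group_of_eq_iff[OF assms] by auto
  then show ?thesis by (simp add: offset_def)
qed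

lemma necklace_group_of:
  assumes "\<And>n. 1 \<le> m n"
  shows "necklace (group_of m)"
proof
  show "mono (group_of m)"
  proof (rule monoI)
    fix i j :: nat assume ij: "i \<le> j"
    have "j < offset m (Suc (group_of m j))" using group_of_eq_iff[of m, OF assms, where k = j and n = "group_of m j"] by simp
    then show "group_of m i \<le> group_of m j" unfolding group_of_def[of m i] using ij by (intro Least_le) simp
  qed
  show "finite {k. group_of m k < n}" for n
  proof (rule finite_subset)
    show "{k. group_of m k < n} \<subseteq> {..<offset m n}"
    proof
      fix k assume "k \<in> {k. group_of m k < n}"
      moreover have "k < offset m (Suc (group_of m k))" using group_of_eq_iff[of m, OF assms, where k = k and n = "group_of m k"] by simp
      ultimately show "k \<in> {..<offset m n}" using offset_mono[of "Suc (group_of m k)" n m] by auto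
    qed
  qed simp
qed

text \<open>
  With powers of 8 the intervals from \<open>2m\<close> to \<open>4m\<close> that contain the orders of the hubs are disjoint.
\<close>

definition size_code :: "nat set \<Rightarrow> nat \<Rightarrow> nat" where
  "size_code A n = (if n \<in> A then 8 ^ Suc n else 1)"

lemma size_code_ge_1: "1 \<le> size_code A n"
  by (simp add: size_code_def)

definition necklace_space :: "bool \<Rightarrow> nat set \<Rightarrow> (nat \<Rightarrow> real) topology" where
  "necklace_space cl A = top_of_set (necklace.X (group_of (size_code A)) cl)"

text \<open>The right-hand side is invariant under homeomorphisms, so the set \<open>A\<close> can
  be recovered from the space.\<close>

lemma necklace_space_order:
  "n \<in> A \<longleftrightarrow> (\<exists>x\<in>topspace (necklace_space cl A).
     \<not> order_at_most (necklace_space cl A) x (2 * 8 ^ Suc n - 1) \<and> order_at_most (necklace_space cl A) x (4 * 8 ^ Suc n))"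
proof -
  interpret necklace "group_of (size_code A)" cl by (rule necklace_group_of[OF size_code_ge_1])
  note card = card_group[of "size_code A", OF size_code_ge_1]
  have T: "necklace_space cl A = top_of_set X" by (simp add: necklace_space_def)
  show ?thesis unfolding T
  proof
    assume "n \<in> A"
    then have sz: "size_code A n = 8 ^ Suc n" by (simp add: size_code_def)
    have "card {k. group_of (size_code A) k = n} \<noteq> 0" using card[of n] sz by simp
    then have "{k. group_of (size_code A) k = n} \<noteq> {}" by (metis card.empty)
    then obtain k where k: "group_of (size_code A) k = n" by blast
    have "order_at_most (top_of_set X) (P k hub) (4 * 8 ^ Suc n)" using order_hub[of k] k card[of n] sz by simp
    moreover have "\<not> order_at_most (top_of_set X) (P k hub) (2 * 8 ^ Suc n - 1)"
    proof
      assume "order_at_most (top_of_set X) (P k hub) (2 * 8 ^ Suc n - 1)"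
      then have "2 * card {j. group_of (size_code A) j = group_of (size_code A) k} \<le> 2 * 8 ^ Suc n - 1"
        by (rule order_hub_lower)
      moreover have "card {j. group_of (size_code A) j = group_of (size_code A) k} = 8 ^ Suc n"
        unfolding k card sz ..
      moreover have "0 < (8::nat) ^ Suc n" by simp
      ultimately show False by linarith
    qed
    moreover have "P k hub \<in> X" by (rule P_in_X) (auto simp: hub_def)
    ultimately show "\<exists>x\<in>topspace (top_of_set X). \<not> order_at_most (top_of_set X) x (2 * 8 ^ Suc n - 1) \<and> order_at_most (top_of_set X) x (4 * 8 ^ Suc n)"
      by (intro bexI[of _ "P k hub"]) auto
  next
    assume "\<exists>x\<in>topspace (top_of_set X). \<not> order_at_most (top_of_set X) x (2 * 8 ^ Suc n - 1) \<and> order_at_most (top_of_set X) x (4 * 8 ^ Suc n)"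
    then obtain x where x: "x \<in> X" "\<not> order_at_most (top_of_set X) x (2 * 8 ^ Suc n - 1)" "order_at_most (top_of_set X) x (4 * 8 ^ Suc n)"
      by auto
    \<comment> \<open>This excludes the points other than hubs, and later also the hubs of groups
      with a single bead, because all of these have order at most 4.\<close>
    have big: "4 \<le> 2 * 8 ^ Suc n - (1::nat)"
    proof -
      have "1 \<le> (8::nat) ^ n" by simp
      then show ?thesis unfolding power_Suc by linarith
    qed
    have "\<not> order_at_most (top_of_set X) x 4"
    proof
      assume "order_at_most (top_of_set X) x 4"
      from order_at_most_mono[OF this big] show False using x(2) by contradiction
    qed
    then obtain k where k: "x = P k hub" using order_cases[OF x(1)] by blast
    define i where "i = group_of (size_code A) k"
    have c: "card {j. group_of (size_code A) j = group_of (size_code A) k} = size_code A i" using card by (simp add: i_def)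
    have upper: "order_at_most (top_of_set X) x (4 * size_code A i)" using order_hub[of k] unfolding k c .
    have lo: "2 * size_code A i \<le> 4 * 8 ^ Suc n" using order_hub_lower[of k] x(3) unfolding k c by blast
    have gt: "2 * 8 ^ Suc n - 1 < 4 * size_code A i" proof (rule ccontr)
      assume "\<not> 2 * 8 ^ Suc n - 1 < 4 * size_code A i"
      then have "4 * size_code A i \<le> 2 * 8 ^ Suc n - 1" by (rule leI)
      from order_at_most_mono[OF upper this] show False using x(2) by contradiction
    qed
    have "i \<in> A"
    proof (rule ccontr)
      assume "i \<notin> A"
      then show False using gt big by (simp add: size_code_def)
    qed
    then have sz: "size_code A i = 8 ^ Suc i" by (simp add: size_code_def)
    have "i = n"
    proof (rule ccontr)
      assume "i \<noteq> n"
      then consider "Suc (Suc n) \<le> Suc i" | "Suc (Suc i) \<le> Suc n" by linarith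
      then show False
      proof cases
        case 1
        then have "(8::nat) ^ Suc (Suc n) \<le> 8 ^ Suc i" by (intro power_increasing) auto
        then have "8 * (8::nat) ^ Suc n \<le> 8 ^ Suc i" by (simp only: power_Suc)
        moreover have "0 < (8::nat) ^ Suc n" by simp
        ultimately show False using lo unfolding sz by linarith
      next
        case 2
        then have "(8::nat) ^ Suc (Suc i) \<le> 8 ^ Suc n" by (intro power_increasing) auto
        then have "8 * (8::nat) ^ Suc i \<le> 8 ^ Suc n" by (simp only: power_Suc)
        moreover have "0 < (8::nat) ^ Suc i" by simp
        ultimately show False using gt unfolding sz by linarith
      qed
    qed
    then show "n \<in> A" using \<open>i \<in> A\<close> by simp
  qed
qed

lemma necklace_space_homeomorphic_imp_eq:
  assumes "necklace_space cl A homeomorphic_space necklace_space cl B"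
  shows "A = B"
proof -
  have "A \<subseteq> B" if hom: "necklace_space cl A homeomorphic_space necklace_space cl B" for A B
  proof
    fix n assume "n \<in> A"
    then obtain x where x: "x \<in> topspace (necklace_space cl A)"
        "\<not> order_at_most (necklace_space cl A) x (2 * 8 ^ Suc n - 1)" "order_at_most (necklace_space cl A) x (4 * 8 ^ Suc n)"
      using necklace_space_order by blast
    obtain f g where fg: "homeomorphic_maps (necklace_space cl A) (necklace_space cl B) f g"
      using hom homeomorphic_space_def by blast
    then have f: "homeomorphic_map (necklace_space cl A) (necklace_space cl B) f"
      and g: "homeomorphic_map (necklace_space cl B) (necklace_space cl A) g" and gf: "g (f x) = x"
      using x(1) homeomorphic_maps_map by (blast, blast, auto simp: homeomorphic_maps_def)
    have fx: "f x \<in> topspace (necklace_space cl B)" using f x(1) homeomorphic_imp_surjective_map by blast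
    have "order_at_most (necklace_space cl B) (f x) (4 * 8 ^ Suc n)"
      by (rule order_at_most_homeomorphic[OF f x(1,3)])
    moreover have "\<not> order_at_most (necklace_space cl B) (f x) (2 * 8 ^ Suc n - 1)"
      using order_at_most_homeomorphic[OF g fx, of "2 * 8 ^ Suc n - 1"] x(2) gf by auto
    ultimately show "n \<in> B" using necklace_space_order[of n B cl] fx by blast
  qed
  then show ?thesis using assms homeomorphic_space_sym by blast
qed

lemma continuum_many_necklaces:
  assumes "\<And>A. R (necklace_space cl A)"
  shows "continuum_many_nonhomeomorphic R"
proof -
  have "inj (necklace_space cl)"
    by (rule injI) (metis homeomorphic_space_refl necklace_space_homeomorphic_imp_eq)
  then have "range (necklace_space cl) \<approx> (UNIV :: nat set set)"
    by (rule inj_on_image_eqpoll_self)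
  moreover have "pairwise (\<lambda>X Y. \<not> X homeomorphic_space Y) (range (necklace_space cl))"
    using necklace_space_homeomorphic_imp_eq by (auto simp: pairwise_def)
  ultimately show ?thesis unfolding continuum_many_nonhomeomorphic_def
    using assms by (intro exI[of _ "range (necklace_space cl)"]) auto
qed

theorem theorem4p3:
  shows "continuum_many_nonhomeomorphic (\<lambda>X. graph_like_continuum X \<and> omega_cc X) \<and>
         continuum_many_nonhomeomorphic (\<lambda>X. graph_like_continuum X \<and> omega_ac X \<and> \<not> n_cc 2 X)"
proof
  show "continuum_many_nonhomeomorphic (\<lambda>X. graph_like_continuum X \<and> omega_cc X)"
  proof (rule continuum_many_necklaces[of _ True])
    fix A
    interpret necklace "group_of (size_code A)" True by (rule necklace_group_of[OF size_code_ge_1])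
    show "graph_like_continuum (necklace_space True A) \<and> omega_cc (necklace_space True A)"
      unfolding necklace_space_def using graph_like_X omega_cc_X by simp
  qed
  show "continuum_many_nonhomeomorphic (\<lambda>X. graph_like_continuum X \<and> omega_ac X \<and> \<not> n_cc 2 X)"
  proof (rule continuum_many_necklaces[of _ False])
    fix A
    interpret necklace "group_of (size_code A)" False by (rule necklace_group_of[OF size_code_ge_1])
    \<comment> \<open>The bridge is the link from the last bead of group 0 to the first bead of
      group 1.\<close>
    have k: "size_code A 0 - 1 < size_code A 0" using size_code_ge_1[of A 0] by simp
    have "group_of (size_code A) (size_code A 0 - 1) = 0"
      using k by (simp add: group_of_eq_iff[OF size_code_ge_1] offset_def)
    moreover have "group_of (size_code A) (size_code A 0) = 1"
      using size_code_ge_1[of A 1] by (simp add: group_of_eq_iff[OF size_code_ge_1] offset_def)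
    ultimately have "\<not> n_cc 2 (top_of_set X)"
      using not_2cc_X[of "size_code A 0 - 1"] k by simp
    then show "graph_like_continuum (necklace_space False A) \<and> omega_ac (necklace_space False A) \<and> \<not> n_cc 2 (necklace_space False A)"
      unfolding necklace_space_def using graph_like_X omega_ac_X by simp
  qed
qed

end
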